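(* Assume the standing setting below, and let $\psi$ be a positive function, defined for all sufficiently large $q$, which is nonincreasing, bounded, and slowly varying (for each $K>0$, $\psi(Kq)\asymp\psi(q)$ with constants depending on $K$). (i) If $\sum_{q}\frac{\log(q)\,\psi(q)^\delta}{q}<\infty$, then $\mu$-almost every $x\in J$ is badly symbolically approximable with respect to $\psi$. (ii) If $\psi(q)<1$ for all sufficiently large $q$ and $\sum_{q}\frac{\log(q)\,\psi(q)^\delta}{q\,|\log\psi(q)|}=\infty$ (sum over sufficiently large $q$), then $\mu$-almost every $x\in J$ is symbolically well approximable with respect to $\psi$. In particular, for every $\varepsilon>0$, case (i) applies to $\psi(q)=(\log q)^{-(2/\delta+\varepsilon)}$, and case (ii) applies to $\psi(q)=(\log q)^{-2/\delta}$.
   Context: Standing setting: $(u_a)_{a\in E}$ is a rational IFS on $\mathbb{R}$, $u_a(x)=\frac{p_a}{q_a}x+\frac{r_a}{q_a}$ with $p_a\in\{\pm1\}$, $r_a\in\mathbb{Z}$, $q_a\in\mathbb{N}$, $q_a\ge2$, $\#E\ge2$, satisfying the strong separation condition (a closed interval $I$ with the $u_a(I)$ pairwise disjoint subsets of $I$); $\pi(\omega)=\lim_n u_{\omega_1}\circ\cdots\circ u_{\omega_n}(0)$ is the coding map, $J$ the limit set, $\delta$ its Hausdorff dimension, $\mu=\mathcal{H}^\delta|_J/\mathcal{H}^\delta(J)$. Every rational in $J$ has a unique, eventually periodic coding $\omega$. Intrinsic denominator: with $n\ge0$ minimal such that $(\omega_i)_{i>n}$ is periodic and $m\ge1$ its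 minimal period, $q_{\mathrm{int}}:=\big(\prod_{i=1}^n q_{\omega_i}\big)\big(\prod_{i=1}^m q_{\omega_{n+i}}-\prod_{i=1}^m p_{\omega_{n+i}}\big)$. A point $x\in J$ is badly symbolically approximable w.r.t. $\psi$ if there is $\varepsilon>0$ with $|x-p/q|\ge\varepsilon\psi(q_{\mathrm{int}})/q_{\mathrm{int}}$ for all $p/q\in\mathbb{Q}\cap J$; otherwise it is symbolically well approximable w.r.t. $\psi$. *)

theory Defs
  imports "HOL-Analysis.Analysis"
begin

text \<open>The alphabet E is a finite type 'e (E = UNIV). Letter a has data
  p a (= +1 or -1), r a (integer), q a (natural, at least 2), and
  u_a(x) = p_a/q_a * x + r_a/q_a.\<close>

definition ifs_map :: "('e \<Rightarrow> int) \<Rightarrow> ('e \<Rightarrow> nat) \<Rightarrow> ('e \<Rightarrow> int) \<Rightarrow> 'e \<Rightarrow> real \<Rightarrow> real" where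
  "ifs_map p q r a x = of_int (p a) / of_nat (q a) * x + of_int (r a) / of_nat (q a)"

text \<open>Coding map: omega 0, omega 1, ... corresponds to omega_1, omega_2, ... of the paper;
  pi(omega) = lim_n u_{omega_1} o ... o u_{omega_n} (0).\<close>

definition coding_map :: "('e \<Rightarrow> int) \<Rightarrow> ('e \<Rightarrow> nat) \<Rightarrow> ('e \<Rightarrow> int) \<Rightarrow> (nat \<Rightarrow> 'e) \<Rightarrow> real" where
  "coding_map p q r \<omega> = lim (\<lambda>n. foldr (\<lambda>i. ifs_map p q r (\<omega> i)) [0..<n] 0)"

definition limit_set :: "('e \<Rightarrow> int) \<Rightarrow> ('e \<Rightarrow> nat) \<Rightarrow> ('e \<Rightarrow> int) \<Rightarrow> real set" where
  "limit_set p q r = range (coding_map p q r)"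

definition strong_separation :: "('e \<Rightarrow> int) \<Rightarrow> ('e \<Rightarrow> nat) \<Rightarrow> ('e \<Rightarrow> int) \<Rightarrow> bool" where
  "strong_separation p q r \<longleftrightarrow>
     (\<exists>c d::real. c \<le> d \<and> (\<forall>a. ifs_map p q r a ` {c..d} \<subseteq> {c..d}) \<and>
        (\<forall>a b. a \<noteq> b \<longrightarrow> ifs_map p q r a ` {c..d} \<inter> ifs_map p q r b ` {c..d} = {}))"

text \<open>Minimal n such that (omega_i)_{i>n} is periodic (0-indexed: omega i for i >= n),
  and its minimal period m >= 1.\<close>

definition preperiod :: "(nat \<Rightarrow> 'e) \<Rightarrow> nat" where
  "preperiod \<omega> = (LEAST n. \<exists>m\<ge>1. \<forall>i\<ge>n. \<omega> (i + m) = \<omega> i)"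

definition min_period :: "(nat \<Rightarrow> 'e) \<Rightarrow> nat" where
  "min_period \<omega> = (LEAST m. m \<ge> 1 \<and> (\<forall>i\<ge>preperiod \<omega>. \<omega> (i + m) = \<omega> i))"

definition qint_of_coding :: "('e \<Rightarrow> int) \<Rightarrow> ('e \<Rightarrow> nat) \<Rightarrow> (nat \<Rightarrow> 'e) \<Rightarrow> int" where
  "qint_of_coding p q \<omega> =
     (\<Prod>i<preperiod \<omega>. int (q (\<omega> i))) *
     ((\<Prod>i<min_period \<omega>. int (q (\<omega> (preperiod \<omega> + i))))
       - (\<Prod>i<min_period \<omega>. p (\<omega> (preperiod \<omega> + i))))"

text \<open>Intrinsic denominator of a rational y in J, computed from its (unique) coding.\<close>

definition intrinsic_denom :: "('e \<Rightarrow> int) \<Rightarrow> ('e \<Rightarrow> nat) \<Rightarrow> ('e \<Rightarrow> int) \<Rightarrow> real \<Rightarrow> int" where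
  "intrinsic_denom p q r y = qint_of_coding p q (SOME \<omega>. coding_map p q r \<omega> = y)"

definition badly_sym_approx ::
  "('e \<Rightarrow> int) \<Rightarrow> ('e \<Rightarrow> nat) \<Rightarrow> ('e \<Rightarrow> int) \<Rightarrow> (real \<Rightarrow> real) \<Rightarrow> real \<Rightarrow> bool" where
  "badly_sym_approx p q r \<psi> x \<longleftrightarrow>
     (\<exists>\<epsilon>>0. \<forall>y \<in> \<rat> \<inter> limit_set p q r.
        \<bar>x - y\<bar> \<ge> \<epsilon> * \<psi> (of_int (intrinsic_denom p q r y)) / of_int (intrinsic_denom p q r y))"

definition sym_well_approx ::
  "('e \<Rightarrow> int) \<Rightarrow> ('e \<Rightarrow> nat) \<Rightarrow> ('e \<Rightarrow> int) \<Rightarrow> (real \<Rightarrow> real) \<Rightarrow> real \<Rightarrow> bool" where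
  "sym_well_approx p q r \<psi> x \<longleftrightarrow> \<not> badly_sym_approx p q r \<psi> x"

definition cover_term :: "real \<Rightarrow> real set \<Rightarrow> ennreal" where
  "cover_term s U = (if U = {} then 0 else if s = 0 then 1 else ennreal (diameter U powr s))"

definition hausdorff_content :: "real \<Rightarrow> real \<Rightarrow> real set \<Rightarrow> ennreal" where
  "hausdorff_content s \<epsilon> A =
     (INF U \<in> {U :: nat \<Rightarrow> real set. A \<subseteq> (\<Union>i. U i) \<and> (\<forall>i. bounded (U i) \<and> diameter (U i) \<le> \<epsilon>)}.
        (\<Sum>i. cover_term s (U i)))"

definition hausdorff_outer :: "real \<Rightarrow> real set \<Rightarrow> ennreal" where
  "hausdorff_outer s A = (SUP \<epsilon> \<in> {0<..}. hausdorff_content s \<epsilon> A)"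

definition hausdorff_dim :: "real set \<Rightarrow> real" where
  "hausdorff_dim A = Inf {s. 0 \<le> s \<and> hausdorff_outer s A = 0}"

text \<open>mu-almost every x in A, where mu is the normalised restriction of H^s to A:
  the exceptional points of A form an H^s-null set.\<close>

definition hausdorff_ae :: "real \<Rightarrow> real set \<Rightarrow> (real \<Rightarrow> bool) \<Rightarrow> bool" where
  "hausdorff_ae s A P \<longleftrightarrow> (\<exists>N. hausdorff_outer s N = 0 \<and> (\<forall>x \<in> A - N. P x))"

definition admissible_psi :: "(real \<Rightarrow> real) \<Rightarrow> bool" where
  "admissible_psi \<psi> \<longleftrightarrow>
     (\<forall>\<^sub>F t in at_top. \<psi> t > 0) \<and>
     (\<exists>T. \<forall>s t. T \<le> s \<longrightarrow> s \<le> t \<longrightarrow> \<psi> t \<le> \<psi> s) \<and>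
     (\<exists>B. \<forall>\<^sub>F t in at_top. \<psi> t \<le> B) \<and>
     (\<forall>K>0. \<exists>c C. c > 0 \<and> C > 0 \<and>
        (\<forall>\<^sub>F t in at_top. c * \<psi> t \<le> \<psi> (K * t) \<and> \<psi> (K * t) \<le> C * \<psi> t))"

end

theory Submission
  imports Defs "HOL-Real_Asymp.Real_Asymp"
begin

text \<open>
  Let \<open>s\<close> solve \<open>\<Sum>\<^sub>a q\<^sub>a powr (-s) = 1\<close>, so that \<open>W w = Q w powr (-s)\<close>, with \<open>Q w\<close> the product of
  the \<open>q\<close>'s of the letters of \<open>w\<close>, is the Bernoulli weight of the word \<open>w\<close>; then \<open>\<delta> = s\<close>. Only
  finite sums of these weights are needed: no measure on the sequence space is constructed.

  Convergence: the rational point with preperiod \<open>v\<close> and period \<open>w\<close> has intrinsic denominator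
  comparable to \<open>Q v * Q w \<ge> 2 ^ (length v + length w)\<close>. Summing the diameters of the balls around
  these points, raised to the power \<open>s\<close>, over all pairs with \<open>length v + length w = k\<close> gives about
  \<open>k * \<psi> (2 ^ k) powr s\<close>, and the condensed series converges.

  Divergence: a point whose coding repeats at position \<open>N\<close> a word \<open>w\<close> with \<open>Q w\<close> of order
  \<open>1 / \<psi>\<close> seen at an earlier position is well approximated by the rational point obtained by closing
  up the period. Split the coding into the independent stages \<open>[2 ^ j, 2 ^ (j + 1))\<close>. Within a
  stage compare the words starting at all positions of the first part with disjoint blocks of the
  second part, spaced by the word length (of order \<open>\<bar>ln \<psi>\<bar>\<close>). By Bonferroni's inequality a match
  has weight of order at least \<open>min 1 (4 ^ j * \<psi> powr s / \<bar>ln \<psi>\<bar>)\<close>, whose sum diverges. Hence the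
  cylinders without a match in the stages \<open>J, ..., J + k\<close> have total weight tending to \<open>0\<close>, and they
  cover the exceptional set.
\<close>

subsection \<open>Hausdorff null sets\<close>

text \<open>The square of the logarithm in the critical rate counts pairs. In the convergence half a
  word of length \<open>k\<close> splits in \<open>k\<close> ways into preperiod and period, and
  \<open>k\<close> is at most of order log q. In the divergence half a stage has about
  \<open>4 ^ j\<close> pairs of positions, and the sum of log q / q over the block of q with log q
  of order \<open>2 ^ j\<close> has the same order. Dividing by \<bar>log \<psi>\<bar> in (ii) is
  the price of spacing the later words so that they are independent.

  Two obstacles shape the matching argument. Words of one length can have very different weights, so
  words are compared after being cut where \<open>Q\<close> first reaches a threshold; all cuts then
  have comparable weight. And the earlier words overlap, so their coincidences are not independent;
  but a word that coincides with an overlapping shift of itself is determined by periodicity, which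
  yields the bound that independence would give.\<close>

lemma hausdorff_content_le:
  fixes U :: "'i::countable \<Rightarrow> real set"
  assumes s: "s > 0" and cov: "A \<subseteq> (\<Union>i\<in>I. U i)" and eps: "\<epsilon> \<ge> 0"
    and U: "\<And>i. i \<in> I \<Longrightarrow> bounded (U i) \<and> diameter (U i) \<le> d i \<and> d i \<le> \<epsilon>"
    and B: "\<And>F. finite F \<Longrightarrow> F \<subseteq> I \<Longrightarrow> (\<Sum>i\<in>F. d i powr s) \<le> B"
  shows "hausdorff_content s \<epsilon> A \<le> ennreal B"
proof -
  define V where "V n = (if n \<in> to_nat ` I then U (from_nat n) else {})" for n
  have V: "A \<subseteq> (\<Union>n. V n)" "\<And>n. bounded (V n) \<and> diameter (V n) \<le> \<epsilon>"
  proof -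
    show "A \<subseteq> (\<Union>n. V n)"
    proof
      fix x assume "x \<in> A"
      then obtain i where "i \<in> I" "x \<in> U i" using cov by auto
      then have "x \<in> V (to_nat i)" by (auto simp: V_def)
      then show "x \<in> (\<Union>n. V n)" by blast
    qed
    show "bounded (V n) \<and> diameter (V n) \<le> \<epsilon>" for n
      using U eps by (fastforce simp: V_def)
  qed
  have termle: "cover_term s (V (to_nat i)) \<le> ennreal (d i powr s)" if "i \<in> I" for i
  proof -
    have "diameter (U i) powr s \<le> d i powr s"
      using U[OF that] s diameter_ge_0[of "U i"] by (intro powr_mono2) auto
    then show ?thesis using s that by (auto simp: cover_term_def V_def ennreal_leI)
  qed
  have "(\<Sum>n<N. cover_term s (V n)) \<le> ennreal B" for N
  proof -
    define F where "F = {i\<in>I. to_nat i < N}"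
    have "finite F"
      by (rule finite_imageD[of to_nat]) (auto simp: F_def intro: finite_subset[of _ "{..<N}"])
    have "(\<Sum>n<N. cover_term s (V n)) = (\<Sum>n\<in>to_nat ` F. cover_term s (V n))"
      by (rule sum.mono_neutral_right) (auto simp: F_def V_def cover_term_def)
    also have "\<dots> = (\<Sum>i\<in>F. cover_term s (V (to_nat i)))"
      by (subst sum.reindex) auto
    also have "\<dots> \<le> (\<Sum>i\<in>F. ennreal (d i powr s))"
      by (rule sum_mono) (auto simp: F_def intro: termle)
    also have "\<dots> = ennreal (\<Sum>i\<in>F. d i powr s)" by simp
    also have "\<dots> \<le> ennreal B" using B[OF \<open>finite F\<close>] by (auto simp: F_def intro!: ennreal_leI)
    finally show ?thesis .
  qed
  then have "(\<Sum>n. cover_term s (V n)) \<le> ennreal B"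
    by (intro suminf_le_const) auto
  moreover have "hausdorff_content s \<epsilon> A \<le> (\<Sum>n. cover_term s (V n))"
    unfolding hausdorff_content_def by (rule INF_lower) (use V in auto)
  ultimately show ?thesis by simp
qed

lemma hausdorff_outer_eq_0I:
  assumes "\<And>\<epsilon> \<eta>. 0 < \<epsilon> \<Longrightarrow> 0 < \<eta> \<Longrightarrow> hausdorff_content s \<epsilon> A \<le> ennreal \<eta>"
  shows "hausdorff_outer s A = 0"
proof -
  have "hausdorff_content s \<epsilon> A = 0" if "\<epsilon> > 0" for \<epsilon>
  proof -
    have "hausdorff_content s \<epsilon> A \<le> 0"
      by (rule ennreal_le_epsilon) (use assms[OF that] in simp)
    then show ?thesis by simp
  qed
  then show ?thesis
    unfolding hausdorff_outer_def by (simp add: SUP_eq_const)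
qed

lemma hausdorff_outer_null_UN:
  fixes A :: "nat \<Rightarrow> real set"
  assumes "\<And>n. hausdorff_outer s (A n) = 0"
  shows "hausdorff_outer s (\<Union>n. A n) = 0"
proof (rule hausdorff_outer_eq_0I)
  fix \<epsilon> \<eta> :: real assume eps: "0 < \<epsilon>" and eta: "0 < \<eta>"
  have "\<exists>U. A n \<subseteq> (\<Union>i. U i) \<and> (\<forall>i. bounded (U i) \<and> diameter (U i) \<le> \<epsilon>)
          \<and> (\<Sum>i. cover_term s (U i)) \<le> ennreal (\<eta> * (1/2) ^ Suc n)" for n
  proof -
    have "hausdorff_content s \<epsilon> (A n) \<le> hausdorff_outer s (A n)"
      unfolding hausdorff_outer_def by (rule SUP_upper) (use eps in auto)
    then have "hausdorff_content s \<epsilon> (A n) < ennreal (\<eta> * (1/2) ^ Suc n)"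
      using assms[of n] eta by (simp add: ennreal_zero_less_mult_iff)
    then show ?thesis
      unfolding hausdorff_content_def INF_less_iff by (auto intro: less_imp_le)
  qed
  then obtain U where U: "\<And>n. A n \<subseteq> (\<Union>i. U n i)"
      "\<And>n i. bounded (U n i) \<and> diameter (U n i) \<le> \<epsilon>"
      "\<And>n. (\<Sum>i. cover_term s (U n i)) \<le> ennreal (\<eta> * (1/2) ^ Suc n)" by metis
  define V where "V k = (case prod_decode k of (n, i) \<Rightarrow> U n i)" for k
  have cov: "(\<Union>n. A n) \<subseteq> (\<Union>k. V k)"
  proof
    fix x assume "x \<in> (\<Union>n. A n)"
    then obtain n where "x \<in> A n" by auto
    with U(1)[of n] obtain i where "x \<in> U n i" by auto
    then have "x \<in> V (prod_encode (n, i))" by (simp add: V_def)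
    then show "x \<in> (\<Union>k. V k)" by (rule UN_I[OF UNIV_I])
  qed
  have V: "bounded (V k) \<and> diameter (V k) \<le> \<epsilon>" for k
    using U(2) by (simp add: V_def split: prod.split)
  have "hausdorff_content s \<epsilon> (\<Union>n. A n) \<le> (\<Sum>k. cover_term s (V k))"
    unfolding hausdorff_content_def
    by (rule INF_lower) (use V cov in simp)
  also have "\<dots> = (\<Sum>n. \<Sum>i. cover_term s (U n i))"
    using suminf_ennreal_2dimen[of "\<lambda>n. \<Sum>i. cover_term s (U n i)" "\<lambda>(n,i). cover_term s (U n i)"]
    by (simp add: V_def case_prod_beta)
  also have "\<dots> \<le> (\<Sum>n. ennreal (\<eta> * (1/2) ^ Suc n))"
    by (intro suminf_le U(3)) auto
  also have "\<dots> = ennreal \<eta>"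
  proof (rule suminf_ennreal_eq)
    show "(\<lambda>n. \<eta> * (1/2) ^ Suc n) sums \<eta>"
      using sums_mult[OF power_half_series, of \<eta>] by simp
  qed (use eta in simp)
  finally show "hausdorff_content s \<epsilon> (\<Union>n. A n) \<le> ennreal \<eta>" .
qed

lemma hausdorff_outer_null_countable:
  assumes "countable A" "s > 0" shows "hausdorff_outer s A = 0"
proof (cases "A = {}")
  case True
  show ?thesis
    by (rule hausdorff_outer_eq_0I, rule hausdorff_content_le[where I = "{}::nat set"])
       (use assms True in auto)
next
  case False
  have "hausdorff_outer s {x} = 0" for x
    by (rule hausdorff_outer_eq_0I,
        rule hausdorff_content_le[where I = "UNIV::unit set" and U = "\<lambda>_. {x}" and d = "\<lambda>_. 0"])
       (use assms in auto)
  then have "hausdorff_outer s (\<Union>n. {from_nat_into A n}) = 0"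
    by (rule hausdorff_outer_null_UN)
  then show ?thesis
    using range_from_nat_into[OF False assms(1)] by (simp add: UNION_singleton_eq_range)
qed

subsection \<open>Words, weights and the coding map\<close>

definition words :: "nat \<Rightarrow> 'e list set" where
  "words n = {xs. length xs = n}"

lemma words_iff [simp]: "xs \<in> words n \<longleftrightarrow> length xs = n"
  by (simp add: words_def)

lemma words_0 [simp]: "words 0 = {[]}"
  by (auto simp: words_def)

lemma finite_words [simp, intro]: "finite (words n :: 'e::finite list set)"
  using finite_lists_length_eq[of "UNIV :: 'e set" n] by (simp add: words_def)

text \<open>For the multiplicative weights \<open>W\<close> this is the independence of consecutive
  blocks of letters; it plays the role of Fubini's theorem.\<close>

lemma sum_words_add:
  fixes f :: "'e::finite list \<Rightarrow> 'b::comm_monoid_add"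
  shows "sum f (words (m + n)) = (\<Sum>x\<in>words m. \<Sum>y\<in>words n. f (x @ y))"
proof -
  have "bij_betw (\<lambda>(x, y). x @ y) (words m \<times> words n) (words (m + n) :: 'e list set)"
    by (rule bij_betw_byWitness[where f' = "\<lambda>z. (take m z, drop m z)"]) auto
  from sum.reindex_bij_betw[OF this, of f]
  show ?thesis by (simp add: sum.cartesian_product case_prod_beta')
qed

lemma sum_words_Suc:
  fixes f :: "'e::finite list \<Rightarrow> 'b::comm_monoid_add"
  shows "sum f (words (Suc n)) = (\<Sum>a\<in>UNIV. \<Sum>y\<in>words n. f (a # y))"
proof -
  have "bij_betw (\<lambda>(a, y). a # y) (UNIV \<times> words n) (words (Suc n) :: 'e list set)"
    by (rule bij_betw_byWitness[where f' = "\<lambda>z. (hd z, tl z)"]) (auto simp: length_Suc_conv)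
  from sum.reindex_bij_betw[OF this, of f]
  show ?thesis by (simp add: sum.cartesian_product case_prod_beta')
qed

lemma upt_add_split: "map \<omega> [0..<m + n] = map \<omega> [0..<m] @ map (\<lambda>i. \<omega> (m + i)) [0..<n]"
  by (rule nth_equalityI) (auto simp: nth_append)

text \<open>\<open>{c..d}\<close> is the invariant interval of the strong separation condition,
  \<open>g\<close> a uniform distance between distinct first-level images of it, and
  \<open>moran\<close> is Moran's equation for the dimension.\<close>

locale rational_ifs =
  fixes p r :: "'e::finite \<Rightarrow> int" and q :: "'e \<Rightarrow> nat" and c d g s :: real and b :: nat
  assumes p_unit: "p a = 1 \<or> p a = -1"
    and q_ge2: "2 \<le> q a" and q_le: "q a \<le> b"
    and cd: "c < d"
    and ifs_map_in: "x \<in> {c..d} \<Longrightarrow> ifs_map p q r a x \<in> {c..d}"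
    and g_pos: "0 < g"
    and gap: "a \<noteq> a' \<Longrightarrow> x \<in> {c..d} \<Longrightarrow> y \<in> {c..d} \<Longrightarrow>
      g \<le> \<bar>ifs_map p q r a x - ifs_map p q r a' y\<bar>"
    and s_pos: "0 < s"
    and moran: "(\<Sum>a\<in>UNIV. real (q a) powr (-s)) = 1"
begin

definition Q :: "'e list \<Rightarrow> real" where
  "Q w = (\<Prod>a\<leftarrow>w. real (q a))"

definition u :: "'e list \<Rightarrow> real \<Rightarrow> real" where
  "u w = foldr (ifs_map p q r) w"

abbreviation cm :: "(nat \<Rightarrow> 'e) \<Rightarrow> real" where
  "cm \<equiv> coding_map p q r"

abbreviation W :: "'e list \<Rightarrow> real" where
  "W w \<equiv> Q w powr (-s)"

lemma b_ge2: "2 \<le> b"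
  using q_ge2 q_le order_trans by blast

lemma Q_simps [simp]: "Q [] = 1" "Q (a # w) = real (q a) * Q w" "Q (v @ w) = Q v * Q w"
  by (simp_all add: Q_def)

lemma Q_ge: "2 ^ length w \<le> Q w"
proof (induction w)
  case (Cons a w)
  have "2 * 2 ^ length w \<le> real (q a) * Q w"
    using Cons q_ge2[of a] by (intro mult_mono) auto
  then show ?case by simp
qed simp

lemma Q_ge1: "1 \<le> Q w"
  using Q_ge[of w] one_le_power[of "2::real" "length w"] by linarith

lemma Q_pos [simp]: "0 < Q w"
  using Q_ge1[of w] by linarith

lemma Q_nonneg [simp]: "0 \<le> Q w" and Q_neq_0 [simp]: "Q w \<noteq> 0"
  using Q_pos[of w] by linarith+

lemma Q_le: "Q w \<le> real b ^ length w"
proof (induction w)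
  case (Cons a w)
  have "real (q a) * Q w \<le> real b * real b ^ length w"
    using Cons q_le[of a] by (intro mult_mono) auto
  then show ?case by simp
qed simp

lemma W_append: "W (v @ w) = W v * W w"
  by (simp add: powr_mult)

lemma sum_W: "(\<Sum>w\<in>words n. W w) = 1"
proof (induction n)
  case (Suc n)
  then show ?case
    by (simp add: sum_words_Suc powr_mult moran flip: sum_distrib_left)
qed simp

section \<open>Contraction of the branches and the coding map\<close>

lemma u_simps [simp]: "u [] x = x" "u (a # w) x = ifs_map p q r a (u w x)"
  "u (v @ w) x = u v (u w x)"
  by (simp_all add: u_def)

lemma u_diff: "\<bar>u w x - u w y\<bar> = \<bar>x - y\<bar> / Q w"
proof (induction w)
  case (Cons a w)
  have "u (a # w) x - u (a # w) y = of_int (p a) / real (q a) * (u w x - u w y)"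
    by (simp add: ifs_map_def algebra_simps)
  moreover have "\<bar>of_int (p a) / real (q a)\<bar> = 1 / real (q a)"
    using p_unit[of a] by auto
  ultimately have "\<bar>u (a # w) x - u (a # w) y\<bar> = 1 / real (q a) * (\<bar>x - y\<bar> / Q w)"
    using Cons by (simp only: abs_mult)
  then show ?case by simp
qed simp

lemma u_in: "x \<in> {c..d} \<Longrightarrow> u w x \<in> {c..d}"
  by (induction w) (use ifs_map_in in auto)

lemma u_diff_tendsto_0: "(\<lambda>n. u (map \<omega> [0..<n]) x - u (map \<omega> [0..<n]) y) \<longlonglongrightarrow> 0"
proof (rule Lim_null_comparison)
  show "\<forall>\<^sub>F n in sequentially. norm (u (map \<omega> [0..<n]) x - u (map \<omega> [0..<n]) y)
      \<le> \<bar>x - y\<bar> * (1/2) ^ n"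
  proof (rule eventuallyI)
    fix n
    have "\<bar>x - y\<bar> / Q (map \<omega> [0..<n]) \<le> \<bar>x - y\<bar> / 2 ^ n"
      using Q_ge[of "map \<omega> [0..<n]"] by (intro divide_left_mono) auto
    then show "norm (u (map \<omega> [0..<n]) x - u (map \<omega> [0..<n]) y) \<le> \<bar>x - y\<bar> * (1/2) ^ n"
      by (simp add: u_diff field_simps)
  qed
  show "(\<lambda>n. \<bar>x - y\<bar> * (1/2) ^ n) \<longlonglongrightarrow> 0"
    by (intro tendsto_mult_right_zero LIMSEQ_power_zero) auto
qed

lemma u_prefix_tendsto: "(\<lambda>n. u (map \<omega> [0..<n]) x) \<longlonglongrightarrow> cm \<omega>"
proof -
  \<comment> \<open>The base point \<open>c\<close> lies in the invariant interval, so consecutive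
    terms are close. The point 0 of the definition need not lie there;
    \<open>u_diff_tendsto_0\<close> transfers the limit to every base point.\<close>
  define f where "f n = u (map \<omega> [0..<n]) c" for n
  have c: "c \<in> {c..d}" using cd by auto
  have step: "norm (f (Suc n) - f n) \<le> (d - c) * (1/2) ^ n" for n
  proof -
    have "\<bar>f (Suc n) - f n\<bar> = \<bar>ifs_map p q r (\<omega> n) c - c\<bar> / Q (map \<omega> [0..<n])"
      by (simp add: f_def u_diff)
    also have "\<dots> \<le> (d - c) / 2 ^ n"
      using Q_ge[of "map \<omega> [0..<n]"] ifs_map_in[OF c, of "\<omega> n"]
      by (intro frac_le) auto
    finally show ?thesis by (simp add: field_simps)
  qed
  have "summable (\<lambda>n. (d - c) * (1/2::real) ^ n)"
    by (intro summable_mult summable_geometric) auto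
  then have "summable (\<lambda>n. f (Suc n) - f n)"
    by (rule summable_comparison_test'[where N = 0]) (rule step)
  then have "convergent f" by (simp only: telescope_summable' summable_iff_convergent sum_lessThan_telescope
     convergent_diff_const_right_iff)
  then obtain l where l: "f \<longlonglongrightarrow> l" by (auto simp: convergent_def)
  have lim: "(\<lambda>n. u (map \<omega> [0..<n]) y) \<longlonglongrightarrow> l" for y
    using tendsto_add[OF u_diff_tendsto_0[of \<omega> y c] l] by (simp add: f_def)
  have "cm \<omega> = l"
    unfolding coding_map_def
    using lim[of 0] by (intro limI) (simp add: u_def foldr_map o_def)
  with lim show ?thesis by simp
qed

lemma cm_in: "cm \<omega> \<in> {c..d}"
  using cd by (intro closed_sequentially[OF _ _ u_prefix_tendsto[of \<omega> c]] allI u_in) auto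

lemma u_isCont: "isCont (u w) x"
proof (induction w)
  case (Cons a w)
  then show ?case unfolding u_simps ifs_map_def by (intro continuous_intros)
qed (simp add: u_def)

lemma cm_shift: "cm \<omega> = u (map \<omega> [0..<m]) (cm (\<lambda>i. \<omega> (m + i)))"
proof -
  have "(\<lambda>n. u (map \<omega> [0..<m]) (u (map (\<lambda>i. \<omega> (m + i)) [0..<n]) 0))
      \<longlonglongrightarrow> u (map \<omega> [0..<m]) (cm (\<lambda>i. \<omega> (m + i)))"
    by (rule isCont_tendsto_compose[OF u_isCont u_prefix_tendsto])
  moreover have "(\<lambda>n. u (map \<omega> [0..<n + m]) 0) \<longlonglongrightarrow> cm \<omega>"
    by (rule LIMSEQ_ignore_initial_segment[OF u_prefix_tendsto])
  ultimately show ?thesis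
    by (simp add: add.commute[of _ m] upt_add_split LIMSEQ_unique del: upt_Suc)
qed

lemma cm_close:
  assumes "map \<omega> [0..<n] = map \<eta> [0..<n]"
  shows "\<bar>cm \<omega> - cm \<eta>\<bar> \<le> (d - c) / Q (map \<omega> [0..<n])"
proof -
  have "\<bar>cm \<omega> - cm \<eta>\<bar> = \<bar>cm (\<lambda>i. \<omega> (n + i)) - cm (\<lambda>i. \<eta> (n + i))\<bar> / Q (map \<omega> [0..<n])"
    by (simp add: cm_shift[of \<omega> n] cm_shift[of \<eta> n] assms u_diff)
  also have "\<dots> \<le> (d - c) / Q (map \<omega> [0..<n])"
    using cm_in[of "\<lambda>i. \<omega> (n + i)"] cm_in[of "\<lambda>i. \<eta> (n + i)"]
    by (intro divide_right_mono) auto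
  finally show ?thesis .
qed

text \<open>Counterpart of \<open>cm_close\<close>: once the common prefix is removed the first
  letters differ, so \<open>gap\<close> applies. Distances in the limit set are thus comparable with
  \<open>1 / Q\<close> of the longest common prefix.\<close>

lemma cm_apart:
  assumes "map \<omega> [0..<n] = map \<eta> [0..<n]" "\<omega> n \<noteq> \<eta> n"
  shows "g / Q (map \<omega> [0..<n]) \<le> \<bar>cm \<omega> - cm \<eta>\<bar>"
proof -
  have "\<bar>cm \<omega> - cm \<eta>\<bar> = \<bar>cm (\<lambda>i. \<omega> (n + i)) - cm (\<lambda>i. \<eta> (n + i))\<bar> / Q (map \<omega> [0..<n])"
    by (simp add: cm_shift[of \<omega> n] cm_shift[of \<eta> n] assms u_diff)
  moreover have "g \<le> \<bar>cm (\<lambda>i. \<omega> (n + i)) - cm (\<lambda>i. \<eta> (n + i))\<bar>"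
    using gap[OF assms(2) cm_in cm_in] cm_shift[of "\<lambda>i. \<omega> (n + i)" 1] cm_shift[of "\<lambda>i. \<eta> (n + i)" 1]
    by simp
  ultimately show ?thesis by (simp add: divide_right_mono)
qed

lemma first_difference:
  assumes "\<omega> \<noteq> (\<eta> :: nat \<Rightarrow> 'e)"
  obtains n where "map \<omega> [0..<n] = map \<eta> [0..<n]" "\<omega> n \<noteq> \<eta> n"
proof -
  define n where "n = (LEAST n. \<omega> n \<noteq> \<eta> n)"
  have "\<exists>n. \<omega> n \<noteq> \<eta> n" using assms by auto
  then have "\<omega> n \<noteq> \<eta> n" unfolding n_def by (rule LeastI_ex)
  moreover have "\<omega> i = \<eta> i" if "i < n" for i
    using not_less_Least[of i "\<lambda>n. \<omega> n \<noteq> \<eta> n"] that by (auto simp: n_def)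
  ultimately show ?thesis using that[of n] by auto
qed

lemma cm_inj: "cm \<omega> = cm \<eta> \<Longrightarrow> \<omega> = \<eta>"
proof (rule ccontr)
  assume eq: "cm \<omega> = cm \<eta>" and "\<omega> \<noteq> \<eta>"
  then obtain n where "map \<omega> [0..<n] = map \<eta> [0..<n]" "\<omega> n \<noteq> \<eta> n"
    using first_difference by metis
  from cm_apart[OF this] eq have "g / Q (map \<omega> [0..<n]) \<le> 0" by simp
  with g_pos Q_pos show False by (meson divide_pos_pos not_le)
qed

lemma intrinsic_denom_cm: "intrinsic_denom p q r (cm \<omega>) = qint_of_coding p q \<omega>"
proof -
  have "(SOME \<eta>. cm \<eta> = cm \<omega>) = \<omega>"
    by (rule some_equality) (auto dest: cm_inj)
  then show ?thesis by (simp add: intrinsic_denom_def)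
qed

lemma limit_set_iff: "x \<in> limit_set p q r \<longleftrightarrow> (\<exists>\<omega>. x = cm \<omega>)"
  by (auto simp: limit_set_def)

definition cyl :: "'e list \<Rightarrow> real set" where
  "cyl w = {cm \<omega> | \<omega>. map \<omega> [0..<length w] = w}"

lemma cyl_bounded: "bounded (cyl w)"
  by (rule bounded_subset[of "{c..d}"]) (use cm_in in \<open>auto simp: cyl_def\<close>)

lemma diameter_cyl: "diameter (cyl w) \<le> (d - c) / Q w"
proof (rule diameter_le)
  show "cyl w \<noteq> {} \<or> 0 \<le> (d - c) / Q w" using cd by simp
next
  fix x y assume "x \<in> cyl w" "y \<in> cyl w"
  then obtain \<omega> \<eta> where "x = cm \<omega>" "y = cm \<eta>"
      "map \<omega> [0..<length w] = w" "map \<eta> [0..<length w] = w" by (auto simp: cyl_def)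
  then show "norm (x - y) \<le> (d - c) / Q w"
    using cm_close[of \<omega> "length w" \<eta>] by simp
qed

end

subsection \<open>The dimension of the limit set\<close>

lemma power_powr_swap: "0 < x \<Longrightarrow> (x ^ n) powr a = (x powr a) ^ n" for x :: real
  by (induction n) (simp_all add: powr_mult)

context rational_ifs
begin

text \<open>The weight argument replacing the mass distribution principle: if the cylinders below
  \<open>v\<close> have total weight less than \<open>W v\<close>, the same holds below one of the children of \<open>v\<close>;
  following such children produces a sequence that avoids every cylinder.\<close>

lemma cylinder_cover_weight:
  fixes w :: "nat \<Rightarrow> 'e list"
  assumes cov: "\<And>\<omega>. \<exists>i. map \<omega> [0..<length (w i)] = w i"
  shows "1 \<le> (\<Sum>i. ennreal (W (w i)))"
proof (rule ccontr)
  assume "\<not> ?thesis"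
  then have lt1: "(\<Sum>i. ennreal (W (w i))) < 1" by simp
  \<comment> \<open>\<open>h v i\<close> is the weight of \<open>w i\<close> if \<open>v\<close> is
    a prefix of it, so \<open>G v\<close> is the total weight of the given cylinders below
    \<open>v\<close>.\<close>
  define h where "h v i = (if take (length v) (w i) = v then ennreal (W (w i)) else 0)" for v i
  define G where "G v = (\<Sum>i. h v i)" for v
  have step: "\<exists>a. G (v @ [a]) < ennreal (W (v @ [a]))" if v: "G v < ennreal (W v)" for v
  proof (rule ccontr)
    assume "\<not> ?thesis"
    then have ge: "ennreal (W (v @ [a])) \<le> G (v @ [a])" for a by (simp add: not_less)
    \<comment> \<open>A word \<open>w i\<close> properly extending \<open>v\<close> lies below
      exactly one child of \<open>v\<close>; any other word lies below none.\<close>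
    have le: "(\<Sum>a\<in>UNIV. h (v @ [a]) i) \<le> h v i" for i
    proof (cases "length v < length (w i) \<and> take (length v) (w i) = v")
      case True
      then have "take (Suc (length v)) (w i) = v @ [a] \<longleftrightarrow> a = w i ! length v" for a
        by (auto simp: take_Suc_conv_app_nth)
      then have "(\<Sum>a\<in>UNIV. h (v @ [a]) i) = (\<Sum>a\<in>UNIV. if a = w i ! length v then ennreal (W (w i)) else 0)"
        by (simp add: h_def)
      also have "\<dots> = h v i" using True by (simp add: h_def)
      finally show ?thesis by simp
    next
      case False
      have "h (v @ [a]) i = 0" for a
      proof -
        have "take (Suc (length v)) (w i) \<noteq> v @ [a]"
        proof
          assume eq: "take (Suc (length v)) (w i) = v @ [a]"
          have "length (take (Suc (length v)) (w i)) = Suc (length v)" by (simp only: eq) simp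
          then have "length v < length (w i)" by (simp add: min_def split: if_splits)
          moreover have "take (length v) (w i) = v"
            using arg_cong[OF eq, of "take (length v)"] by simp
          ultimately show False using False by simp
        qed
        then show ?thesis by (simp add: h_def)
      qed
      then show ?thesis by simp
    qed
    have "ennreal (W v) = (\<Sum>a\<in>UNIV. ennreal (W (v @ [a])))"
    proof -
      have "W v = (\<Sum>a\<in>UNIV. W (v @ [a]))"
        by (simp add: powr_mult moran flip: sum_distrib_left)
      then show ?thesis by simp
    qed
    also have "\<dots> \<le> (\<Sum>a\<in>UNIV. G (v @ [a]))" by (intro sum_mono ge)
    also have "\<dots> = (\<Sum>i. \<Sum>a\<in>UNIV. h (v @ [a]) i)"
      unfolding G_def by (rule suminf_sum[symmetric]) simp
    also have "\<dots> \<le> G v" unfolding G_def by (intro suminf_le le) auto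
    finally show False using v by simp
  qed
  define nxt where "nxt v = (SOME a. G (v @ [a]) < ennreal (W (v @ [a])))" for v
  define V where "V = rec_nat [] (\<lambda>_ v. v @ [nxt v])"
  define \<omega> where "\<omega> n = nxt (V n)" for n
  have V: "V n = map \<omega> [0..<n]" for n
    by (induction n) (auto simp: V_def \<omega>_def)
  have small: "G (V n) < ennreal (W (V n))" for n
  proof (induction n)
    case 0
    then show ?case using lt1 by (simp add: V_def G_def h_def)
  next
    case (Suc n)
    have "V (Suc n) = V n @ [nxt (V n)]" by (simp add: V_def)
    then show ?case unfolding nxt_def using someI_ex[OF step[OF Suc]] by simp
  qed
  from cov obtain i where i: "map \<omega> [0..<length (w i)] = w i" by blast
  \<comment> \<open>The constructed sequence passes through the node \<open>w i\<close>, where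
    \<open>G\<close> is at least \<open>W (w i)\<close>, against \<open>small\<close>.\<close>
  have "ennreal (W (w i)) = h (w i) i" by (simp add: h_def)
  also have "\<dots> \<le> G (w i)"
    unfolding G_def using sum_le_suminf[of "h (w i)" "{i}"] by simp
  finally show False using small[of "length (w i)"] i by (simp add: V)
qed

text \<open>Take the longest common prefix \<open>w\<close> of the codings of points in
  \<open>U\<close>: two of these points separate right after \<open>w\<close>, so
  \<open>cm_apart\<close> bounds \<open>1 / Q w\<close> by \<open>diameter U / g\<close>. If
  \<open>U\<close> meets the limit set in at most one point there is no longest prefix and any long
  one serves; the slack \<open>e\<close> pays for it.\<close>

lemma set_in_cylinder:
  assumes bU: "bounded U" and e: "0 < e"
  obtains w where "W w \<le> (diameter U / g) powr s + e"
    "\<And>\<omega>. cm \<omega> \<in> U \<Longrightarrow> map \<omega> [0..<length w] = w"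
proof (cases "\<exists>\<omega> \<eta> n. cm \<omega> \<in> U \<and> cm \<eta> \<in> U \<and> \<omega> n \<noteq> \<eta> n")
  case True
  define n where "n = (LEAST n. \<exists>\<omega> \<eta>. cm \<omega> \<in> U \<and> cm \<eta> \<in> U \<and> \<omega> n \<noteq> \<eta> n)"
  have "\<exists>\<omega> \<eta>. cm \<omega> \<in> U \<and> cm \<eta> \<in> U \<and> \<omega> n \<noteq> \<eta> n"
    unfolding n_def by (rule LeastI_ex) (use True in blast)
  then obtain \<omega> \<eta> where we: "cm \<omega> \<in> U" "cm \<eta> \<in> U" "\<omega> n \<noteq> \<eta> n" by blast
  have agree: "\<alpha> i = \<omega> i" if "i < n" "cm \<alpha> \<in> U" for i \<alpha>
    using not_less_Least[OF that(1)[unfolded n_def]] that(2) we(1) by blast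
  define w where "w = map \<omega> [0..<n]"
  have "g / Q w \<le> \<bar>cm \<omega> - cm \<eta>\<bar>"
    unfolding w_def by (rule cm_apart) (use agree[OF _ we(2)] we(3) in simp_all)
  also have "\<dots> \<le> diameter U"
    using diameter_bounded_bound[OF bU we(1,2)] by (simp add: dist_real_def)
  finally have "g / Q w / g \<le> diameter U / g" by (rule divide_right_mono) (use g_pos in simp)
  then have "1 / Q w \<le> diameter U / g" using g_pos by simp
  then have "(1 / Q w) powr s \<le> (diameter U / g) powr s"
    using s_pos by (intro powr_mono2) auto
  then have W: "W w \<le> (diameter U / g) powr s + e"
    using e by (simp add: powr_divide powr_minus_divide)
  have "map \<alpha> [0..<length w] = w" if "cm \<alpha> \<in> U" for \<alpha>
    using agree that by (simp add: w_def)
  with W show ?thesis by (rule that)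
next
  case False
  have "(\<lambda>n. (2 powr (-s)) ^ n) \<longlonglongrightarrow> 0"
    using s_pos by (intro LIMSEQ_power_zero) (simp add: powr_minus_divide)
  then have "\<forall>\<^sub>F n in sequentially. (2 powr (-s)) ^ n < e" using e by (rule order_tendstoD)
  then obtain n where n: "(2 powr (-s)) ^ n < e" by (auto simp: eventually_sequentially)
  obtain \<omega> where \<omega>: "(\<exists>\<alpha>. cm \<alpha> \<in> U) \<longrightarrow> cm \<omega> \<in> U" by blast
  define w where "w = map \<omega> [0..<n]"
  have "W w \<le> (2 ^ n) powr (-s)"
    using Q_ge[of w] s_pos by (intro powr_mono2') (auto simp: w_def)
  also have "\<dots> = (2 powr (-s)) ^ n"
    by (simp add: power_powr_swap)
  finally have W: "W w \<le> (diameter U / g) powr s + e"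
    using n powr_ge_zero[of "diameter U / g" s] by linarith
  have "map \<alpha> [0..<length w] = w" if "cm \<alpha> \<in> U" for \<alpha>
    using False that \<omega> by (auto simp: w_def)
  with W show ?thesis by (rule that)
qed

text \<open>A cheap cover, with each set replaced by a cylinder, would contradict
  \<open>cylinder_cover_weight\<close>. For sets of diameter at most 1 the power \<open>s\<close> of
  the diameter is at most the power \<open>t\<close>, so one argument serves all
  \<open>t \<le> s\<close>, including \<open>t = 0\<close>.\<close>

lemma hausdorff_outer_limit_set_pos:
  assumes t: "0 \<le> t" "t \<le> s"
  shows "hausdorff_outer t (limit_set p q r) \<noteq> 0"
proof
  assume "hausdorff_outer t (limit_set p q r) = 0"
  moreover have "hausdorff_content t 1 (limit_set p q r) \<le> hausdorff_outer t (limit_set p q r)"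
    unfolding hausdorff_outer_def by (rule SUP_upper) auto
  \<comment> \<open>After division by \<open>g powr s\<close> the cover contributes at most
    \<open>1/4\<close>, and the slacks \<open>(1/4) * (1/2) ^ Suc i\<close> below add another
    \<open>1/4\<close>, so the total stays below 1.\<close>
  ultimately have "hausdorff_content t 1 (limit_set p q r) < ennreal (g powr s / 4)"
    using g_pos by simp
  then obtain U where U: "limit_set p q r \<subseteq> (\<Union>i. U i)" "\<And>i. bounded (U i)" "\<And>i. diameter (U i) \<le> 1"
      and lt: "(\<Sum>i. cover_term t (U i)) < ennreal (g powr s / 4)"
    unfolding hausdorff_content_def INF_less_iff by auto
  have "\<exists>w. W w \<le> (diameter (U i) / g) powr s + (1/4) * (1/2) ^ Suc i \<and>
      (\<forall>\<omega>. cm \<omega> \<in> U i \<longrightarrow> map \<omega> [0..<length w] = w)" for i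
  proof -
    have e: "0 < (1/4) * (1/2::real) ^ Suc i" by simp
    show ?thesis by (rule set_in_cylinder[OF U(2)[of i] e]) auto
  qed
  then obtain w where w: "\<And>i. W (w i) \<le> (diameter (U i) / g) powr s + (1/4) * (1/2) ^ Suc i"
      "\<And>i \<omega>. cm \<omega> \<in> U i \<Longrightarrow> map \<omega> [0..<length (w i)] = w i" by metis
  have cov: "\<exists>i. map \<omega> [0..<length (w i)] = w i" for \<omega>
  proof -
    have "cm \<omega> \<in> (\<Union>i. U i)" by (rule subsetD[OF U(1)]) (auto simp: limit_set_iff)
    then show ?thesis using w(2) by blast
  qed
  have term_le: "ennreal (W (w i)) \<le> ennreal (1 / g powr s) * cover_term t (U i) + ennreal ((1/4) * (1/2) ^ Suc i)" for i
  proof -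
    have "ennreal (diameter (U i) powr s) \<le> cover_term t (U i)"
    proof -
      have d: "0 \<le> diameter (U i)" using U(2) by (rule diameter_ge_0)
      have "diameter (U i) powr s \<le> 1"
        using d U(3)[of i] s_pos powr_mono2[of s "diameter (U i)" 1] by simp
      moreover have "diameter (U i) powr s \<le> diameter (U i) powr t"
        using d U(3)[of i] t by (intro powr_mono') auto
      ultimately show ?thesis
        by (auto simp: cover_term_def ennreal_leI)
    qed
    then have "ennreal (1 / g powr s) * ennreal (diameter (U i) powr s) \<le> ennreal (1 / g powr s) * cover_term t (U i)"
      by (rule mult_left_mono) simp
    moreover have "ennreal (1 / g powr s) * ennreal (diameter (U i) powr s) = ennreal ((diameter (U i) / g) powr s)"
      using g_pos diameter_ge_0[OF U(2)[of i]] by (subst ennreal_mult[symmetric]) (auto simp: powr_divide)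
    moreover have "ennreal (W (w i)) \<le> ennreal ((diameter (U i) / g) powr s) + ennreal ((1/4) * (1/2) ^ Suc i)"
      using ennreal_leI[OF w(1)[of i]] by simp
    ultimately show ?thesis by (metis add_right_mono order_trans)
  qed
  have "1 \<le> (\<Sum>i. ennreal (W (w i)))" using cov by (rule cylinder_cover_weight)
  also have "\<dots> \<le> (\<Sum>i. ennreal (1 / g powr s) * cover_term t (U i) + ennreal ((1/4) * (1/2) ^ Suc i))"
    by (intro suminf_le term_le) auto
  also have "\<dots> = ennreal (1 / g powr s) * (\<Sum>i. cover_term t (U i)) + (\<Sum>i. ennreal ((1/4) * (1/2) ^ Suc i))"
    by (subst suminf_add[symmetric]) auto
  also have "(\<Sum>i. ennreal ((1/4) * (1/2) ^ Suc i)) = ennreal (1/4)"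
    by (rule suminf_ennreal_eq) (use sums_mult[OF power_half_series, of "1/4"] in auto)
  also have "ennreal (1 / g powr s) * (\<Sum>i. cover_term t (U i)) \<le> ennreal (1 / g powr s) * ennreal (g powr s / 4)"
    using lt by (intro mult_left_mono) auto
  also have "\<dots> = ennreal (1/4)"
    using g_pos by (subst ennreal_mult[symmetric]) auto
  finally have "1 \<le> ennreal (1/4) + ennreal (1/4)" by simp
  also have "\<dots> = ennreal (1/2)" by (subst ennreal_plus[symmetric]) auto
  also have "\<dots> < 1" by (subst ennreal_less_one_iff) auto
  finally show False by simp
qed

lemma hausdorff_content_cyl_le:
  assumes t: "0 < t" and A: "A \<subseteq> (\<Union>w\<in>V. cyl w)" and V: "V \<subseteq> words n"
    and n: "(d - c) / 2 ^ n \<le> \<epsilon>"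
  shows "hausdorff_content t \<epsilon> A \<le> ennreal ((d - c) powr t * (\<Sum>w\<in>V. Q w powr (-t)))"
proof (rule hausdorff_content_le[OF t A, where d = "\<lambda>w. (d - c) / Q w"])
  have fV: "finite V" using V finite_words finite_subset by blast
  show "0 \<le> \<epsilon>" using n cd by (smt (verit) divide_nonneg_pos zero_less_power)
  show "bounded (cyl w) \<and> diameter (cyl w) \<le> (d - c) / Q w \<and> (d - c) / Q w \<le> \<epsilon>" if "w \<in> V" for w
  proof -
    have "(d - c) / Q w \<le> (d - c) / 2 ^ n"
      using Q_ge[of w] cd V that by (intro divide_left_mono) auto
    then show ?thesis using n cyl_bounded diameter_cyl by auto
  qed
  fix F assume "finite F" "F \<subseteq> V"
  then have "(\<Sum>w\<in>F. ((d - c) / Q w) powr t) \<le> (\<Sum>w\<in>V. ((d - c) / Q w) powr t)"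
    using fV by (intro sum_mono2) auto
  then show "(\<Sum>w\<in>F. ((d - c) / Q w) powr t) \<le> (d - c) powr t * (\<Sum>w\<in>V. Q w powr (-t))"
    using cd by (simp add: powr_divide powr_minus_divide sum_distrib_left)
qed

text \<open>\<open>Q w powr (-t)\<close> is \<open>W w\<close> times
  \<open>Q w powr (-(t - s))\<close>. The second factor decays geometrically in the length of
  \<open>w\<close>, and the weights of the words of one length sum to 1.\<close>

lemma hausdorff_outer_limit_set_null:
  assumes t: "s < t" shows "hausdorff_outer t (limit_set p q r) = 0"
proof (rule hausdorff_outer_eq_0I)
  fix \<epsilon> \<eta> :: real assume "0 < \<epsilon>" "0 < \<eta>"
  have "(\<lambda>n. (d - c) * (1/2) ^ n) \<longlonglongrightarrow> 0"
    by (intro tendsto_mult_right_zero LIMSEQ_power_zero) auto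
  then have ev1: "\<forall>\<^sub>F n in sequentially. (d - c) * (1/2) ^ n < \<epsilon>"
    using \<open>0 < \<epsilon>\<close> by (rule order_tendstoD)
  have "(\<lambda>n. (d - c) powr t * (2 powr (-(t - s))) ^ n) \<longlonglongrightarrow> 0"
    using t powr_less_mono[of "s - t" 0 2]
    by (intro tendsto_mult_right_zero LIMSEQ_power_zero) simp
  then have ev2: "\<forall>\<^sub>F n in sequentially. (d - c) powr t * (2 powr (-(t - s))) ^ n < \<eta>"
    using \<open>0 < \<eta>\<close> by (rule order_tendstoD)
  from eventually_happens[OF eventually_conj[OF ev1 ev2]]
  obtain n where n: "(d - c) * (1/2) ^ n < \<epsilon>" "(d - c) powr t * (2 powr (-(t - s))) ^ n < \<eta>"
    by auto
  have "limit_set p q r \<subseteq> (\<Union>w\<in>words n. cyl w)"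
  proof
    fix x assume "x \<in> limit_set p q r"
    then obtain \<omega> where "x = cm \<omega>" by (auto simp: limit_set_iff)
    then have "x \<in> cyl (map \<omega> [0..<n])" by (auto simp: cyl_def)
    moreover have "map \<omega> [0..<n] \<in> words n" by simp
    ultimately show "x \<in> (\<Union>w\<in>words n. cyl w)" by blast
  qed
  then have "hausdorff_content t \<epsilon> (limit_set p q r) \<le> ennreal ((d - c) powr t * (\<Sum>w\<in>words n. Q w powr (-t)))"
    using n(1) s_pos t by (intro hausdorff_content_cyl_le[where n = n]) (auto simp: field_simps)
  also have "\<dots> \<le> ennreal \<eta>"
  proof (rule ennreal_leI)
    have "(\<Sum>w\<in>words n. Q w powr (-t)) \<le> (\<Sum>w\<in>words n. (2 powr (-(t - s))) ^ n * W w)"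
    proof (rule sum_mono)
      fix w :: "'e list" assume "w \<in> words n"
      then have "Q w powr (-(t - s)) \<le> (2 ^ n) powr (-(t - s))"
        using Q_ge[of w] t by (intro powr_mono2') auto
      also have "\<dots> = (2 powr (-(t - s))) ^ n"
        by (simp add: power_powr_swap)
      finally have "Q w powr (-(t - s)) * W w \<le> (2 powr (-(t - s))) ^ n * W w"
        by (rule mult_right_mono) simp
      then show "Q w powr (-t) \<le> (2 powr (-(t - s))) ^ n * W w"
        by (simp flip: powr_add)
    qed
    also have "\<dots> = (2 powr (-(t - s))) ^ n" by (simp add: sum_W flip: sum_distrib_left)
    finally have "(d - c) powr t * (\<Sum>w\<in>words n. Q w powr (-t)) \<le> (d - c) powr t * (2 powr (-(t - s))) ^ n"
      by (rule mult_left_mono) simp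
    with n(2) show "(d - c) powr t * (\<Sum>w\<in>words n. Q w powr (-t)) \<le> \<eta>" by linarith
  qed
  finally show "hausdorff_content t \<epsilon> (limit_set p q r) \<le> ennreal \<eta>" .
qed

lemma hausdorff_dim_limit_set: "hausdorff_dim (limit_set p q r) = s"
proof -
  have "{t. 0 \<le> t \<and> hausdorff_outer t (limit_set p q r) = 0} = {s<..}"
    using hausdorff_outer_limit_set_null hausdorff_outer_limit_set_pos s_pos by force
  then show ?thesis by (simp add: hausdorff_dim_def)
qed

end

subsection \<open>Rational points\<close>

context rational_ifs
begin

text \<open>\<open>pw w / Q w\<close> is the slope of \<open>u w\<close>, and
  \<open>Q w - pw w\<close> is the period factor of the intrinsic denominator.\<close>

definition pw :: "'e list \<Rightarrow> real" where
  "pw w = (\<Prod>a\<leftarrow>w. of_int (p a))"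

lemma pw_simps [simp]: "pw [] = 1" "pw (a # w) = of_int (p a) * pw w"
  by (simp_all add: pw_def)

lemma abs_pw [simp]: "\<bar>pw w\<bar> = 1"
proof (induction w)
  case (Cons a w)
  then show ?case using p_unit[of a] by (auto simp: abs_mult)
qed simp

lemma Q_Ints: "Q w \<in> \<int>"
  by (induction w) auto

lemma pw_Ints: "pw w \<in> \<int>"
  by (induction w) auto

lemma Q_ge2: "w \<noteq> [] \<Longrightarrow> 2 \<le> Q w"
  using Q_ge[of w] self_le_power[of "2::real" "length w"] by simp

lemma Q_minus_pw_ge: "w \<noteq> [] \<Longrightarrow> Q w / 2 \<le> Q w - pw w"
  and Q_minus_pw_le: "w \<noteq> [] \<Longrightarrow> Q w - pw w \<le> 2 * Q w"
  using Q_ge2[of w] abs_pw[of w] by linarith+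

lemma Q_u: "\<exists>N\<in>\<int>. \<forall>x. Q w * u w x = pw w * x + N"
proof (induction w)
  case Nil
  then show ?case by (intro bexI[of _ 0]) auto
next
  case (Cons a w)
  then obtain N where N: "N \<in> \<int>" "\<And>x. Q w * u w x = pw w * x + N" by blast
  have "Q (a # w) * u (a # w) x = pw (a # w) * x + (of_int (p a) * N + of_int (r a) * Q w)" for x
  proof -
    have "real (q a) \<noteq> 0" using q_ge2[of a] by simp
    then have "Q (a # w) * u (a # w) x = of_int (p a) * (Q w * u w x) + of_int (r a) * Q w"
      by (simp add: ifs_map_def field_simps)
    also have "\<dots> = pw (a # w) * x + (of_int (p a) * N + of_int (r a) * Q w)"
      by (simp add: N(2) algebra_simps)
    finally show ?thesis .
  qed
  moreover have "of_int (p a) * N + of_int (r a) * Q w \<in> \<int>"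
    using N(1) Q_Ints by (intro Ints_add Ints_mult) auto
  ultimately show ?case by blast
qed

lemma Ints_subset_Rats_real: "x \<in> \<int> \<Longrightarrow> x \<in> \<rat>" for x :: real
  by (auto elim!: Ints_cases)

text \<open>The tail after position \<open>n\<close> is the fixed point of \<open>u v\<close>, with
  \<open>v\<close> its period, so by \<open>Q_u\<close> it solves
  \<open>(Q v - pw v) * z = N\<close> with an integer \<open>N\<close>. The coefficient is nonzero
  since \<open>Q v\<close> is at least 2 and \<open>pw v\<close> is a sign.\<close>

lemma cm_periodic_Rats:
  assumes m: "1 \<le> m" and per: "\<And>i. n \<le> i \<Longrightarrow> \<eta> (i + m) = \<eta> i"
  shows "cm \<eta> \<in> \<rat>"
proof -
  define z where "z = cm (\<lambda>i. \<eta> (n + i))"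
  define v where "v = map (\<lambda>i. \<eta> (n + i)) [0..<m]"
  have "v \<noteq> []" using m by (simp add: v_def)
  have "z = u v z"
    unfolding z_def v_def
    using cm_shift[of "\<lambda>i. \<eta> (n + i)" m] per[of "n + _"] by (simp add: ac_simps)
  moreover obtain N where N: "N \<in> \<int>" "\<And>x. Q v * u v x = pw v * x + N" using Q_u by blast
  ultimately have "Q v * z = pw v * z + N" by metis
  then have "(Q v - pw v) * z = N" by (simp add: algebra_simps)
  moreover have "Q v - pw v \<noteq> 0" using Q_minus_pw_ge[OF \<open>v \<noteq> []\<close>] Q_pos[of v] by linarith
  ultimately have "z = N / (Q v - pw v)" by (simp add: field_simps)
  then have z: "z \<in> \<rat>"
    using N(1) Q_Ints pw_Ints by (auto intro!: Rats_divide Rats_diff intro: Ints_subset_Rats_real)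
  define w where "w = map \<eta> [0..<n]"
  obtain N' where N': "N' \<in> \<int>" "\<And>x. Q w * u w x = pw w * x + N'" using Q_u by blast
  have "cm \<eta> = u w z" by (simp add: w_def z_def cm_shift[of \<eta> n])
  then have "cm \<eta> = (pw w * z + N') / Q w" using N'(2)[of z] by (simp add: field_simps)
  then show ?thesis
    using z N'(1) Q_Ints pw_Ints
    by (auto intro!: Rats_divide Rats_add Rats_mult intro: Ints_subset_Rats_real)
qed

text \<open>The inverse branches do not increase denominators, so the orbit of a rational point
  under them stays in a finite set.\<close>

lemma cm_Rats_periodic:
  assumes "cm \<eta> \<in> \<rat>"
  obtains n m where "1 \<le> m" "\<And>i. n \<le> i \<Longrightarrow> \<eta> (i + m) = \<eta> i"
proof -
  obtain a D :: int where D: "0 < D" and a: "cm \<eta> = of_int a / of_int D"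
    using assms by (auto elim!: Rats_cases')
  define x where "x n = cm (\<lambda>i. \<eta> (n + i))" for n
  have int: "x n * of_int D \<in> \<int>" for n
  proof (induction n)
    case 0
    then show ?case using a D by (simp add: x_def)
  next
    case (Suc n)
    have "x n = ifs_map p q r (\<eta> n) (x (Suc n))"
      using cm_shift[of "\<lambda>i. \<eta> (n + i)" 1] by (simp add: x_def)
    moreover have "real (q (\<eta> n)) \<noteq> 0" using q_ge2[of "\<eta> n"] by simp
    ultimately have "real (q (\<eta> n)) * x n = of_int (p (\<eta> n)) * x (Suc n) + of_int (r (\<eta> n))"
      by (simp add: ifs_map_def field_simps)
    \<comment> \<open>The sign \<open>p (\<eta> n)\<close> is its own inverse, so the inverse branch
      has integer coefficients.\<close>
    then have e: "x (Suc n) = of_int (p (\<eta> n)) * (real (q (\<eta> n)) * x n - of_int (r (\<eta> n)))"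
      using p_unit[of "\<eta> n"] by auto
    have "x (Suc n) * of_int D = of_int (p (\<eta> n)) *
        (real (q (\<eta> n)) * (x n * of_int D) - of_int (r (\<eta> n)) * of_int D)"
      unfolding e by (simp add: algebra_simps)
    also have "\<dots> \<in> \<int>"
      by (intro Ints_mult[OF Ints_of_int Ints_diff[OF Ints_mult[OF Ints_of_nat Suc]
            Ints_mult[OF Ints_of_int Ints_of_int]]])
    finally show ?case .
  qed
  have "finite (range x)"
  proof (rule finite_subset)
    show "range x \<subseteq> (\<lambda>k. of_int k / of_int D) ` {\<lfloor>c * of_int D\<rfloor>..\<lceil>d * of_int D\<rceil>}"
    proof
      fix y assume "y \<in> range x"
      then obtain n where y: "y = x n" by blast
      obtain k where k: "x n * of_int D = of_int k" using int[of n] by (auto elim: Ints_cases)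
      have "c * of_int D \<le> x n * of_int D" "x n * of_int D \<le> d * of_int D"
        using cm_in[of "\<lambda>i. \<eta> (n + i)"] D by (auto simp: x_def intro!: mult_right_mono)
      then have "k \<in> {\<lfloor>c * of_int D\<rfloor>..\<lceil>d * of_int D\<rceil>}"
        unfolding k by (auto simp: floor_le_iff le_ceiling_iff)
      moreover have "y = of_int k / of_int D" using k D y by (simp add: field_simps)
      ultimately show "y \<in> (\<lambda>k. of_int k / of_int D) ` {\<lfloor>c * of_int D\<rfloor>..\<lceil>d * of_int D\<rceil>}"
        by blast
    qed
  qed simp
  then have "\<not> inj x" using finite_imageD by (metis infinite_UNIV_nat)
  then obtain n n' where nn: "n < n'" "x n = x n'"
    unfolding inj_def by (metis linorder_neqE_nat)
  then have eq: "(\<lambda>i. \<eta> (n + i)) = (\<lambda>i. \<eta> (n' + i))" unfolding x_def by (intro cm_inj)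
  show ?thesis
  proof (rule that[of "n' - n" n])
    show "1 \<le> n' - n" using nn by simp
    show "\<eta> (i + (n' - n)) = \<eta> i" if "n \<le> i" for i
      using fun_cong[OF eq, of "i - n"] that nn(1) by (simp add: add.commute)
  qed
qed

text \<open>\<open>Y v w\<close> is the point with coding \<open>v\<close> followed by infinitely many copies of \<open>w\<close>.\<close>

definition Y :: "'e list \<Rightarrow> 'e list \<Rightarrow> real" where
  "Y v w = cm (\<lambda>i. if i < length v then v ! i else w ! ((i - length v) mod length w))"

lemma periodic_mod:
  fixes \<eta> :: "nat \<Rightarrow> 'e" and n m :: nat
  assumes "\<And>i. n \<le> i \<Longrightarrow> \<eta> (i + m) = \<eta> i"
  shows "\<eta> (n + i) = \<eta> (n + i mod m)"
proof -
  have "\<eta> (n + (j + k * m)) = \<eta> (n + j)" for j k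
  proof (induction k)
    case (Suc k)
    have "\<eta> (n + (j + Suc k * m)) = \<eta> (n + (j + k * m) + m)" by (simp add: ac_simps)
    also have "\<dots> = \<eta> (n + (j + k * m))" by (rule assms) simp
    finally show ?case using Suc by simp
  qed simp
  from this[of "i mod m" "i div m"] show ?thesis by simp
qed

lemma Y_Rats: "w \<noteq> [] \<Longrightarrow> Y v w \<in> \<rat>"
  unfolding Y_def
proof (rule cm_periodic_Rats[where n = "length v" and m = "length w"])
  fix i assume "length v \<le> i"
  then have "(i + length w - length v) mod length w = (i - length v) mod length w"
    by (metis Nat.add_diff_assoc2 mod_add_self2)
  then show "(if i + length w < length v then v ! (i + length w) else w ! ((i + length w - length v) mod length w))
     = (if i < length v then v ! i else w ! ((i - length v) mod length w))"
    using \<open>length v \<le> i\<close> by simp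
qed (simp add: Suc_leI)

text \<open>The intrinsic denominator uses the minimal preperiod and period, whereas constructions
  supply some \<open>n\<close> and \<open>m\<close>. The length bounds record that the minimal
  choice only shortens both words, which keeps the denominator under control.\<close>

lemma intrinsic_data:
  assumes m: "1 \<le> m" and per: "\<And>i. n \<le> i \<Longrightarrow> \<eta> (i + m) = \<eta> i"
  obtains v w where "w \<noteq> []" "cm \<eta> = Y v w" "length v \<le> n" "length w \<le> m"
    "v @ w = map \<eta> [0..<length v + length w]"
    "of_int (intrinsic_denom p q r (cm \<eta>)) = Q v * (Q w - pw w)"
proof -
  let ?P = "\<lambda>n. \<exists>m\<ge>1. \<forall>i\<ge>n. \<eta> (i + m) = \<eta> i"
  define n0 m0 where "n0 = preperiod \<eta>" and "m0 = min_period \<eta>"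
  have P: "?P n" using m per by blast
  have n0: "?P n0" unfolding n0_def preperiod_def by (rule LeastI[of ?P, OF P])
  have n0_le: "n0 \<le> n" unfolding n0_def preperiod_def by (rule Least_le[of ?P, OF P])
  let ?R = "\<lambda>m. m \<ge> 1 \<and> (\<forall>i\<ge>n0. \<eta> (i + m) = \<eta> i)"
  have m0: "?R m0" unfolding m0_def min_period_def n0_def[symmetric]
    by (rule LeastI_ex[of ?R]) (use n0 in blast)
  \<comment> \<open>\<open>m\<close> is a period only from \<open>n\<close> on. Adding
    \<open>n * m0\<close>, a multiple of a period valid from \<open>n0\<close> on, moves any index
    past \<open>n\<close>, where \<open>m\<close> applies, and back.\<close>
  have R: "?R m"
  proof (intro conjI allI impI m)
    fix i assume i: "n0 \<le> i"
    have it: "\<eta> (j + k * m0) = \<eta> j" if "n0 \<le> j" for j k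
    proof (induction k)
      case (Suc k)
      have "\<eta> (j + Suc k * m0) = \<eta> ((j + k * m0) + m0)" by (simp add: ac_simps)
      also have "\<dots> = \<eta> (j + k * m0)" using m0 that by (simp add: trans_le_add1)
      finally show ?case using Suc by simp
    qed simp
    have ge: "n \<le> i + n * m0" using m0 by (cases m0) auto
    have "\<eta> (i + m) = \<eta> ((i + m) + n * m0)" using it[of "i + m" n] i by simp
    also have "\<dots> = \<eta> ((i + n * m0) + m)" by (simp add: ac_simps)
    also have "\<dots> = \<eta> (i + n * m0)" using ge by (rule per)
    also have "\<dots> = \<eta> i" using it[of i n] i by simp
    finally show "\<eta> (i + m) = \<eta> i" .
  qed
  have m0_le: "m0 \<le> m" unfolding m0_def min_period_def n0_def[symmetric]
    by (rule Least_le[of ?R, OF R])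
  define v w where "v = map \<eta> [0..<n0]" and "w = map (\<lambda>i. \<eta> (n0 + i)) [0..<m0]"
  have len: "length v = n0" "length w = m0" by (simp_all add: v_def w_def)
  have "\<eta> i = (if i < length v then v ! i else w ! ((i - length v) mod length w))" for i
  proof (cases "i < n0")
    case False
    then have "\<eta> i = \<eta> (n0 + (i - n0) mod m0)"
      using periodic_mod[of n0 \<eta> m0 "i - n0"] m0 by simp
    then show ?thesis using False m0 by (simp add: len) (simp add: w_def)
  qed (simp add: v_def)
  then have eq: "cm \<eta> = Y v w" unfolding Y_def by presburger
  have prodQ: "Q (map f [0..<k]) = of_int (\<Prod>i<k. int (q (f i)))" for f k
    by (induction k) (auto simp: mult.commute)
  have prodp: "pw (map f [0..<k]) = of_int (\<Prod>i<k. p (f i))" for f k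
    by (induction k) (auto simp: pw_def mult.commute)
  have qint: "of_int (intrinsic_denom p q r (cm \<eta>)) = Q v * (Q w - pw w)"
    unfolding intrinsic_denom_cm qint_of_coding_def v_def w_def prodQ prodp n0_def m0_def by simp
  show ?thesis
  proof (rule that[OF _ eq _ _ _ qint])
    show "w \<noteq> []" using m0 len by auto
    show "v @ w = map \<eta> [0..<length v + length w]"
      unfolding len unfolding upt_add_split v_def w_def ..
  qed (use len n0_le m0_le in auto)
qed

text \<open>This is the intrinsic denominator of \<open>Y v w\<close> when \<open>v\<close> and
  \<open>w\<close> are the minimal preperiod and period; for other pairs it is only a formula, so
  that sums can run over all pairs.\<close>

definition qden :: "'e list \<Rightarrow> 'e list \<Rightarrow> real" where
  "qden v w = Q v * (Q w - pw w)"

lemma qden_ge: "w \<noteq> [] \<Longrightarrow> Q v * Q w / 2 \<le> qden v w"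
  and qden_le: "w \<noteq> [] \<Longrightarrow> qden v w \<le> 2 * (Q v * Q w)"
  unfolding qden_def
  using mult_left_mono[OF Q_minus_pw_ge, of w "Q v"] mult_left_mono[OF Q_minus_pw_le, of w "Q v"] by auto

lemma qden_ge_power:
  assumes "w \<noteq> []" shows "2 ^ (length v + length w - 1) \<le> qden v w"
proof -
  obtain k where k: "length w = Suc k" using assms by (cases w) auto
  have "2 ^ (length v + length w) \<le> Q v * Q w" using Q_ge[of "v @ w"] by simp
  then have "2 ^ (length v + length w - 1) \<le> Q v * Q w / 2" by (simp add: k)
  with qden_ge[OF assms, of v] show ?thesis by linarith
qed

lemma qden_pos: "w \<noteq> [] \<Longrightarrow> 0 < qden v w"
  using qden_ge_power[of w v] zero_less_power[of "2::real"] by (smt (verit))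

end

subsection \<open>Condensation\<close>

lemma sum_blocks:
  fixes f :: "nat \<Rightarrow> real"
  assumes "incseq B"
  shows "(\<Sum>k<K. \<Sum>n\<in>{B k..<B (Suc k)}. f n) = (\<Sum>n\<in>{B 0..<B K}. f n)"
proof (induction K)
  case (Suc K)
  then show ?case
    using sum.atLeastLessThan_concat[of "B 0" "B K" "B (Suc K)" f] incseqD[OF assms, of 0 K]
      incseqD[OF assms, of K "Suc K"] by simp
qed simp

lemma summable_blocks:
  fixes f :: "nat \<Rightarrow> real"
  assumes "incseq B" "\<And>n. B 0 \<le> n \<Longrightarrow> 0 \<le> f n" "summable f"
  shows "summable (\<lambda>k. \<Sum>n\<in>{B k..<B (Suc k)}. f n)"
proof (rule summableI_nonneg_bounded)
  have s: "summable (\<lambda>n. f (n + B 0))" using assms(3) by (simp add: summable_iff_shift)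
  fix K
  show "0 \<le> (\<Sum>n\<in>{B K..<B (Suc K)}. f n)"
    using incseqD[OF assms(1), of 0 K] by (intro sum_nonneg assms(2)) auto
  have "(\<Sum>k<K. \<Sum>n\<in>{B k..<B (Suc k)}. f n) = (\<Sum>n\<in>{0 + B 0..<(B K - B 0) + B 0}. f n)"
    using incseqD[OF assms(1), of 0 K] by (simp add: sum_blocks[OF assms(1)])
  also have "\<dots> = (\<Sum>n<B K - B 0. f (n + B 0))"
    by (simp only: sum.shift_bounds_nat_ivl atLeast0LessThan)
  also have "\<dots> \<le> (\<Sum>n. f (n + B 0))"
    by (intro sum_le_suminf s) (auto intro: assms(2))
  finally show "(\<Sum>k<K. \<Sum>n\<in>{B k..<B (Suc k)}. f n) \<le> (\<Sum>n. f (n + B 0))" .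
qed

lemma summable_from_blocks:
  fixes f :: "nat \<Rightarrow> real"
  assumes "strict_mono B" "\<And>n. B 0 \<le> n \<Longrightarrow> 0 \<le> f n"
    and "summable (\<lambda>k. \<Sum>n\<in>{B k..<B (Suc k)}. f n)"
  shows "summable f"
proof -
  have inc: "incseq B" using assms(1) by (rule strict_mono_mono)
  have "summable (\<lambda>n. f (n + B 0))"
  proof (rule summableI_nonneg_bounded)
    fix N
    show "0 \<le> f (N + B 0)" by (rule assms(2)) simp
    have "(\<Sum>n<N. f (n + B 0)) = (\<Sum>n\<in>{0 + B 0..<N + B 0}. f n)"
      by (simp only: sum.shift_bounds_nat_ivl atLeast0LessThan)
    also have "\<dots> \<le> (\<Sum>n\<in>{B 0..<B (N + B 0)}. f n)"
      using strict_mono_imp_increasing[OF assms(1), of "N + B 0"]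
      by (intro sum_mono2) (auto intro: assms(2))
    also have "\<dots> = (\<Sum>k<N + B 0. \<Sum>n\<in>{B k..<B (Suc k)}. f n)" by (simp add: sum_blocks[OF inc])
    also have "\<dots> \<le> (\<Sum>k. \<Sum>n\<in>{B k..<B (Suc k)}. f n)"
      using incseqD[OF inc, of 0] by (intro sum_le_suminf assms(3) ballI sum_nonneg assms(2)) (auto intro: order_trans)
    finally show "(\<Sum>n<N. f (n + B 0)) \<le> (\<Sum>k. \<Sum>n\<in>{B k..<B (Suc k)}. f n)" .
  qed
  then show ?thesis by (simp add: summable_iff_shift)
qed

lemma admissible_psi_pos_mono:
  assumes "admissible_psi \<psi>"
  obtains T where "2 \<le> T" "\<And>t. T \<le> t \<Longrightarrow> 0 < \<psi> t" "\<And>s t. T \<le> s \<Longrightarrow> s \<le> t \<Longrightarrow> \<psi> t \<le> \<psi> s"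
proof -
  obtain T1 T2 where "\<forall>t\<ge>T1. 0 < \<psi> t" "\<forall>s t. T2 \<le> s \<longrightarrow> s \<le> t \<longrightarrow> \<psi> t \<le> \<psi> s"
    using assms by (auto simp: admissible_psi_def eventually_at_top_linorder)
  then show ?thesis by (intro that[of "max 2 (max T1 T2)"]) auto
qed

text \<open>On the block from \<open>2 ^ K\<close> to \<open>2 ^ Suc K\<close> the terms
  \<open>ln n / n\<close> add up to order \<open>K\<close>. The shift \<open>k - 1\<close> matches
  the lower bound for denominators in \<open>qden_ge_power\<close>.\<close>

lemma summable_condensed:
  fixes \<psi> :: "real \<Rightarrow> real"
  assumes T: "2 \<le> T" and pos: "\<And>t. T \<le> t \<Longrightarrow> 0 < \<psi> t"
    and mono: "\<And>s t. T \<le> s \<Longrightarrow> s \<le> t \<Longrightarrow> \<psi> t \<le> \<psi> s" and s: "0 < s"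
    and sum: "summable (\<lambda>n::nat. ln (real n) * \<psi> (real n) powr s / real n)"
  shows "summable (\<lambda>k. real k * \<psi> (2 ^ (k - 1)) powr s)"
proof -
  define f where "f n = ln (real n) * \<psi> (real n) powr s / real n" for n
  obtain k0 :: nat where k0: "T < 2 ^ k0" using real_arch_pow[of 2 T] by auto
  have k0': "1 \<le> k0" using k0 T by (cases k0) auto
  define B :: "nat \<Rightarrow> nat" where "B k = 2 ^ (k0 + k)" for k
  have B0: "T \<le> real n" if "B 0 \<le> n" for n
  proof -
    have "2 ^ k0 \<le> n" using that by (simp add: B_def)
    then have "real (2 ^ k0) \<le> real n" by (rule of_nat_mono)
    then have "2 ^ k0 \<le> real n" by (simp only: of_nat_power of_nat_numeral)
    then show ?thesis using k0 by linarith
  qed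
  have inc: "incseq B" unfolding B_def by (intro monoI power_increasing) auto
  have "summable (\<lambda>k. \<Sum>n\<in>{B k..<B (Suc k)}. f n)"
  proof (rule summable_blocks[OF inc])
    show "0 \<le> f n" if "B 0 \<le> n" for n using B0[OF that] T by (simp add: f_def)
  qed (use sum in \<open>simp add: f_def\<close>)
  then have s4: "summable (\<lambda>k. 8 / ln 2 * (\<Sum>n\<in>{B k..<B (Suc k)}. f n))" by (rule summable_mult)
  \<comment> \<open>With \<open>K = k + k0\<close> one has \<open>K + 2 \<le> 4 * K\<close>, and the
    block sum is at least \<open>K * ln 2 / 2\<close> times \<open>\<psi> powr s\<close> at the
    right end; the quotient of the constants is \<open>8 / ln 2\<close>.\<close>
  have le: "real (k + k0 + 2) * \<psi> (2 ^ (k + k0 + 1)) powr s \<le> 8 / ln 2 * (\<Sum>n\<in>{B k..<B (Suc k)}. f n)" for k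
  proof -
    define K where "K = k + k0"
    have K: "1 \<le> K" using k0' by (simp add: K_def)
    have Bk: "B k = 2 ^ K" "B (Suc k) = 2 ^ Suc K" by (simp_all add: B_def K_def add.commute)
    define C where "C = (real K * ln 2) * \<psi> (2 ^ Suc K) powr s / 2 ^ Suc K"
    have "real (card {B k..<B (Suc k)}) * C \<le> (\<Sum>n\<in>{B k..<B (Suc k)}. f n)"
    proof (rule sum_bounded_below)
      fix n assume n: "n \<in> {B k..<B (Suc k)}"
      then have n1: "2 ^ K \<le> n" "n \<le> 2 ^ Suc K" by (auto simp: Bk)
      have n1': "2 ^ K \<le> real n" "real n \<le> 2 ^ Suc K"
        using of_nat_mono[OF n1(1), where 'a=real] of_nat_mono[OF n1(2), where 'a=real] by simp_all
      have Tn: "T \<le> real n" using n incseqD[OF inc, of 0 k] by (intro B0) auto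
      have "real K * ln 2 = ln (2 ^ K)" by (simp add: ln_realpow)
      also have "\<dots> \<le> ln (real n)" using n1' Tn T by (subst ln_le_cancel_iff) auto
      finally have l: "real K * ln 2 \<le> ln (real n)" .
      have "\<psi> (2 ^ Suc K) powr s \<le> \<psi> (real n) powr s"
        using pos[of "2 ^ Suc K"] mono[OF Tn n1'(2)] Tn n1' s by (intro powr_mono2) auto
      then show "C \<le> f n"
        unfolding C_def f_def using l n1' Tn T by (intro frac_le mult_mono) auto
    qed
    moreover have "real (card {B k..<B (Suc k)}) = 2 ^ K" by (simp add: Bk)
    ultimately have A: "2 ^ K * C \<le> (\<Sum>n\<in>{B k..<B (Suc k)}. f n)" by simp
    have C: "2 ^ K * C = real K * ln 2 * \<psi> (2 ^ Suc K) powr s / 2" by (simp add: C_def)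
    have "real (K + 2) * \<psi> (2 ^ Suc K) powr s \<le> (4 * real K) * \<psi> (2 ^ Suc K) powr s"
      using K by (intro mult_right_mono) auto
    also have "\<dots> = 8 / ln 2 * (2 ^ K * C)" unfolding C by simp
    also have "\<dots> \<le> 8 / ln 2 * (\<Sum>n\<in>{B k..<B (Suc k)}. f n)" using A by (intro mult_left_mono) auto
    finally show ?thesis by (simp add: K_def)
  qed
  have "summable (\<lambda>k. real (k + k0 + 2) * \<psi> (2 ^ (k + k0 + 1)) powr s)"
    by (rule summable_comparison_test'[OF s4, where N = 0]) (use le in \<open>simp add: abs_mult\<close>)
  then have "summable (\<lambda>k. real (k + (k0 + 2)) * \<psi> (2 ^ (k + (k0 + 2) - 1)) powr s)" by (simp add: add.assoc)
  then show ?thesis by (rule iffD1[OF summable_iff_shift])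
qed

lemma hausdorff_outer_null_Un:
  assumes "hausdorff_outer s A = 0" "hausdorff_outer s B = 0"
  shows "hausdorff_outer s (A \<union> B) = 0"
proof -
  have "A \<union> B = (\<Union>n::nat. if n = 0 then A else B)" by (auto split: if_splits)
  moreover have "hausdorff_outer s (\<Union>n::nat. if n = 0 then A else B) = 0"
    by (rule hausdorff_outer_null_UN) (use assms in auto)
  ultimately show ?thesis by metis
qed

text \<open>Inserting 1 covers the empty set and gives \<open>e \<le> 1\<close>, so that in the
  convergence half one constant serves both the finitely many short pairs and all the
  others.\<close>

lemma finite_positive_lower_bound:
  fixes h :: "'a \<Rightarrow> real"
  assumes "finite F" "\<And>x. x \<in> F \<Longrightarrow> 0 < h x"
  obtains e where "0 < e" "e \<le> 1" "\<And>x. x \<in> F \<Longrightarrow> e \<le> h x"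
proof
  show "0 < Min (insert 1 (h ` F))" using assms by (subst Min_gr_iff) auto
  show "Min (insert 1 (h ` F)) \<le> 1" using assms by (intro Min_le) auto
  show "Min (insert 1 (h ` F)) \<le> h x" if "x \<in> F" for x using assms that by (intro Min_le) auto
qed

subsection \<open>The convergence case\<close>

context rational_ifs
begin

text \<open>Sort the pairs by total length \<open>k\<close> and by \<open>i = length v\<close>,
  which is less than \<open>k\<close> because \<open>w\<close> is nonempty. For each of the
  \<open>k\<close> values of \<open>i\<close> the weights \<open>W v * W w\<close> sum to 1; this
  multiplicity is the source of the logarithm in (i).\<close>

lemma sum_word_pairs_le:
  fixes h :: "'e list \<times> 'e list \<Rightarrow> real"
  assumes F: "finite F" "\<And>v w. (v, w) \<in> F \<Longrightarrow> w \<noteq> [] \<and> K \<le> length v + length w"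
    and nn: "\<And>x. 0 \<le> h x"
    and h: "\<And>v w. w \<noteq> [] \<Longrightarrow> K \<le> length v + length w \<Longrightarrow> h (v, w) \<le> a (length v + length w) * (W v * W w)"
  shows "\<exists>K'. sum h F \<le> (\<Sum>k\<in>{K..<K'}. real k * a k)"
proof -
  obtain K' where K': "\<And>v w. (v, w) \<in> F \<Longrightarrow> length v + length w < K'"
  proof -
    have "finite ((\<lambda>(v, w). length v + length w) ` F)" using F(1) by simp
    then obtain K' where "\<forall>k\<in>(\<lambda>(v, w). length v + length w) ` F. k < K'"
      using finite_nat_set_iff_bounded by meson
    then show ?thesis by (intro that) auto
  qed
  define I where "I = Sigma {K..<K'} (\<lambda>k. {..<k})"
  define A :: "nat \<times> nat \<Rightarrow> ('e list \<times> 'e list) set" where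
    "A = (\<lambda>(k, i). words i \<times> words (k - i))"
  have fin: "finite I" "\<forall>x\<in>I. finite (A x)" by (auto simp: I_def A_def)
  have disj: "\<forall>x\<in>I. \<forall>y\<in>I. x \<noteq> y \<longrightarrow> A x \<inter> A y = {}"
    by (auto simp: I_def A_def)
  have "F \<subseteq> \<Union> (A ` I)"
  proof
    fix x assume "x \<in> F"
    moreover obtain v w where x: "x = (v, w)" by (cases x)
    ultimately have vw: "(length v + length w, length v) \<in> I" using F(2) K' by (auto simp: I_def)
    have "x \<in> A (length v + length w, length v)" by (simp add: A_def x)
    with vw show "x \<in> \<Union> (A ` I)" by (rule UN_I)
  qed
  then have "sum h F \<le> sum h (\<Union> (A ` I))" using fin nn by (intro sum_mono2) auto
  also have "\<dots> = (\<Sum>x\<in>I. sum h (A x))" by (rule sum.UNION_disjoint[OF fin disj])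
  also have "\<dots> \<le> (\<Sum>x\<in>I. a (fst x))"
  proof (rule sum_mono)
    fix x assume "x \<in> I"
    moreover obtain k i where x: "x = (k, i)" by (cases x)
    ultimately have ki: "i < k" "K \<le> k" by (auto simp: I_def)
    have "sum h (A x) = (\<Sum>v\<in>words i. \<Sum>w\<in>words (k - i). h (v, w))"
      by (simp add: x A_def sum.cartesian_product)
    also have "\<dots> \<le> (\<Sum>v\<in>words i. \<Sum>w\<in>words (k - i). a k * (W v * W w))"
    proof (intro sum_mono)
      fix v w :: "'e list" assume "v \<in> words i" "w \<in> words (k - i)"
      moreover from this ki have "w \<noteq> []" by auto
      ultimately show "h (v, w) \<le> a k * (W v * W w)" using h[of w v] ki by auto
    qed
    also have "\<dots> = a k" by (simp add: sum_W flip: sum_distrib_left)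
    finally show "sum h (A x) \<le> a (fst x)" by (simp add: x)
  qed
  also have "\<dots> = (\<Sum>k\<in>{K..<K'}. real k * a k)"
  proof -
    have "(\<Sum>x\<in>I. a (fst x)) = (\<Sum>(k, i)\<in>Sigma {K..<K'} (\<lambda>k. {..<k}). a k)"
      by (simp add: I_def case_prod_beta')
    also have "\<dots> = (\<Sum>k\<in>{K..<K'}. \<Sum>i\<in>{..<k}. a k)" by (rule sum.Sigma[symmetric]) auto
    finally show ?thesis by simp
  qed
  finally show ?thesis by blast
qed

lemma convergence_case:
  assumes adm: "admissible_psi \<psi>"
    and sum: "summable (\<lambda>n::nat. ln (real n) * \<psi> (real n) powr s / real n)"
  shows "hausdorff_ae s (limit_set p q r) (badly_sym_approx p q r \<psi>)"
proof -
  obtain T where T: "2 \<le> T" and pos: "\<And>t. T \<le> t \<Longrightarrow> 0 < \<psi> t"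
    and mono: "\<And>s t. T \<le> s \<Longrightarrow> s \<le> t \<Longrightarrow> \<psi> t \<le> \<psi> s"
    using admissible_psi_pos_mono[OF adm] by blast
  obtain k0 :: nat where k0: "T < 2 ^ k0" using real_arch_pow[of 2 T] by auto
  \<comment> \<open>The radius belongs to the approximation constant 1. Different pairs may give the
    same point \<open>Y v w\<close>; the surplus balls do no harm.\<close>
  define \<rho> where "\<rho> x = (case x of (v, w) \<Rightarrow> \<psi> (qden v w) / qden v w)" for x
  define I where "I K = {(v :: 'e list, w :: 'e list). w \<noteq> [] \<and> K \<le> length v + length w}" for K
  define BK where "BK K = (\<Union>x\<in>I K. cball (case x of (v, w) \<Rightarrow> Y v w) (\<rho> x))" for K
  \<comment> \<open>One factor 2 comes from the diameter \<open>2 * \<rho>\<close> and one from the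
    halving in \<open>qden_ge\<close>.\<close>
  define a where "a k = 4 powr s * \<psi> (2 ^ (k - 1)) powr s" for k
  have big: "T \<le> 2 ^ (k - 1)" if "Suc k0 \<le> k" for k
  proof -
    have "(2::real) ^ k0 \<le> 2 ^ (k - 1)" using that by (intro power_increasing) auto
    then show ?thesis using k0 by linarith
  qed
  have qden_T: "T \<le> qden v w" if "(v, w) \<in> I K" "Suc k0 \<le> K" for v w K
    using that big[of "length v + length w"] qden_ge_power[of w v] by (auto simp: I_def)
  have \<rho>_pos: "0 < \<rho> (v, w)" if "(v, w) \<in> I K" "Suc k0 \<le> K" for v w K
    using qden_T[OF that] pos[of "qden v w"] T by (auto simp: \<rho>_def)
  have \<rho>_le: "2 * \<rho> (v, w) \<le> 4 * \<psi> (2 ^ (length v + length w - 1)) / (Q v * Q w)"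
    if "(v, w) \<in> I K" "Suc k0 \<le> K" for v w K
  proof -
    have w: "w \<noteq> []" and k: "Suc k0 \<le> length v + length w" using that by (auto simp: I_def)
    have m: "\<psi> (qden v w) \<le> \<psi> (2 ^ (length v + length w - 1))"
      using big[OF k] qden_ge_power[OF w] by (rule mono)
    have "\<rho> (v, w) \<le> \<psi> (2 ^ (length v + length w - 1)) / (Q v * Q w / 2)"
      unfolding \<rho>_def prod.case
      using m pos[OF qden_T[OF that]] qden_ge[OF w, of v] by (intro frac_le) auto
    then show ?thesis by simp
  qed
  have null: "hausdorff_outer s (\<Inter>K. BK K) = 0"
  proof (rule hausdorff_outer_eq_0I)
    fix \<epsilon> \<eta> :: real assume "0 < \<epsilon>" "0 < \<eta>"
    have "summable (\<lambda>k. 4 powr s * (real k * \<psi> (2 ^ (k - 1)) powr s))"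
      by (intro summable_mult summable_condensed[OF T pos mono s_pos sum])
    then have "summable (\<lambda>k. real k * a k)" by (simp add: a_def mult.left_commute)
    then obtain N1 where N1: "\<And>m n. N1 \<le> m \<Longrightarrow> norm (\<Sum>k\<in>{m..<n}. real k * a k) < \<eta>"
      using \<open>0 < \<eta>\<close> unfolding summable_Cauchy by meson
    have "(\<lambda>k. 4 * \<psi> (2 ^ k0) * (1/2) ^ k) \<longlonglongrightarrow> 0"
      by (intro tendsto_mult_right_zero LIMSEQ_power_zero) auto
    then have "\<forall>\<^sub>F k in sequentially. 4 * \<psi> (2 ^ k0) * (1/2) ^ k < \<epsilon>"
      using \<open>0 < \<epsilon>\<close> by (rule order_tendstoD)
    then obtain N2 where N2: "\<And>k. N2 \<le> k \<Longrightarrow> 4 * \<psi> (2 ^ k0) * (1/2) ^ k < \<epsilon>"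
      by (auto simp: eventually_sequentially)
    define K where "K = max (Suc k0) (max N1 N2)"
    have K: "Suc k0 \<le> K" "N1 \<le> K" "N2 \<le> K" by (auto simp: K_def)
    show "hausdorff_content s \<epsilon> (\<Inter>K. BK K) \<le> ennreal \<eta>"
    proof (rule hausdorff_content_le[OF s_pos, where I = "I K" and d = "\<lambda>x. 2 * \<rho> x"
          and U = "\<lambda>x. cball (case x of (v, w) \<Rightarrow> Y v w) (\<rho> x)"])
      show "(\<Inter>K. BK K) \<subseteq> (\<Union>x\<in>I K. cball (case x of (v, w) \<Rightarrow> Y v w) (\<rho> x))"
        unfolding BK_def by blast
      show "0 \<le> \<epsilon>" using \<open>0 < \<epsilon>\<close> by simp
    next
      fix x assume x: "x \<in> I K"
      obtain v w where vw: "x = (v, w)" by (cases x)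
      have vwI: "(v, w) \<in> I K" using x vw by simp
      define k where "k = length v + length w"
      have k: "K \<le> k" using vwI by (auto simp: I_def k_def)
      have "2 * \<rho> x \<le> 4 * \<psi> (2 ^ (k - 1)) / (Q v * Q w)"
        using \<rho>_le[OF vwI K(1)] by (simp add: vw k_def)
      also have "\<dots> \<le> 4 * \<psi> (2 ^ k0) / 2 ^ k"
      proof (rule frac_le)
        show "4 * \<psi> (2 ^ (k - 1)) \<le> 4 * \<psi> (2 ^ k0)"
          using mono[of "2 ^ k0" "2 ^ (k - 1)"] k0 k K(1) by simp
        show "0 \<le> 4 * \<psi> (2 ^ k0)" using pos[of "2 ^ k0"] k0 by simp
        show "2 ^ k \<le> Q v * Q w" using Q_ge[of "v @ w"] by (simp add: k_def)
      qed simp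
      also have "\<dots> < \<epsilon>" using N2[of k] k K(3) by (simp add: power_one_over)
      finally have "2 * \<rho> x \<le> \<epsilon>" by simp
      moreover have "diameter (cball (Y v w) (\<rho> x)) \<le> 2 * \<rho> x"
        using \<rho>_pos[OF vwI K(1)] by (simp add: vw)
      ultimately show "bounded (cball (case x of (v, w) \<Rightarrow> Y v w) (\<rho> x)) \<and>
          diameter (cball (case x of (v, w) \<Rightarrow> Y v w) (\<rho> x)) \<le> 2 * \<rho> x \<and> 2 * \<rho> x \<le> \<epsilon>"
        by (simp add: vw)
    next
      fix F assume F: "finite F" "F \<subseteq> I K"
      have "\<exists>K'. (\<Sum>x\<in>F. (2 * \<rho> x) powr s) \<le> (\<Sum>k\<in>{K..<K'}. real k * a k)"
      proof (rule sum_word_pairs_le)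
        fix v w :: "'e list" assume "w \<noteq> []" "K \<le> length v + length w"
        then have vwI: "(v, w) \<in> I K" by (simp add: I_def)
        define X where "X = \<psi> (2 ^ (length v + length w - 1))"
        have "0 < X" using big[of "length v + length w"] pos K(1) \<open>K \<le> length v + length w\<close>
          by (simp add: X_def)
        have "(2 * \<rho> (v, w)) powr s \<le> (4 * X / (Q v * Q w)) powr s"
          using \<rho>_le[OF vwI K(1)] \<rho>_pos[OF vwI K(1)] s_pos by (intro powr_mono2) (auto simp: X_def)
        also have "\<dots> = a (length v + length w) * (W v * W w)"
        proof -
          have "a (length v + length w) = 4 powr s * X powr s" by (simp only: a_def X_def)
          then show ?thesis using \<open>0 < X\<close> by (simp add: powr_divide powr_mult powr_minus_divide)
        qed
        finally show "(2 * \<rho> (v, w)) powr s \<le> a (length v + length w) * (W v * W w)" .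
      qed (use F in \<open>auto simp: I_def\<close>)
      then obtain K' where "(\<Sum>x\<in>F. (2 * \<rho> x) powr s) \<le> (\<Sum>k\<in>{K..<K'}. real k * a k)" by blast
      also have "\<dots> \<le> norm (\<Sum>k\<in>{K..<K'}. real k * a k)" by simp
      also have "\<dots> < \<eta>" using N1 K(2) by blast
      finally show "(\<Sum>x\<in>F. (2 * \<rho> x) powr s) \<le> \<eta>" by simp
    qed
  qed
  \<comment> \<open>Outside the first set all but finitely many pairs are far enough away with
    constant 1. For an irrational point the distances to the remaining ones are positive, so a
    smaller constant absorbs them.\<close>
  define N where "N = (\<Inter>K. BK K) \<union> \<rat>"
  have "hausdorff_outer s N = 0"
    unfolding N_def by (intro hausdorff_outer_null_Un null hausdorff_outer_null_countable countable_rat s_pos)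
  moreover have "badly_sym_approx p q r \<psi> x" if x: "x \<in> limit_set p q r - N" for x
  proof -
    from x obtain K1 where "x \<notin> BK K1" and irr: "x \<notin> \<rat>" by (auto simp: N_def)
    define K where "K = max K1 (Suc k0)"
    have far: "\<rho> (v, w) \<le> \<bar>x - Y v w\<bar>" if "(v, w) \<in> I K" for v w
    proof -
      have "(v, w) \<in> I K1" using that by (auto simp: I_def K_def)
      then have "x \<notin> cball (Y v w) (\<rho> (v, w))" using \<open>x \<notin> BK K1\<close> by (auto simp: BK_def)
      then show ?thesis by (simp add: dist_real_def abs_minus_commute)
    qed
    define F where "F = {(v :: 'e list, w :: 'e list). w \<noteq> [] \<and> length v + length w < K}"
    have finF: "finite F"
    proof (rule finite_subset)
      show "F \<subseteq> (\<Union>n<K. words n) \<times> (\<Union>n<K. words n)" by (auto simp: F_def)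
    qed auto
    \<comment> \<open>At small arguments \<open>\<psi>\<close> is uncontrolled and may vanish or be
      negative; the absolute value plus 1 is a safe positive denominator.\<close>
    define h where "h x' = (case x' of (v, w) \<Rightarrow> \<bar>x - Y v w\<bar> * qden v w / (\<bar>\<psi> (qden v w)\<bar> + 1))" for x'
    have hpos: "0 < h y" if "y \<in> F" for y
    proof -
      obtain v w where y: "y = (v, w)" by (cases y)
      then have w: "w \<noteq> []" using that by (auto simp: F_def)
      have "x \<noteq> Y v w" using irr Y_Rats[OF w] by auto
      then show ?thesis using qden_pos[OF w, of v] by (simp add: h_def y add_nonneg_pos)
    qed
    obtain e where e: "0 < e" "e \<le> 1" "\<And>y. y \<in> F \<Longrightarrow> e \<le> h y"
      using finite_positive_lower_bound[of F h] finF hpos by blast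
    have "e * \<psi> (of_int (intrinsic_denom p q r y)) / of_int (intrinsic_denom p q r y) \<le> \<bar>x - y\<bar>"
      if y: "y \<in> \<rat> \<inter> limit_set p q r" for y
    proof -
      obtain \<eta> where \<eta>: "y = cm \<eta>" using y by (auto simp: limit_set_iff)
      obtain n m where nm: "1 \<le> m" "\<And>i. n \<le> i \<Longrightarrow> \<eta> (i + m) = \<eta> i"
        using cm_Rats_periodic[of \<eta>] y \<eta> by blast
      obtain v w where w: "w \<noteq> []" and Y: "cm \<eta> = Y v w"
        and qint: "of_int (intrinsic_denom p q r (cm \<eta>)) = Q v * (Q w - pw w)"
        using intrinsic_data[of m n \<eta>, OF nm] by metis
      have qd: "of_int (intrinsic_denom p q r y) = qden v w" using qint by (simp add: \<eta> qden_def)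
      have "e * \<psi> (qden v w) / qden v w \<le> \<bar>x - Y v w\<bar>"
      proof (cases "length v + length w < K")
        case True
        then have "e \<le> h (v, w)" using e(3) w by (simp add: F_def)
        then have "e * (\<bar>\<psi> (qden v w)\<bar> + 1) \<le> \<bar>x - Y v w\<bar> * qden v w"
          unfolding h_def prod.case by (subst (asm) le_divide_eq) auto
        moreover have "e * \<psi> (qden v w) \<le> e * (\<bar>\<psi> (qden v w)\<bar> + 1)"
          using e(1) by (intro mult_left_mono) auto
        ultimately show ?thesis using qden_pos[OF w, of v] by (simp add: divide_le_eq)
      next
        case False
        then have I: "(v, w) \<in> I K" using w by (simp add: I_def)
        have "e * \<rho> (v, w) \<le> 1 * \<rho> (v, w)"
          using e(2) \<rho>_pos[OF I] by (intro mult_right_mono) (auto simp: K_def)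
        then show ?thesis using far[OF I] by (simp add: \<rho>_def)
      qed
      then show ?thesis unfolding qd unfolding \<eta> Y .
    qed
    then show ?thesis unfolding badly_sym_approx_def using e(1) by blast
  qed
  ultimately show ?thesis unfolding hausdorff_ae_def by blast
qed

end

subsection \<open>Matches within a stage\<close>

text \<open>In the induction a repeated value adds nothing on the right; on the left its term is
  cancelled by the correction for an earlier index with the same value.\<close>

lemma sum_image_ge_bonferroni:
  fixes f :: "nat \<Rightarrow> 'a" and h :: "'a \<Rightarrow> real"
  assumes "\<And>x. 0 \<le> h x"
  shows "(\<Sum>n<M. h (f n)) - (\<Sum>n<M. \<Sum>m<n. of_bool (f m = f n) * h (f n)) \<le> (\<Sum>x\<in>f ` {..<M}. h x)"
proof (induction M)
  case (Suc M)
  have nn: "0 \<le> (\<Sum>m<M. of_bool (f m = f M) * h (f M))"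
    using assms by (intro sum_nonneg) auto
  show ?case
  proof (cases "f M \<in> f ` {..<M}")
    case True
    then obtain m where m: "m < M" "f m = f M" by auto
    have "of_bool (f m = f M) * h (f M) \<le> (\<Sum>m<M. of_bool (f m = f M) * h (f M))"
      using m assms by (intro member_le_sum) auto
    then show ?thesis using Suc True m by (simp add: lessThan_Suc insert_absorb)
  next
    case False
    then show ?thesis using Suc nn by (simp add: lessThan_Suc)
  qed
qed simp

lemma sum_real_lessThan_le: "(\<Sum>n<M. real n) \<le> real M * real M / 2"
  by (induction M) (simp_all add: field_simps)

text \<open>With \<open>y = T * x\<close> the chain is \<open>(1 - x) ^ T \<le> exp (- y) \<le> 1 /
  (1 + y) \<le> 1 - y / 2\<close>. It serves to bound the weight of at least one success in
  \<open>T\<close> independent trials by half the expected number of successes.\<close>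

lemma one_minus_power_ge:
  fixes x :: real
  assumes "0 \<le> x" "x \<le> 1" "real T * x \<le> 1"
  shows "real T * x / 2 \<le> 1 - (1 - x) ^ T"
proof -
  define y where "y = real T * x"
  have y: "0 \<le> y" "y \<le> 1" using assms by (auto simp: y_def)
  have "(1 - x) ^ T \<le> exp (- x) ^ T"
    using assms exp_ge_add_one_self[of "- x"] by (intro power_mono) auto
  also have "\<dots> = inverse (exp y)" by (simp add: y_def flip: exp_of_nat_mult exp_minus)
  also have "\<dots> \<le> inverse (1 + y)" using y by (intro le_imp_inverse_le) auto
  also have "\<dots> \<le> 1 - y / 2"
  proof -
    have "1 \<le> (1 - y / 2) * (1 + y)"
      using y mult_left_mono[of y 1 y] by (simp add: algebra_simps)
    then show ?thesis using y by (simp add: field_simps)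
  qed
  finally show ?thesis by (simp add: y_def)
qed

section \<open>Words cut at a prescribed weight\<close>

context rational_ifs
begin

text \<open>The shortest prefix \<open>w\<close> of the argument with \<open>R \<le> Q w\<close> (provided there is one).\<close>

fun cut :: "real \<Rightarrow> 'e list \<Rightarrow> 'e list" where
  "cut R [] = []"
| "cut R (a # z) = (if R \<le> 1 then [] else a # cut (R / real (q a)) z)"

lemma q_pos [simp]: "0 < real (q a)" "q a \<noteq> 0" "0 < q a"
  using q_ge2[of a] by auto

lemma div_q_le: "R \<le> 2 ^ Suc n \<Longrightarrow> R / real (q a) \<le> 2 ^ n"
proof -
  assume "R \<le> 2 ^ Suc n"
  also have "\<dots> \<le> real (q a) * 2 ^ n" using q_ge2[of a] by simp
  finally show ?thesis by (simp add: divide_le_eq mult.commute)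
qed

lemma cut_R_le_1 [simp]: "R \<le> 1 \<Longrightarrow> cut R z = []"
  by (cases z) auto

lemma take_cut: "take (length (cut R z)) z = cut R z"
  by (induction R z rule: cut.induct) auto

lemma cut_nth: "i < length (cut R z) \<Longrightarrow> cut R z ! i = z ! i"
  using nth_take[of i "length (cut R z)" z] by (simp only: take_cut)

lemma length_cut_le: "R \<le> 2 ^ L \<Longrightarrow> length (cut R z) \<le> L"
proof (induction R z arbitrary: L rule: cut.induct)
  case (2 R a z)
  show ?case
  proof (cases L)
    case 0
    then show ?thesis using 2 by simp
  next
    case (Suc l)
    then show ?thesis using 2 div_q_le[of R l a] by simp
  qed
qed simp

lemma Q_cut_ge: "R \<le> 2 ^ length z \<Longrightarrow> R \<le> Q (cut R z)"
proof (induction R z rule: cut.induct)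
  case (2 R a z)
  then show ?case using div_q_le[of R "length z" a] Q_ge1[of "cut R (a # z)"]
    by (auto simp: divide_le_eq mult.commute)
qed simp

text \<open>The last letter read overshoots \<open>R\<close> by at most a factor \<open>b\<close>;
  the 1 accounts for the empty cut.\<close>

lemma Q_cut_le: "Q (cut R z) \<le> max 1 (real b * R)"
proof (induction R z rule: cut.induct)
  case (2 R a z)
  show ?case
  proof (cases "R \<le> 1")
    case False
    then have "real (q a) * Q (cut (R / real (q a)) z) \<le> real (q a) * max 1 (real b * (R / real (q a)))"
      using 2 by (intro mult_left_mono) auto
    also have "\<dots> = max (real (q a)) (real b * R)" by (simp add: max_mult_distrib_left)
    also have "\<dots> \<le> max 1 (real b * R)"
    proof -
      have "real (q a) * 1 \<le> real b * R" using False q_le[of a] by (intro mult_mono) auto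
      then show ?thesis by simp
    qed
    finally show ?thesis using False by simp
  qed simp
qed simp

lemma cut_append: "R \<le> 2 ^ length z \<Longrightarrow> cut R (z @ y) = cut R z"
proof (induction R z rule: cut.induct)
  case (2 R a z)
  then show ?case using div_q_le[of R "length z" a] by auto
qed simp

text \<open>The stopping rule reads no letter beyond the cut, so cuts form a prefix-free code. The
  bound on \<open>R\<close> ensures that the threshold is reached within \<open>z\<close>, rather
  than the word merely ending.\<close>

lemma cut_unique:
  assumes "R \<le> 2 ^ length z" "take (length (cut R z)) z' = cut R z"
  shows "cut R z' = cut R z"
  using assms
proof (induction R z arbitrary: z' rule: cut.induct)
  case (2 R a z)
  show ?case
  proof (cases "R \<le> 1")
    case False
    then have "take (Suc (length (cut (R / real (q a)) z))) z' = a # cut (R / real (q a)) z"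
      using 2 by simp
    then obtain y where y: "z' = a # y" "take (length (cut (R / real (q a)) z)) y = cut (R / real (q a)) z"
      by (cases z') auto
    have "R \<le> 2 ^ Suc (length z)" using "2.prems"(1) by simp
    then have "cut (R / real (q a)) y = cut (R / real (q a)) z"
      by (intro "2.IH"[OF False _ y(2)] div_q_le)
    then show ?thesis using False y(1) by simp
  qed simp
qed simp

text \<open>By hypothesis the letters of the cut at places below \<open>length t\<close> are those
  of \<open>t\<close>, and each later one equals the letter \<open>length t\<close> places earlier.
  So both cuts are prefixes of \<open>ttt...\<close>, and a prefix-free code leaves only
  one.\<close>

lemma cut_periodic_unique:
  assumes s: "t \<noteq> []" and len: "R \<le> 2 ^ length y" "R \<le> 2 ^ length y'"
    and eq: "cut R (t @ y) = cut R y" "cut R (t @ y') = cut R y'"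
  shows "cut R y = cut R y'"
proof -
  have nth: "z ! i = (if i < length t then t ! i else z ! (i - length t))"
    if "cut R (t @ z) = cut R z" "i < length (cut R z)" for z i
    using cut_nth[of i R z] cut_nth[of i R "t @ z"] that by (simp add: nth_append)
  have agree: "y ! i = y' ! i" if "i < length (cut R y)" "i < length (cut R y')" for i
    using that
  proof (induction i rule: less_induct)
    case (less i)
    show ?case
    proof (cases "i < length t")
      case True
      then show ?thesis using nth[OF eq(1)] nth[OF eq(2)] less.prems by simp
    next
      case False
      then have lt: "i - length t < i" using s by (cases t) auto
      have "y ! (i - length t) = y' ! (i - length t)"
        by (rule less.IH[OF lt]) (use less.prems in auto)
      with False show ?thesis using nth[OF eq(1)] nth[OF eq(2)] less.prems by simp
    qed
  qed
  \<comment> \<open>The shorter cut is a prefix of the other word, to which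
    \<open>cut_unique\<close> applies. The words are general because either cut may be the shorter
    one.\<close>
  have *: "cut R z' = cut R z"
    if "length (cut R z) \<le> length (cut R z')" "R \<le> 2 ^ length z"
      and ag: "\<And>i. i < length (cut R z) \<Longrightarrow> i < length (cut R z') \<Longrightarrow> z ! i = z' ! i" for z z'
  proof (rule cut_unique[OF that(2)])
    have "length (cut R z') \<le> length z'" using arg_cong[OF take_cut[of R z'], of length] by simp
    then show "take (length (cut R z)) z' = cut R z"
      using that(1) ag by (intro nth_equalityI) (auto simp: cut_nth)
  qed
  show ?thesis
  proof (cases "length (cut R y) \<le> length (cut R y')")
    case True
    show ?thesis by (rule *[OF True len(1) agree, symmetric])
  next
    case False
    then show ?thesis by (intro *[OF _ len(2)]) (simp_all add: agree)
  qed
qed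

section \<open>Weights of cuts and of coincidences between cuts\<close>

lemma sum_W_prefix:
  assumes "length w \<le> L"
  shows "(\<Sum>z\<in>words L. of_bool (take (length w) z = w) * W z) = W w"
proof -
  have "(\<Sum>z\<in>words (length w + (L - length w)). of_bool (take (length w) z = w) * W z)
      = (\<Sum>x\<in>words (length w). \<Sum>y\<in>words (L - length w). of_bool (x = w) * W x * W y)"
    unfolding sum_words_add by (intro sum.cong refl) (simp add: powr_mult)
  also have "\<dots> = (\<Sum>x\<in>words (length w). of_bool (x = w) * W x)"
    by (simp add: sum_W flip: sum_distrib_left)
  also have "\<dots> = (\<Sum>x\<in>words (length w). if x = w then W x else 0)"
    by (intro sum.cong) auto
  also have "\<dots> = W w" by (subst sum.delta) auto
  finally show ?thesis using assms by simp
qed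

lemma sum_W_cut:
  assumes "R \<le> 2 ^ L" "length y = L"
  shows "(\<Sum>z\<in>words L. of_bool (cut R z = cut R y) * W z) = W (cut R y)"
proof -
  have "(\<Sum>z\<in>words L. of_bool (cut R z = cut R y) * W z)
      = (\<Sum>z\<in>words L. of_bool (take (length (cut R y)) z = cut R y) * W z)"
  proof (intro sum.cong refl)
    fix z :: "'e list"
    have "cut R z = cut R y \<longleftrightarrow> take (length (cut R y)) z = cut R y"
      using cut_unique[of R y z] assms take_cut[of R z] by auto
    then show "of_bool (cut R z = cut R y) * W z = of_bool (take (length (cut R y)) z = cut R y) * W z"
      by simp
  qed
  then show ?thesis using sum_W_prefix[of "cut R y" L] length_cut_le[OF assms(1)] by simp
qed

lemma W_cut_le: "0 < R \<Longrightarrow> R \<le> 2 ^ length z \<Longrightarrow> W (cut R z) \<le> R powr (-s)"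
  using Q_cut_ge s_pos by (intro powr_mono2') auto

lemma W_cut_ge:
  assumes "1 \<le> R" shows "real b powr (-s) * R powr (-s) \<le> W (cut R z)"
proof -
  have "1 * 1 \<le> real b * R" using assms b_ge2 by (intro mult_mono) auto
  then have "Q (cut R z) \<le> real b * R" using Q_cut_le[of R z] by simp
  then have "(real b * R) powr (-s) \<le> W (cut R z)" using s_pos by (intro powr_mono2') auto
  then show ?thesis using assms by (simp add: powr_mult)
qed

text \<open>Given \<open>t\<close>, the common cut of \<open>y\<close> and \<open>t @ y\<close> is forced: it is the cut of \<open>ttt...\<close>.\<close>

lemma sum_W_self_match_le:
  assumes t: "t \<noteq> []" and R: "0 < R" "R \<le> 2 ^ m"
  shows "(\<Sum>y\<in>words m. of_bool (cut R (t @ y) = cut R y) * W y) \<le> R powr (-s)"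
proof (cases "\<exists>y\<in>words m. cut R (t @ y) = cut R y")
  case True
  then obtain y0 where y0: "length y0 = m" "cut R (t @ y0) = cut R y0" by auto
  have "(\<Sum>y\<in>words m. of_bool (cut R (t @ y) = cut R y) * W y)
      \<le> (\<Sum>y\<in>words m. of_bool (cut R y = cut R y0) * W y)"
  proof (rule sum_mono)
    fix y :: "'e list" assume "y \<in> words m"
    then show "of_bool (cut R (t @ y) = cut R y) * W y \<le> of_bool (cut R y = cut R y0) * W y"
      using cut_periodic_unique[OF t, of R y y0] y0 R by auto
  qed
  also have "\<dots> = W (cut R y0)" using sum_W_cut[OF R(2) y0(1)] .
  also have "\<dots> \<le> R powr (-s)" using W_cut_le[OF R(1), of y0] R(2) y0(1) by simp
  finally show ?thesis .
next
  case False
  then have "(\<Sum>y\<in>words m. of_bool (cut R (t @ y) = cut R y) * W y) = 0"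
    by (intro sum.neutral) auto
  then show ?thesis by simp
qed

text \<open>The two words may overlap, so they are not independent. Conditioning on the first
  \<open>n'\<close> letters \<open>t\<close> leaves a self-match with the nonempty shift
  \<open>drop n t\<close>, which \<open>sum_W_self_match_le\<close> bounds.\<close>

lemma sum_W_coincidence_le:
  assumes nm: "n < n'" "n' + L \<le> m" and R: "0 < R" "R \<le> 2 ^ L"
  shows "(\<Sum>x\<in>words m. of_bool (cut R (drop n x) = cut R (drop n' x)) * W x) \<le> R powr (-s)"
proof -
  have R': "R \<le> 2 ^ (m - n')"
    by (rule order_trans[OF R(2)], rule power_increasing) (use nm in auto)
  have "(\<Sum>x\<in>words m. of_bool (cut R (drop n x) = cut R (drop n' x)) * W x)
      = (\<Sum>x\<in>words (n' + (m - n')). of_bool (cut R (drop n x) = cut R (drop n' x)) * W x)"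
    using nm by simp
  also have "\<dots> = (\<Sum>t\<in>words n'. \<Sum>y\<in>words (m - n'). W t * (of_bool (cut R (drop n t @ y) = cut R y) * W y))"
    unfolding sum_words_add using nm by (intro sum.cong refl) (simp add: powr_mult)
  also have "\<dots> = (\<Sum>t\<in>words n'. W t * (\<Sum>y\<in>words (m - n'). of_bool (cut R (drop n t @ y) = cut R y) * W y))"
    by (simp only: sum_distrib_left)
  also have "\<dots> \<le> (\<Sum>t\<in>words n'. W t * R powr (-s))"
    using nm R(1) R' by (intro sum_mono mult_left_mono sum_W_self_match_le) auto
  also have "\<dots> = R powr (-s)" by (simp add: sum_W flip: sum_distrib_right)
  finally show ?thesis .
qed

text \<open>The earlier words are read from the first \<open>M + L\<close> letters only, so that
  they do not depend on the \<open>T\<close> blocks of length \<open>L\<close> that follow. For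
  \<open>R \<le> 2 ^ L\<close> each cut is determined by \<open>L\<close> letters.\<close>

definition hit :: "real \<Rightarrow> nat \<Rightarrow> nat \<Rightarrow> nat \<Rightarrow> 'e list \<Rightarrow> bool" where
  "hit R M T L z \<longleftrightarrow> (\<exists>n<M. \<exists>k<T. cut R (drop n (take (M + L) z)) = cut R (drop (M + L + k * L) z))"

text \<open>The blocks do not overlap and a cut reads at most \<open>L\<close> letters, so the
  trials are independent; the induction peels off the first block.\<close>

lemma sum_W_miss_trials:
  assumes R: "R \<le> 2 ^ L"
  shows "(\<Sum>y\<in>words (T * L). of_bool (\<forall>k<T. cut R (drop (k * L) y) \<notin> S) * W y)
    = (1 - (\<Sum>z\<in>words L. of_bool (cut R z \<in> S) * W z)) ^ T"
proof (induction T)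
  case 0
  show ?case by simp
next
  case (Suc T)
  define \<sigma> where "\<sigma> = (\<Sum>z\<in>words L. of_bool (cut R z \<in> S) * W z)"
  have miss: "(\<Sum>z\<in>words L. of_bool (cut R z \<notin> S) * W z) = 1 - \<sigma>"
  proof -
    have "(\<Sum>z\<in>words L. of_bool (cut R z \<notin> S) * W z) + \<sigma> = (\<Sum>z\<in>words L. W z)"
      unfolding \<sigma>_def sum.distrib[symmetric] by (intro sum.cong) auto
    then show ?thesis by (simp add: sum_W)
  qed
  have "(\<Sum>y\<in>words (Suc T * L). of_bool (\<forall>k<Suc T. cut R (drop (k * L) y) \<notin> S) * W y)
     = (\<Sum>z\<in>words L. \<Sum>y\<in>words (T * L). (of_bool (cut R z \<notin> S) * W z) *
           (of_bool (\<forall>k<T. cut R (drop (k * L) y) \<notin> S) * W y))"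
    unfolding mult_Suc sum_words_add
  proof (intro sum.cong refl)
    fix z y :: "'e list" assume z: "z \<in> words L" "y \<in> words (T * L)"
    have "(\<forall>k<Suc T. cut R (drop (k * L) (z @ y)) \<notin> S) \<longleftrightarrow>
        cut R z \<notin> S \<and> (\<forall>k<T. cut R (drop (k * L) y) \<notin> S)"
      using z R by (simp add: All_less_Suc2 cut_append)
    then show "of_bool (\<forall>k<Suc T. cut R (drop (k * L) (z @ y)) \<notin> S) * W (z @ y) =
        of_bool (cut R z \<notin> S) * W z * (of_bool (\<forall>k<T. cut R (drop (k * L) y) \<notin> S) * W y)"
      by (simp only: W_append) simp
  qed
  also have "\<dots> = (\<Sum>z\<in>words L. of_bool (cut R z \<notin> S) * W z) *
      (\<Sum>y\<in>words (T * L). of_bool (\<forall>k<T. cut R (drop (k * L) y) \<notin> S) * W y)"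
    by (rule sum_product[symmetric])
  also have "\<dots> = (1 - \<sigma>) * (1 - \<sigma>) ^ T"
    by (simp only: miss Suc[folded \<sigma>_def])
  finally show ?case by (simp add: \<sigma>_def)
qed

text \<open>Let \<open>\<sigma> x\<close> be the weight of success of one trial given the first part
  \<open>x\<close>. Bonferroni bounds its mean \<open>E\<close> below by
  \<open>M * \<rho> * b powr (-s)\<close> minus pair terms of total at most
  \<open>(M * \<rho>)\<^sup>2 / 2\<close>, and the bound on \<open>M\<close> makes these at most
  half the main term. The bound on \<open>T\<close> allows \<open>one_minus_power_ge\<close>, which
  costs another factor 2; hence the 4.\<close>

lemma sum_W_hit_ge:
  assumes R: "1 \<le> R" "R \<le> 2 ^ L"
    and M: "real M * R powr (-s) \<le> real b powr (-s)" and T: "real T * (real M * R powr (-s)) \<le> 1"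
  shows "real T * (real M * R powr (-s)) * real b powr (-s) / 4
    \<le> (\<Sum>z\<in>words (M + L + T * L). of_bool (hit R M T L z) * W z)"
proof -
  define \<rho> where "\<rho> = R powr (-s)"
  define f where "f x n = cut R (drop n x)" for x n
  define \<sigma> where "\<sigma> x = (\<Sum>z\<in>words L. of_bool (cut R z \<in> f x ` {..<M}) * W z)" for x
  have \<rho>0: "0 \<le> \<rho>" by (simp add: \<rho>_def)
  have long: "R \<le> 2 ^ length (drop n x)" if "n < M" "x \<in> words (M + L)" for n x
    by (rule order_trans[OF R(2)], rule power_increasing) (use that in auto)
  \<comment> \<open>Distinct cuts have disjoint cylinders, so their weights add; a cut occurring at
    several positions counts once.\<close>
  have \<sigma>_eq: "\<sigma> x = (\<Sum>w\<in>f x ` {..<M}. W w)" if x: "x \<in> words (M + L)" for x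
  proof -
    have "\<sigma> x = (\<Sum>z\<in>words L. \<Sum>w\<in>f x ` {..<M}. of_bool (cut R z = w) * W z)"
    proof (unfold \<sigma>_def, intro sum.cong refl)
      fix z
      have "(\<Sum>w\<in>f x ` {..<M}. of_bool (cut R z = w) * W z) = (\<Sum>w\<in>f x ` {..<M}. if cut R z = w then W z else 0)"
        by (intro sum.cong) auto
      also have "\<dots> = of_bool (cut R z \<in> f x ` {..<M}) * W z" by (subst sum.delta') auto
      finally show "of_bool (cut R z \<in> f x ` {..<M}) * W z = (\<Sum>w\<in>f x ` {..<M}. of_bool (cut R z = w) * W z)" ..
    qed
    also have "\<dots> = (\<Sum>w\<in>f x ` {..<M}. \<Sum>z\<in>words L. of_bool (cut R z = w) * W z)"
      by (rule sum.swap)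
    also have "\<dots> = (\<Sum>w\<in>f x ` {..<M}. W w)"
    proof (intro sum.cong refl)
      fix w assume "w \<in> f x ` {..<M}"
      then obtain n where n: "n < M" "w = cut R (drop n x)" by (auto simp: f_def)
      define y where "y = take L (drop n x)"
      have len: "length y = L" using n x by (simp add: y_def)
      have "w = cut R y"
        using cut_append[of R y "drop L (drop n x)"] n(2) R(2) len unfolding y_def append_take_drop_id by metis
      then show "(\<Sum>z\<in>words L. of_bool (cut R z = w) * W z) = W w"
        using sum_W_cut[OF R(2) len] by simp
    qed
    finally show ?thesis .
  qed
  have Wf: "W (f x n) \<le> \<rho>" "real b powr (-s) * \<rho> \<le> W (f x n)" if "n < M" "x \<in> words (M + L)" for x n
    unfolding f_def \<rho>_def by (rule W_cut_le[OF _ long[OF that]], use R(1) in simp, rule W_cut_ge[OF R(1)])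
  have \<sigma>0: "0 \<le> \<sigma> x" for x unfolding \<sigma>_def by (intro sum_nonneg) auto
  have \<sigma>_le: "\<sigma> x \<le> real M * \<rho>" if x: "x \<in> words (M + L)" for x
  proof -
    have "\<sigma> x \<le> (\<Sum>n<M. W (f x n))"
      unfolding \<sigma>_eq[OF x] using sum_image_le[of "{..<M}" W "f x"] by (simp add: o_def)
    also have "\<dots> \<le> (\<Sum>n<M. \<rho>)" by (intro sum_mono Wf(1) x) simp
    finally show ?thesis by simp
  qed
  have b1: "real b powr (-s) \<le> 1"
    using powr_mono2'[of "-s" 1 "real b"] s_pos b_ge2 by simp
  define E where "E = (\<Sum>x\<in>words (M + L). W x * \<sigma> x)"
  have E: "real M * \<rho> * real b powr (-s) / 2 \<le> E"
  proof -
    \<comment> \<open>One factor \<open>\<rho>\<close> bounds \<open>W (f x n)\<close>, the other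
      the weight of the coincidence.\<close>
    have coin: "(\<Sum>x\<in>words (M + L). W x * (of_bool (f x m = f x n) * W (f x n))) \<le> \<rho> * \<rho>"
      if "m < n" "n < M" for m n
    proof -
      have "(\<Sum>x\<in>words (M + L). W x * (of_bool (f x m = f x n) * W (f x n)))
          \<le> (\<Sum>x\<in>words (M + L). (of_bool (f x m = f x n) * W x) * \<rho>)"
      proof (rule sum_mono)
        fix x :: "'e list" assume "x \<in> words (M + L)"
        then have "W x * W (f x n) \<le> W x * \<rho>" using that(2) by (intro mult_left_mono Wf(1)) auto
        then show "W x * (of_bool (f x m = f x n) * W (f x n)) \<le> of_bool (f x m = f x n) * W x * \<rho>"
          by simp
      qed
      also have "\<dots> = (\<Sum>x\<in>words (M + L). of_bool (f x m = f x n) * W x) * \<rho>"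
        by (simp only: sum_distrib_right)
      also have "\<dots> \<le> \<rho> * \<rho>"
        unfolding f_def \<rho>_def using that R by (intro mult_right_mono sum_W_coincidence_le[where L = L]) auto
      finally show ?thesis .
    qed
    have "real M * (real b powr (-s) * \<rho>) - (\<Sum>n<M. real n * (\<rho> * \<rho>))
        \<le> (\<Sum>n<M. \<Sum>x\<in>words (M + L). W x * W (f x n))
          - (\<Sum>n<M. \<Sum>m<n. \<Sum>x\<in>words (M + L). W x * (of_bool (f x m = f x n) * W (f x n)))"
    proof (rule diff_mono)
      have "real b powr (-s) * \<rho> \<le> (\<Sum>x\<in>words (M + L). W x * W (f x n))" if "n < M" for n
      proof -
        have "(\<Sum>x\<in>words (M + L). W x * (real b powr (-s) * \<rho>)) \<le> (\<Sum>x\<in>words (M + L). W x * W (f x n))"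
          using that by (intro sum_mono mult_left_mono Wf(2)) auto
        then show ?thesis by (simp only: sum_W mult_1 flip: sum_distrib_right)
      qed
      then have "(\<Sum>n<M. real b powr (-s) * \<rho>) \<le> (\<Sum>n<M. \<Sum>x\<in>words (M + L). W x * W (f x n))"
        by (intro sum_mono) (simp only: lessThan_iff)
      then show "real M * (real b powr (-s) * \<rho>) \<le> (\<Sum>n<M. \<Sum>x\<in>words (M + L). W x * W (f x n))"
        by (simp only: sum_constant card_lessThan)
      show "(\<Sum>n<M. \<Sum>m<n. \<Sum>x\<in>words (M + L). W x * (of_bool (f x m = f x n) * W (f x n)))
          \<le> (\<Sum>n<M. real n * (\<rho> * \<rho>))"
      proof (rule sum_mono)
        fix n assume "n \<in> {..<M}"
        then have "(\<Sum>m<n. \<Sum>x\<in>words (M + L). W x * (of_bool (f x m = f x n) * W (f x n))) \<le> (\<Sum>m<n. \<rho> * \<rho>)"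
          by (intro sum_mono coin) auto
        then show "(\<Sum>m<n. \<Sum>x\<in>words (M + L). W x * (of_bool (f x m = f x n) * W (f x n))) \<le> real n * (\<rho> * \<rho>)"
          by (simp only: sum_constant card_lessThan)
      qed
    qed
    also have "\<dots> = (\<Sum>x\<in>words (M + L). W x * ((\<Sum>n<M. W (f x n)) - (\<Sum>n<M. \<Sum>m<n. of_bool (f x m = f x n) * W (f x n))))"
    proof -
      have 1: "(\<Sum>n<M. \<Sum>x\<in>words (M + L). W x * W (f x n)) = (\<Sum>x\<in>words (M + L). W x * (\<Sum>n<M. W (f x n)))"
        unfolding sum_distrib_left by (rule sum.swap)
      have "(\<Sum>m<n. \<Sum>x\<in>words (M + L). W x * (of_bool (f x m = f x n) * W (f x n)))
         = (\<Sum>x\<in>words (M + L). W x * (\<Sum>m<n. of_bool (f x m = f x n) * W (f x n)))" for n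
        unfolding sum_distrib_left by (rule sum.swap)
      then have 2: "(\<Sum>n<M. \<Sum>m<n. \<Sum>x\<in>words (M + L). W x * (of_bool (f x m = f x n) * W (f x n)))
        = (\<Sum>x\<in>words (M + L). W x * (\<Sum>n<M. \<Sum>m<n. of_bool (f x m = f x n) * W (f x n)))"
        by (simp only: sum_distrib_left) (rule sum.swap)
      show ?thesis unfolding 1 2 right_diff_distrib sum_subtractf ..
    qed
    also have "\<dots> \<le> E"
      unfolding E_def
    proof (intro sum_mono mult_left_mono)
      fix x :: "'e list" assume x: "x \<in> words (M + L)"
      show "(\<Sum>n<M. W (f x n)) - (\<Sum>n<M. \<Sum>m<n. of_bool (f x m = f x n) * W (f x n)) \<le> \<sigma> x"
        unfolding \<sigma>_eq[OF x] by (intro sum_image_ge_bonferroni) simp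
    qed simp
    finally have A: "real M * (real b powr (-s) * \<rho>) - (\<Sum>n<M. real n * (\<rho> * \<rho>)) \<le> E" .
    have "(\<Sum>n<M. real n) \<le> real M * real M / 2"
      by (rule sum_real_lessThan_le)
    then have "(\<Sum>n<M. real n) * (\<rho> * \<rho>) \<le> real M * real M / 2 * (\<rho> * \<rho>)"
      by (rule mult_right_mono) (simp add: \<rho>0)
    also have "\<dots> = (real M * \<rho>) * (real M * \<rho>) / 2" by simp
    also have "\<dots> \<le> (real M * \<rho>) * real b powr (-s) / 2"
      using M \<rho>0 by (intro divide_right_mono mult_left_mono) (auto simp: \<rho>_def)
    finally have B: "(\<Sum>n<M. real n * (\<rho> * \<rho>)) \<le> (real M * \<rho>) * real b powr (-s) / 2"
      by (simp add: sum_distrib_right)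
    have "real M * (real b powr (-s) * \<rho>) = (real M * \<rho>) * real b powr (-s)" by simp
    with A B show ?thesis by linarith
  qed
  \<comment> \<open>Given \<open>x\<close>, all trials fail with weight
    \<open>(1 - \<sigma> x) ^ T\<close>.\<close>
  have hit_eq: "(\<Sum>z\<in>words (M + L + T * L). of_bool (hit R M T L z) * W z)
      = (\<Sum>x\<in>words (M + L). W x * (1 - (1 - \<sigma> x) ^ T))"
    unfolding sum_words_add[of _ "M + L"]
  proof (intro sum.cong refl)
    fix x :: "'e list" assume x: "x \<in> words (M + L)"
    have "(\<Sum>y\<in>words (T * L). of_bool (hit R M T L (x @ y)) * W (x @ y))
        = (\<Sum>y\<in>words (T * L). W x * (W y - of_bool (\<forall>k<T. cut R (drop (k * L) y) \<notin> f x ` {..<M}) * W y))"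
    proof (intro sum.cong refl)
      fix y :: "'e list"
      have h: "hit R M T L (x @ y) \<longleftrightarrow> \<not> (\<forall>k<T. cut R (drop (k * L) y) \<notin> f x ` {..<M})"
      proof -
        have "hit R M T L (x @ y) \<longleftrightarrow> (\<exists>n<M. \<exists>k<T. f x n = cut R (drop (k * L) y))"
          using x by (simp add: hit_def f_def)
        also have "\<dots> \<longleftrightarrow> \<not> (\<forall>k<T. cut R (drop (k * L) y) \<notin> f x ` {..<M})"
          unfolding image_iff by (metis lessThan_iff)
        finally show ?thesis .
      qed
      have split: "of_bool (\<not> P) * (a * c) = a * (c - of_bool P * c)" for P and a c :: real
        by (cases P) simp_all
      show "of_bool (hit R M T L (x @ y)) * W (x @ y)
          = W x * (W y - of_bool (\<forall>k<T. cut R (drop (k * L) y) \<notin> f x ` {..<M}) * W y)"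
        unfolding h W_append by (rule split)
    qed
    also have "\<dots> = W x * (1 - (1 - \<sigma> x) ^ T)"
      unfolding sum_distrib_left[symmetric] sum_subtractf sum_W sum_W_miss_trials[OF R(2)] \<sigma>_def ..
    finally show "(\<Sum>y\<in>words (T * L). of_bool (hit R M T L (x @ y)) * W (x @ y)) = W x * (1 - (1 - \<sigma> x) ^ T)" .
  qed
  have "real T * (real M * \<rho> * real b powr (-s) / 2) / 2 \<le> real T * E / 2"
    using E by (intro divide_right_mono mult_left_mono) auto
  also have "\<dots> = (\<Sum>x\<in>words (M + L). W x * (real T * \<sigma> x / 2))"
    unfolding E_def sum_distrib_left sum_divide_distrib by (intro sum.cong) auto
  also have "\<dots> \<le> (\<Sum>x\<in>words (M + L). W x * (1 - (1 - \<sigma> x) ^ T))"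
  proof (intro sum_mono mult_left_mono one_minus_power_ge \<sigma>0)
    fix x :: "'e list" assume x: "x \<in> words (M + L)"
    show "\<sigma> x \<le> 1" using \<sigma>_le[OF x] M b1 by (simp add: \<rho>_def)
    have "real T * \<sigma> x \<le> real T * (real M * \<rho>)" using \<sigma>_le[OF x] by (intro mult_left_mono) auto
    then show "real T * \<sigma> x \<le> 1" using T by (simp add: \<rho>_def)
  qed simp
  finally show ?thesis unfolding hit_eq by (simp add: \<rho>_def algebra_simps)
qed

end

subsection \<open>From matches to approximations\<close>

lemma prod_one_minus_le_exp:
  fixes P :: "nat \<Rightarrow> real"
  assumes "\<And>j. P j \<le> 1"
  shows "(\<Prod>i<k. 1 - P i) \<le> exp (- (\<Sum>i<k. P i))"
proof -
  have "(\<Prod>i<k. 1 - P i) \<le> (\<Prod>i<k. exp (- P i))"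
  proof (rule prod_mono)
    fix i
    show "0 \<le> 1 - P i \<and> 1 - P i \<le> exp (- P i)"
      using assms[of i] exp_ge_add_one_self[of "- P i"] by auto
  qed
  then show ?thesis by (simp add: exp_sum[symmetric] sum_negf)
qed

lemma take_drop_map_upt:
  "a + a \<le> n \<Longrightarrow> take a (drop a (map \<omega> [0..<n])) = map (\<lambda>l. \<omega> (a + l)) [0..<a]"
  by (rule nth_equalityI) auto

context rational_ifs
begin

lemma Q_map_mono: "k \<le> N \<Longrightarrow> Q (map \<eta> [0..<k]) \<le> Q (map \<eta> [0..<N])"
proof -
  assume "k \<le> N"
  then have "Q (map \<eta> [0..<N]) = Q (map \<eta> [0..<k]) * Q (map (\<lambda>i. \<eta> (k + i)) [0..<N - k])"
    using upt_add_split[of \<eta> k "N - k"] by simp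
  then show ?thesis using Q_ge1 mult_left_mono[of 1 _ "Q (map \<eta> [0..<k])"] by simp
qed

text \<open>A repetition in the coding of a point \<open>x\<close> gives a rational approximation of \<open>x\<close>: close up
  the period.\<close>

lemma repetition_approx:
  assumes nN: "n < N" and rep: "\<And>i. i < l \<Longrightarrow> \<omega> (N + i) = \<omega> (n + i)"
    and R: "0 < R" "R \<le> Q (map (\<lambda>i. \<omega> (N + i)) [0..<l])"
  obtains v w where "w \<noteq> []" "Y v w \<in> \<rat> \<inter> limit_set p q r"
    "of_int (intrinsic_denom p q r (Y v w)) = qden v w"
    "qden v w \<le> 2 * Q (map \<omega> [0..<N])"
    "\<bar>cm \<omega> - Y v w\<bar> \<le> (d - c) / (Q (map \<omega> [0..<N]) * R)"
proof -
  define m where "m = N - n"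
  define \<eta> where "\<eta> i = (if i < n then \<omega> i else \<omega> (n + (i - n) mod m))" for i
  have m: "1 \<le> m" using nN by (simp add: m_def)
  have per: "\<eta> (i + m) = \<eta> i" if "n \<le> i" for i
  proof -
    have "(i + m - n) mod m = (i - n) mod m"
      using that by (metis Nat.add_diff_assoc2 mod_add_self2)
    then show ?thesis using that by (simp add: \<eta>_def)
  qed
  \<comment> \<open>From \<open>N\<close> on both sequences copy the letter \<open>m\<close> places
    earlier: \<open>\<eta>\<close> by periodicity, \<open>\<omega>\<close> by
    \<open>rep\<close>.\<close>
  have agree: "\<eta> i = \<omega> i" if "i < N + l" for i
    using that
  proof (induction i rule: less_induct)
    case (less i)
    show ?case
    proof (cases "i < N")
      case True
      then show ?thesis by (auto simp: \<eta>_def m_def)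
    next
      case False
      define i' where "i' = i - N"
      have i: "i = N + i'" "i' < l" using False less.prems by (auto simp: i'_def)
      have "\<eta> i = \<eta> ((n + i') + m)" using nN by (simp add: i m_def add.commute)
      also have "\<dots> = \<eta> (n + i')" by (rule per) simp
      also have "\<dots> = \<omega> (n + i')" using less.IH[of "n + i'"] nN i by simp
      also have "\<dots> = \<omega> i" using rep[OF i(2)] i(1) by simp
      finally show ?thesis .
    qed
  qed
  \<comment> \<open>The minimal preperiod and period may be shorter than \<open>n\<close> and
    \<open>m\<close>; in any case \<open>v @ w\<close> is a prefix of length at most
    \<open>n + m = N\<close>, which bounds the denominator.\<close>
  obtain v w where vw: "w \<noteq> []" "cm \<eta> = Y v w" "length v \<le> n" "length w \<le> m"
    "v @ w = map \<eta> [0..<length v + length w]"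
    "of_int (intrinsic_denom p q r (cm \<eta>)) = Q v * (Q w - pw w)"
    using intrinsic_data[of m n \<eta>, OF m per] by metis
  show ?thesis
  proof (rule that[of w v])
    show "w \<noteq> []" by fact
    show "Y v w \<in> \<rat> \<inter> limit_set p q r"
      by (rule IntI[OF Y_Rats[OF vw(1)]]) (use vw(2) in \<open>metis limit_set_iff\<close>)
    show "of_int (intrinsic_denom p q r (Y v w)) = qden v w"
      using vw(2,6) by (simp add: qden_def)
    have mapN: "map \<eta> [0..<N] = map \<omega> [0..<N]" using agree by simp
    have "Q v * Q w = Q (map \<eta> [0..<length v + length w])" by (simp flip: vw(5))
    also have "\<dots> \<le> Q (map \<omega> [0..<N])"
      unfolding mapN[symmetric] using vw(3,4) nN by (intro Q_map_mono) (simp add: m_def)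
    finally show "qden v w \<le> 2 * Q (map \<omega> [0..<N])" using qden_le[OF vw(1), of v] by linarith
    have mapNl: "map \<omega> [0..<N + l] = map \<eta> [0..<N + l]" using agree by simp
    have "\<bar>cm \<omega> - Y v w\<bar> \<le> (d - c) / Q (map \<omega> [0..<N + l])"
      using cm_close[OF mapNl] vw(2) by simp
    also have "\<dots> \<le> (d - c) / (Q (map \<omega> [0..<N]) * R)"
      unfolding upt_add_split using cd R by (intro divide_left_mono) auto
    finally show "\<bar>cm \<omega> - Y v w\<bar> \<le> (d - c) / (Q (map \<omega> [0..<N]) * R)" .
  qed
qed

lemma hit_repetition:
  assumes "hit R M T L (map (\<lambda>i. \<omega> (S + i)) [0..<m])" and m: "M + L + T * L \<le> m"
    and R: "R \<le> 2 ^ L"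
  obtains n N l where "S \<le> n" "n < N" "N \<le> S + m" "\<And>i. i < l \<Longrightarrow> \<omega> (N + i) = \<omega> (n + i)"
    "R \<le> Q (map (\<lambda>i. \<omega> (N + i)) [0..<l])"
proof -
  define z where "z = map (\<lambda>i. \<omega> (S + i)) [0..<m]"
  obtain n k where nk: "n < M" "k < T"
    and eq: "cut R (drop n (take (M + L) z)) = cut R (drop (M + L + k * L) z)"
    using assms(1) by (auto simp: hit_def z_def)
  define w where "w = cut R (drop (M + L + k * L) z)"
  define l where "l = length w"
  have l: "l \<le> L" unfolding l_def w_def by (rule length_cut_le[OF R])
  have kL: "k * L + L \<le> T * L" using nk(2) mult_le_mono1[of "Suc k" T L] by simp
  have zlen: "length z = m" by (simp add: z_def)
  have w1: "w ! i = \<omega> (S + (M + L + k * L) + i)" if "i < l" for i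
  proof -
    have "w ! i = drop (M + L + k * L) z ! i"
      unfolding w_def by (rule cut_nth) (use that in \<open>simp add: l_def w_def\<close>)
    then show ?thesis using that l kL m by (simp add: z_def add.assoc)
  qed
  have w2: "w ! i = \<omega> (S + n + i)" if "i < l" for i
  proof -
    have "w ! i = drop n (take (M + L) z) ! i"
      unfolding w_def eq[symmetric] by (rule cut_nth) (use that in \<open>simp add: l_def w_def eq\<close>)
    then show ?thesis using that l kL m nk(1) by (simp add: z_def add.assoc)
  qed
  show ?thesis
  proof (rule that[of "S + n" "S + (M + L + k * L)" l])
    show "S \<le> S + n" by simp
    show "S + n < S + (M + L + k * L)" using nk(1) by simp
    show "S + (M + L + k * L) \<le> S + m" using kL m by simp
    show "\<omega> (S + (M + L + k * L) + i) = \<omega> (S + n + i)" if "i < l" for i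
      using w1[OF that] w2[OF that] by simp
    have "map (\<lambda>i. \<omega> (S + (M + L + k * L) + i)) [0..<l] = w"
      using w1 by (intro nth_equalityI) (auto simp: l_def)
    moreover have "R \<le> Q w"
      unfolding w_def
    proof (rule Q_cut_ge)
      have "R \<le> 2 ^ L" by (rule R)
      also have "\<dots> \<le> 2 ^ length (drop (M + L + k * L) z)"
        using kL m zlen by (intro power_increasing) auto
      finally show "R \<le> 2 ^ length (drop (M + L + k * L) z)" .
    qed
    ultimately show "R \<le> Q (map (\<lambda>i. \<omega> (S + (M + L + k * L) + i)) [0..<l])" by simp
  qed
qed

text \<open>Let \<open>q'\<close> be \<open>Q\<close> of the coding before the second occurrence. A
  hit yields a rational point of denominator at most \<open>2 * q'\<close> at distance at most
  \<open>(d - c) / (q' * R j)\<close>. Badness with constant \<open>e\<close> then bounds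
  \<open>e * \<psi> * R j\<close> by \<open>2 * (d - c)\<close>, which the choice of
  \<open>R j\<close> excludes. In late stages the denominator lies where \<open>\<psi>\<close> is
  monotone.\<close>

lemma bad_imp_finitely_many_hits:
  fixes R :: "nat \<Rightarrow> real" and M T L :: "nat \<Rightarrow> nat"
  assumes irr: "cm \<omega> \<notin> \<rat>" and e: "0 < e"
    and bad: "\<And>y. y \<in> \<rat> \<inter> limit_set p q r \<Longrightarrow>
        e * \<psi> (of_int (intrinsic_denom p q r y)) / of_int (intrinsic_denom p q r y) \<le> \<bar>cm \<omega> - y\<bar>"
    and pos: "\<And>t. t0 \<le> t \<Longrightarrow> 0 < \<psi> t"
    and mono: "\<And>s t. t0 \<le> s \<Longrightarrow> s \<le> t \<Longrightarrow> \<psi> t \<le> \<psi> s"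
    and R: "\<And>j. j0 \<le> j \<Longrightarrow> good j \<Longrightarrow> 1 \<le> R j \<and> R j \<le> 2 ^ L j \<and> M j + L j + T j * L j \<le> 2 ^ j \<and>
        2 * (d - c) < e * \<psi> (real b ^ 2 ^ (j + 2)) * R j"
  shows "\<exists>J\<ge>j0. \<forall>j\<ge>J. \<not> (good j \<and> hit (R j) (M j) (T j) (L j) (map (\<lambda>i. \<omega> (2 ^ j + i)) [0..<2 ^ j]))"
proof -
  obtain k0 :: nat where k0: "t0 < 2 ^ k0" using real_arch_pow[of 2 t0] by auto
  define F where "F = {(v :: 'e list, w :: 'e list). w \<noteq> [] \<and> length v + length w \<le> k0}"
  have "finite F"
  proof (rule finite_subset)
    show "F \<subseteq> (\<Union>n\<le>k0. words n) \<times> (\<Union>n\<le>k0. words n)" by (auto simp: F_def)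
  qed auto
  moreover have "0 < (case y of (v, w) \<Rightarrow> \<bar>cm \<omega> - Y v w\<bar>)" if "y \<in> F" for y
  proof -
    obtain v w where y: "y = (v, w)" by (cases y)
    with that have "w \<noteq> []" by (simp add: F_def)
    then have "cm \<omega> \<noteq> Y v w" using irr Y_Rats by metis
    then show ?thesis by (simp add: y)
  qed
  \<comment> \<open>An approximation closer than \<open>\<gamma>\<close> cannot come from one of the
    finitely many short pairs, so its denominator is at least \<open>t0\<close>.\<close>
  ultimately obtain \<gamma> where \<gamma>: "0 < \<gamma>" "\<And>y. y \<in> F \<Longrightarrow> \<gamma> \<le> (case y of (v, w) \<Rightarrow> \<bar>cm \<omega> - Y v w\<bar>)"
    using finite_positive_lower_bound[of F "\<lambda>(v, w). \<bar>cm \<omega> - Y v w\<bar>"] by blast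
  have "(\<lambda>n. (d - c) * (1/2) ^ n) \<longlonglongrightarrow> 0"
    by (intro tendsto_mult_right_zero LIMSEQ_power_zero) auto
  then have "\<forall>\<^sub>F n in sequentially. (d - c) * (1/2) ^ n < \<gamma>" using \<gamma>(1) by (rule order_tendstoD)
  then obtain N0 where N0: "\<And>n. N0 \<le> n \<Longrightarrow> (d - c) * (1/2) ^ n < \<gamma>"
    by (auto simp: eventually_sequentially)
  show ?thesis
  proof (intro exI[of _ "max j0 N0"] conjI allI impI notI)
    fix j assume j: "max j0 N0 \<le> j"
      and gh: "good j \<and> hit (R j) (M j) (T j) (L j) (map (\<lambda>i. \<omega> (2 ^ j + i)) [0..<2 ^ j])"
    then have h: "hit (R j) (M j) (T j) (L j) (map (\<lambda>i. \<omega> (2 ^ j + i)) [0..<2 ^ j])" by simp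
    have Rj: "1 \<le> R j" "R j \<le> 2 ^ L j" "M j + L j + T j * L j \<le> 2 ^ j"
      "2 * (d - c) < e * \<psi> (real b ^ 2 ^ (j + 2)) * R j" using R[of j] j gh by auto
    obtain n N l where nN: "2 ^ j \<le> n" "n < N" "N \<le> 2 ^ j + 2 ^ j"
      and rep: "\<And>i. i < l \<Longrightarrow> \<omega> (N + i) = \<omega> (n + i)"
      and RQ: "R j \<le> Q (map (\<lambda>i. \<omega> (N + i)) [0..<l])"
      using hit_repetition[OF h Rj(3,2)] by metis
    have R0: "0 < R j" using Rj(1) by simp
    obtain v w where w: "w \<noteq> []" and y: "Y v w \<in> \<rat> \<inter> limit_set p q r"
      and den: "of_int (intrinsic_denom p q r (Y v w)) = qden v w"
      and den_le: "qden v w \<le> 2 * Q (map \<omega> [0..<N])"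
      and close: "\<bar>cm \<omega> - Y v w\<bar> \<le> (d - c) / (Q (map \<omega> [0..<N]) * R j)"
      using repetition_approx[OF nN(2) rep R0 RQ] by metis
    define q' where "q' = Q (map \<omega> [0..<N])"
    have q'0: "0 < q'" by (simp add: q'_def)
    have "j < 2 ^ j" by (rule less_exp)
    then have "N0 \<le> N" using j nN by linarith
    have "(d - c) / (q' * R j) \<le> (d - c) / 2 ^ N"
    proof (rule divide_left_mono)
      have "2 ^ N * 1 \<le> q' * R j"
        using Q_ge[of "map \<omega> [0..<N]"] Rj(1) q'0 by (intro mult_mono) (auto simp: q'_def)
      then show "2 ^ N \<le> q' * R j" by simp
    qed (use cd q'0 R0 in auto)
    also have "\<dots> < \<gamma>" using N0[OF \<open>N0 \<le> N\<close>] by (simp add: power_one_over)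
    finally have "\<bar>cm \<omega> - Y v w\<bar> < \<gamma>" using close by (simp add: q'_def)
    then have "(v, w) \<notin> F" using \<gamma>(2)[of "(v, w)"] by auto
    then have len: "k0 \<le> length v + length w - 1" using w by (simp add: F_def)
    have "(2::real) ^ k0 \<le> 2 ^ (length v + length w - 1)" using len by (intro power_increasing) auto
    then have t0: "t0 \<le> qden v w" using k0 qden_ge_power[OF w, of v] by linarith
    have "qden v w \<le> 2 * real b ^ N"
      using den_le Q_le[of "map \<omega> [0..<N]"] by simp
    also have "\<dots> \<le> real b ^ Suc N" using b_ge2 by simp
    also have "\<dots> \<le> real b ^ 2 ^ (j + 2)"
    proof (rule power_increasing)
      \<comment> \<open>\<open>N\<close> is at most \<open>2 ^ (j + 1)\<close>; the exponent
        \<open>j + 2\<close> leaves room for the factor 2 of the denominator bound, absorbed as one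
        more factor \<open>b\<close>.\<close>
      have "Suc N \<le> 2 ^ j + 2 ^ j + 2 ^ j + 2 ^ j" using nN(3) \<open>j < 2 ^ j\<close> by linarith
      then show "Suc N \<le> 2 ^ (j + 2)" by (simp add: power_add)
    qed (use b_ge2 in auto)
    finally have qb: "qden v w \<le> real b ^ 2 ^ (j + 2)" .
    define \<psi>j where "\<psi>j = \<psi> (real b ^ 2 ^ (j + 2))"
    have "\<psi>j \<le> \<psi> (qden v w)" unfolding \<psi>j_def by (rule mono[OF t0 qb])
    moreover have "0 < \<psi>j" unfolding \<psi>j_def using t0 qb by (intro pos) simp
    ultimately have "e * \<psi>j / (2 * q') \<le> e * \<psi> (qden v w) / qden v w"
      using e den_le qden_pos[OF w, of v] by (intro frac_le mult_left_mono) (auto simp: q'_def)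
    also have "\<dots> \<le> (d - c) / (q' * R j)"
      using bad[OF y] close by (simp add: den q'_def)
    finally have "e * \<psi>j * R j \<le> 2 * (d - c)" using q'0 R0 by (simp add: field_simps)
    with Rj(4) show False by (simp add: \<psi>j_def)
  qed simp
qed

text \<open>Stages use disjoint sets of letters, so the weights of missing them multiply, as in the
  second Borel-Cantelli lemma.\<close>

lemma never_hit_null:
  fixes H :: "nat \<Rightarrow> 'e list \<Rightarrow> bool"
  assumes P: "\<not> summable (\<lambda>j. \<Sum>z\<in>words (2 ^ j). of_bool (H j z) * W z)"
  shows "hausdorff_outer s {cm \<omega> | \<omega>. \<forall>j\<ge>J. \<not> H j (map (\<lambda>i. \<omega> (2 ^ j + i)) [0..<2 ^ j])} = 0"
proof (rule hausdorff_outer_eq_0I)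
  fix \<epsilon> \<eta> :: real assume "0 < \<epsilon>" "0 < \<eta>"
  define P where "P j = (\<Sum>z\<in>words (2 ^ j). of_bool (H j z) * W z)" for j
  define G where "G k x \<longleftrightarrow> (\<forall>i<k. \<not> H (J + i) (take (2 ^ (J + i)) (drop (2 ^ (J + i)) x)))" for k x
  have P0: "0 \<le> P j" for j unfolding P_def by (intro sum_nonneg) simp
  have miss: "(\<Sum>z\<in>words (2 ^ j). of_bool (\<not> H j z) * W z) = 1 - P j" for j
  proof -
    have "(\<Sum>z\<in>words (2 ^ j). of_bool (\<not> H j z) * W z) + P j = (\<Sum>z\<in>words (2 ^ j). W z)"
      unfolding P_def sum.distrib[symmetric] by (intro sum.cong) auto
    then show ?thesis by (simp add: sum_W)
  qed
  have P1: "P j \<le> 1" for j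
  proof -
    have "0 \<le> (\<Sum>z\<in>words (2 ^ j). of_bool (\<not> H j z) * W z)" by (intro sum_nonneg) simp
    then show ?thesis unfolding miss by simp
  qed
  have weight: "(\<Sum>x\<in>words (2 ^ (J + k)). of_bool (G k x) * W x) = (\<Prod>i<k. 1 - P (J + i))" for k
  proof (induction k)
    case 0
    then show ?case by (simp add: G_def sum_W)
  next
    case (Suc k)
    \<comment> \<open>Passing from \<open>k\<close> to \<open>Suc k\<close> doubles the length, and
      the second half is exactly stage \<open>J + k\<close>.\<close>
    have pw2: "2 ^ (J + Suc k) = 2 ^ (J + k) + (2 ^ (J + k) :: nat)" by simp
    have "(\<Sum>x\<in>words (2 ^ (J + Suc k)). of_bool (G (Suc k) x) * W x) =
      (\<Sum>x\<in>words (2 ^ (J + k)). \<Sum>z\<in>words (2 ^ (J + k)). (of_bool (G k x) * W x) * (of_bool (\<not> H (J + k) z) * W z))"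
      unfolding pw2 sum_words_add
    proof (intro sum.cong refl)
      fix x z :: "'e list" assume x: "x \<in> words (2 ^ (J + k))" and z: "z \<in> words (2 ^ (J + k))"
      have "take (2 ^ (J + i)) (drop (2 ^ (J + i)) (x @ z)) = take (2 ^ (J + i)) (drop (2 ^ (J + i)) x)"
        if "i < k" for i
      proof -
        have "2 ^ (J + i) + 2 ^ (J + i) \<le> (2 ^ (J + k) :: nat)"
          using power_increasing[of "Suc (J + i)" "J + k" "2::nat"] that by simp
        then show ?thesis using x by simp
      qed
      moreover have "take (2 ^ (J + k)) (drop (2 ^ (J + k)) (x @ z)) = z" using x z by simp
      ultimately have G: "G (Suc k) (x @ z) \<longleftrightarrow> G k x \<and> \<not> H (J + k) z"
        unfolding G_def by (metis less_Suc_eq)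
      show "of_bool (G (Suc k) (x @ z)) * W (x @ z) = (of_bool (G k x) * W x) * (of_bool (\<not> H (J + k) z) * W z)"
        unfolding G W_append of_bool_conj by simp
    qed
    also have "\<dots> = (\<Sum>x\<in>words (2 ^ (J + k)). of_bool (G k x) * W x) * (\<Sum>z\<in>words (2 ^ (J + k)). of_bool (\<not> H (J + k) z) * W z)"
      by (rule sum_product[symmetric])
    also have "\<dots> = (\<Prod>i<Suc k. 1 - P (J + i))" by (simp only: Suc miss prod.lessThan_Suc)
    finally show ?case .
  qed
  define \<eta>' where "\<eta>' = \<eta> / (d - c) powr s"
  have \<eta>': "0 < \<eta>'" using \<open>0 < \<eta>\<close> cd by (simp add: \<eta>'_def)
  have "\<not> summable P" using P unfolding P_def[abs_def] .
  then have "\<not> summable (\<lambda>i. P (i + J))" using summable_iff_shift[of P J] by blast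
  then have "\<exists>k. - ln \<eta>' < (\<Sum>i<k. P (i + J))"
    using summableI_nonneg_bounded[of "\<lambda>i. P (i + J)" "- ln \<eta>'"] P0 by (meson not_le)
  then obtain k1 where k1: "- ln \<eta>' < (\<Sum>i<k1. P (i + J))" by blast
  have "(\<lambda>n. (d - c) * (1/2) ^ n) \<longlonglongrightarrow> 0"
    by (intro tendsto_mult_right_zero LIMSEQ_power_zero) auto
  then have "\<forall>\<^sub>F n in sequentially. (d - c) * (1/2) ^ n < \<epsilon>" using \<open>0 < \<epsilon>\<close> by (rule order_tendstoD)
  then obtain N0 where N0: "\<And>n. N0 \<le> n \<Longrightarrow> (d - c) * (1/2) ^ n < \<epsilon>"
    by (auto simp: eventually_sequentially)
  \<comment> \<open>\<open>k1\<close> makes the total weight small, \<open>N0\<close> the diameters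
    of the cylinders.\<close>
  define k where "k = max k1 N0"
  have k2: "- ln \<eta>' < (\<Sum>i<k. P (i + J))"
  proof -
    have "(\<Sum>i<k1. P (i + J)) \<le> (\<Sum>i<k. P (i + J))" using P0 by (intro sum_mono2) (auto simp: k_def)
    with k1 show ?thesis by linarith
  qed
  define V where "V = words (2 ^ (J + k)) \<inter> {x. G k x}"
  let ?A = "{cm \<omega> | \<omega>. \<forall>j\<ge>J. \<not> H j (map (\<lambda>i. \<omega> (2 ^ j + i)) [0..<2 ^ j])}"
  have "?A \<subseteq> (\<Union>w\<in>V. cyl w)"
  proof
    fix y assume "y \<in> ?A"
    then obtain \<omega> where y: "y = cm \<omega>" and \<omega>: "\<And>j. J \<le> j \<Longrightarrow> \<not> H j (map (\<lambda>i. \<omega> (2 ^ j + i)) [0..<2 ^ j])"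
      by auto
    define x where "x = map \<omega> [0..<2 ^ (J + k)]"
    have "take (2 ^ (J + i)) (drop (2 ^ (J + i)) x) = map (\<lambda>l. \<omega> (2 ^ (J + i) + l)) [0..<2 ^ (J + i)]"
      if "i < k" for i
    proof -
      have "2 ^ (J + i) + 2 ^ (J + i) \<le> (2 ^ (J + k) :: nat)"
        using power_increasing[of "Suc (J + i)" "J + k" "2::nat"] that by simp
      then show ?thesis unfolding x_def by (rule take_drop_map_upt)
    qed
    then have "G k x" using \<omega> by (simp add: G_def)
    then have "x \<in> V" by (simp add: V_def x_def)
    moreover have "y \<in> cyl x" unfolding cyl_def y x_def by auto
    ultimately show "y \<in> (\<Union>w\<in>V. cyl w)" by blast
  qed
  moreover have "(d - c) / 2 ^ 2 ^ (J + k) \<le> \<epsilon>"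
  proof -
    have "J + k < 2 ^ (J + k)" by (rule less_exp)
    moreover have "N0 \<le> k" by (simp add: k_def)
    ultimately have "N0 \<le> 2 ^ (J + k)" by linarith
    from N0[OF this] show ?thesis by (simp add: power_one_over)
  qed
  ultimately have "hausdorff_content s \<epsilon> ?A \<le> ennreal ((d - c) powr s * (\<Sum>w\<in>V. W w))"
    using s_pos by (intro hausdorff_content_cyl_le[where n = "2 ^ (J + k)"]) (auto simp: V_def)
  also have "\<dots> \<le> ennreal \<eta>"
  proof (rule ennreal_leI)
    have "(\<Sum>w\<in>V. W w) = (\<Sum>x\<in>words (2 ^ (J + k)). of_bool (G k x) * W x)"
      by (simp add: V_def)
    also have "\<dots> = (\<Prod>i<k. 1 - P (i + J))" by (simp only: weight add.commute)
    also have "\<dots> \<le> exp (- (\<Sum>i<k. P (i + J)))" by (rule prod_one_minus_le_exp) (rule P1)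
    also have "\<dots> \<le> exp (ln \<eta>')" using k2 by simp
    also have "\<dots> = \<eta>'" using \<eta>' by simp
    finally have "(d - c) powr s * (\<Sum>w\<in>V. W w) \<le> (d - c) powr s * \<eta>'" by (rule mult_left_mono) simp
    also have "\<dots> = \<eta>" using cd by (simp add: \<eta>'_def)
    finally show "(d - c) powr s * (\<Sum>w\<in>V. W w) \<le> \<eta>" .
  qed
  finally show "hausdorff_content s \<epsilon> ?A \<le> ennreal \<eta>" .
qed

end

subsection \<open>Choice of parameters\<close>

text \<open>\<open>1 / (n + 1)\<close> is at most \<open>ln ((n + 1) / n)\<close>; the factor 2 pays
  for replacing \<open>n + 1\<close> by \<open>n\<close>.\<close>

lemma sum_inverse_le_ln_diff:
  assumes "1 \<le> m" "m \<le> n"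
  shows "(\<Sum>k\<in>{m..<n}. 1 / real k) \<le> 2 * (ln (real n) - ln (real m))"
  using assms(2)
proof (induction n rule: dec_induct)
  case (step n)
  have n: "1 \<le> n" using step assms by simp
  have "1 / (real n + 1) = 1 - 1 / (1 + 1 / real n)" using n by (simp add: field_simps)
  also have "\<dots> \<le> ln (1 + 1 / real n)"
  proof -
    define y where "y = 1 + 1 / real n"
    have "0 < y" by (simp add: y_def add_pos_nonneg)
    then have "- ln y \<le> inverse y - 1" using ln_le_minus_one[of "inverse y"] by (simp add: ln_inverse)
    then show ?thesis by (simp add: y_def inverse_eq_divide)
  qed
  also have "\<dots> = ln (real (Suc n)) - ln (real n)"
  proof -
    have e: "1 + 1 / real n = real (Suc n) / real n" using n by (simp add: field_simps)
    show ?thesis unfolding e using n by (simp add: ln_div)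
  qed
  finally have "2 * (1 / (real n + 1)) \<le> 2 * (ln (real (Suc n)) - ln (real n))"
    by (rule mult_left_mono) simp
  moreover have "1 / real n \<le> 2 * (1 / (real n + 1))" using n by (simp add: field_simps)
  ultimately have "1 / real n \<le> 2 * (ln (real (Suc n)) - ln (real n))" by (rule order_trans[rotated])
  then show ?case using step by (simp add: algebra_simps)
qed simp

lemma summable_min_one:
  fixes a :: "nat \<Rightarrow> real"
  assumes "summable (\<lambda>j. min 1 (a j))"
  shows "summable a"
proof -
  have "(\<lambda>j. min 1 (a j)) \<longlonglongrightarrow> 0" using assms by (rule summable_LIMSEQ_zero)
  then have "\<forall>\<^sub>F j in sequentially. min 1 (a j) < 1" by (rule order_tendstoD) simp
  then have "\<forall>\<^sub>F j in sequentially. min 1 (a j) = a j" by eventually_elim auto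
  from summable_cong[OF this] assms show ?thesis by simp
qed

text \<open>On the block from \<open>b ^ 2 ^ J\<close> to \<open>b ^ 2 ^ (J + 1)\<close> both
  \<open>ln n\<close> and the sum of \<open>1 / n\<close> are of order \<open>2 ^ J\<close>, which
  gives \<open>4 ^ J\<close>. As \<open>\<psi>\<close> decreases below 1,
  \<open>\<psi> powr s\<close> decreases and \<open>\<bar>ln \<psi>\<bar>\<close> grows, so the
  remaining factor \<open>F\<close> is nonincreasing.\<close>

lemma summable_double_exponential_condensed:
  fixes \<psi> :: "real \<Rightarrow> real" and b :: nat
  assumes s: "0 < s" and b: "2 \<le> b" and t0: "2 \<le> t0"
    and pos: "\<And>t. t0 \<le> t \<Longrightarrow> 0 < \<psi> t"
    and mono: "\<And>s t. t0 \<le> s \<Longrightarrow> s \<le> t \<Longrightarrow> \<psi> t \<le> \<psi> s"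
    and lt1: "\<And>t. t0 \<le> t \<Longrightarrow> \<psi> t < 1"
    and sum: "summable (\<lambda>j. 4 ^ j * (\<psi> (real b ^ 2 ^ (j + 2)) powr s / \<bar>ln (\<psi> (real b ^ 2 ^ (j + 2)))\<bar>))"
  shows "summable (\<lambda>n::nat. ln (real n) * \<psi> (real n) powr s / (real n * \<bar>ln (\<psi> (real n))\<bar>))"
proof -
  define f where "f n = ln (real n) * \<psi> (real n) powr s / (real n * \<bar>ln (\<psi> (real n))\<bar>)" for n
  define F where "F t = \<psi> t powr s / \<bar>ln (\<psi> t)\<bar>" for t
  have F0: "0 \<le> F t" for t by (simp add: F_def)
  have Fmono: "F t \<le> F t'" if "t0 \<le> t'" "t' \<le> t" for t t'
  proof -
    have p: "0 < \<psi> t" "\<psi> t \<le> \<psi> t'" "\<psi> t' < 1" using pos[of t] mono[OF that] lt1[OF that(1)] that by auto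
    then have "ln (\<psi> t) \<le> ln (\<psi> t')" "ln (\<psi> t') < 0" by auto
    then show ?thesis unfolding F_def using p s by (intro frac_le powr_mono2) auto
  qed
  obtain j2' :: nat where j2': "t0 < 2 ^ j2'" using real_arch_pow[of 2 t0] by auto
  \<comment> \<open>The shift by 2 matches the exponent \<open>j + 2\<close> in the hypothesis and
    produces the 16 in the constant \<open>64 = 4 * 16\<close> below.\<close>
  define j2 where "j2 = j2' + 2"
  define B where "B j = b ^ 2 ^ (j + j2)" for j :: nat
  have big: "t0 \<le> real (B j)" for j
  proof -
    have "j2' \<le> 2 ^ (j + j2)" using less_exp[of "j + j2"] by (simp add: j2_def)
    then have "(2::real) ^ j2' \<le> 2 ^ 2 ^ (j + j2)" by (intro power_increasing) auto
    also have "\<dots> \<le> real b ^ 2 ^ (j + j2)" using b by (intro power_mono) auto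
    finally show ?thesis using j2' by (simp add: B_def)
  qed
  have "strict_mono B"
    unfolding B_def using b by (intro strict_monoI power_strict_increasing) auto
  then show ?thesis
    unfolding f_def[symmetric]
  proof (rule summable_from_blocks)
    fix n assume "B 0 \<le> n"
    then have "t0 \<le> real n" using big[of 0] by linarith
    then show "0 \<le> f n" using t0 by (simp add: f_def)
  next
    define a where "a j = 4 ^ j * (\<psi> (real b ^ 2 ^ (j + 2)) powr s / \<bar>ln (\<psi> (real b ^ 2 ^ (j + 2)))\<bar>)" for j
    have "summable (\<lambda>j. 64 * (ln (real b))\<^sup>2 * a (j + j2'))"
    proof (rule summable_mult)
      have "summable a" using sum unfolding a_def[abs_def] .
      then show "summable (\<lambda>j. a (j + j2'))" using summable_iff_shift[of a j2'] by blast
    qed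
    then show "summable (\<lambda>k. \<Sum>n\<in>{B k..<B (Suc k)}. f n)"
    proof (rule summable_comparison_test'[where N = 0])
      fix k
      define J where "J = k + j2"
      define lb where "lb = ln (real b)"
      have lb: "0 \<le> lb" using b by (simp add: lb_def)
      have lnB: "ln (real (B k)) = 2 ^ J * lb" "ln (real (B (Suc k))) = 2 * 2 ^ J * lb"
        using b by (simp_all add: B_def ln_realpow J_def lb_def)
      have B1: "1 \<le> B k" "B k \<le> B (Suc k)" using b by (auto simp: B_def intro!: power_increasing)
      have le: "f n \<le> (2 * 2 ^ J * lb * F (real (B k))) * (1 / real n)" if "n \<in> {B k..<B (Suc k)}" for n
      proof -
        have n: "real (B k) \<le> real n" "real n \<le> real (B (Suc k))" using that by auto
        have n0: "t0 \<le> real n" using n big[of k] by linarith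
        have "ln (real n) \<le> ln (real (B (Suc k)))" using n n0 t0 by (subst ln_le_cancel_iff) auto
        then have l: "ln (real n) \<le> 2 * 2 ^ J * lb" by (simp add: lnB)
        have "f n = ln (real n) * F (real n) * (1 / real n)" by (simp add: f_def F_def)
        also have "\<dots> \<le> (2 * 2 ^ J * lb) * F (real (B k)) * (1 / real n)"
          using l Fmono[OF big n(1)] F0 n0 t0 lb by (intro mult_right_mono mult_mono) auto
        finally show ?thesis .
      qed
      have nn: "0 \<le> f n" if "n \<in> {B k..<B (Suc k)}" for n
      proof -
        have "t0 \<le> real n" using big[of k] that by auto
        then show ?thesis using t0 by (simp add: f_def)
      qed
      have "(\<Sum>n\<in>{B k..<B (Suc k)}. f n) \<le> (\<Sum>n\<in>{B k..<B (Suc k)}. (2 * 2 ^ J * lb * F (real (B k))) * (1 / real n))"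
        by (rule sum_mono) (rule le)
      also have "\<dots> = (2 * 2 ^ J * lb * F (real (B k))) * (\<Sum>n\<in>{B k..<B (Suc k)}. 1 / real n)"
        by (simp only: sum_distrib_left)
      also have "\<dots> \<le> (2 * 2 ^ J * lb * F (real (B k))) * (2 * (2 ^ J * lb))"
        using sum_inverse_le_ln_diff[OF B1] lb F0 by (intro mult_left_mono) (auto simp: lnB mult.commute)
      also have "\<dots> = 4 * lb\<^sup>2 * (2 ^ J * 2 ^ J) * F (real (B k))"
        by (simp add: power2_eq_square)
      also have "(2::real) ^ J * 2 ^ J = 16 * 4 ^ (k + j2')"
      proof -
        have "(2::real) ^ J * 2 ^ J = 4 ^ J" by (simp flip: power_mult_distrib)
        also have "\<dots> = 16 * 4 ^ (k + j2')" by (simp add: J_def j2_def power_add)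
        finally show ?thesis .
      qed
      also have "4 * lb\<^sup>2 * (16 * 4 ^ (k + j2')) * F (real (B k)) = 64 * lb\<^sup>2 * a (k + j2')"
        by (simp add: a_def F_def B_def j2_def add.assoc)
      finally have "(\<Sum>n\<in>{B k..<B (Suc k)}. f n) \<le> 64 * (ln (real b))\<^sup>2 * a (k + j2')"
        by (simp add: lb_def)
      then show "norm (\<Sum>n\<in>{B k..<B (Suc k)}. f n) \<le> 64 * (ln (real b))\<^sup>2 * a (k + j2')"
        using sum_nonneg[of "{B k..<B (Suc k)}" f] nn by simp
    qed
  qed
qed

lemma nat_div_ge_half:
  assumes "0 < L" "L \<le> (n::nat)" shows "real n / (2 * real L) \<le> real (n div L)"
proof -
  have "1 \<le> n div L" using assms by (simp add: Suc_leI div_greater_zero_iff)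
  moreover have "real n / real L \<le> real (n div L) + 1"
  proof -
    have "n < L + (n div L) * L" using assms(1) by (rule dividend_less_div_times)
    then have "real n < real (L + (n div L) * L)" by (rule of_nat_less_iff[THEN iffD2])
    then show ?thesis using assms(1) by (simp add: field_simps)
  qed
  ultimately show ?thesis by simp
qed

text \<open>Parameters of the stages of the divergence argument. The second term in \<open>R j\<close> is what makes
  the expected number of matches at most one, and \<open>L j\<close> bounds the lengths of the matched words.\<close>

lemma divergence_parameters:
  fixes \<psi> :: "real \<Rightarrow> real" and b :: nat
  assumes s: "0 < s" and b: "2 \<le> b" and t0: "2 \<le> t0" and C: "1 \<le> C"
    and pos: "\<And>t. t0 \<le> t \<Longrightarrow> 0 < \<psi> t"
    and mono: "\<And>s t. t0 \<le> s \<Longrightarrow> s \<le> t \<Longrightarrow> \<psi> t \<le> \<psi> s"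
    and lt1: "\<And>t. t0 \<le> t \<Longrightarrow> \<psi> t < 1"
    and div: "\<not> summable (\<lambda>n::nat. ln (real n) * \<psi> (real n) powr s / (real n * \<bar>ln (\<psi> (real n))\<bar>))"
  obtains R :: "nat \<Rightarrow> real" and M T L :: "nat \<Rightarrow> nat" and good j0 where
    "\<forall>j\<ge>j0. good j \<longrightarrow> 1 \<le> R j \<and> R j \<le> 2 ^ L j \<and> M j + L j + T j * L j \<le> 2 ^ j \<and>
       C \<le> \<psi> (real b ^ 2 ^ (j + 2)) * R j \<and> real (M j) * R j powr (-s) \<le> real b powr (-s) \<and>
       real (T j) * (real (M j) * R j powr (-s)) \<le> 1"
    "\<not> summable (\<lambda>j. if good j then real (T j) * (real (M j) * R j powr (-s)) else 0)"
proof -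
  define \<psi>j where "\<psi>j j = \<psi> (real b ^ 2 ^ (j + 2))" for j :: nat
  \<comment> \<open>Chosen so that \<open>X j powr (-s) = j / 4 ^ j\<close>: with about
    \<open>2 ^ j\<close> positions, \<open>2 ^ j / L j\<close> blocks and
    \<open>j \<le> L j\<close>, the expected number of matches is then at most 1.\<close>
  define X where "X j = (4 ^ j / real j) powr (1 / s)" for j :: nat
  define R where "R j = max (C / \<psi>j j) (X j)" for j
  \<comment> \<open>In a good stage the starting positions, one word of length \<open>L j\<close>
    and the blocks together each take at most a quarter of the stage.\<close>
  define M where "M j = (2::nat) ^ (j - 2)" for j :: nat
  define L where "L j = nat \<lceil>log 2 (R j)\<rceil> + j" for j
  define T where "T j = 2 ^ (j - 2) div L j" for j
  \<comment> \<open>A stage in which the words are too long is skipped; \<open>key\<close> shows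
    that it costs only a summable error.\<close>
  define good where "good j \<longleftrightarrow> L j \<le> 2 ^ (j - 2)" for j
  define a where "a j = 4 ^ j * (\<psi>j j powr s / \<bar>ln (\<psi>j j)\<bar>)" for j
  define D where "D j = (if good j then real (T j) * (real (M j) * R j powr (-s)) else 0)" for j
  have a_div: "\<not> summable a"
    using summable_double_exponential_condensed[of s b t0 \<psi>, OF s b t0 pos mono lt1] div
    unfolding a_def[abs_def] \<psi>j_def[abs_def] by blast
  obtain j1 :: nat where j1: "t0 < 2 ^ j1" using real_arch_pow[of 2 t0] by auto
  define l0 where "l0 = - ln (\<psi> t0)"
  have l0: "0 < l0" using pos[of t0] lt1[of t0] by (simp add: l0_def)
  \<comment> \<open>Write \<open>l = - ln (\<psi>j j)\<close>. If the first term of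
    \<open>R j\<close> dominates, then \<open>ln (R j) \<le> K1 * l\<close> and
    \<open>L j \<le> K2 * l\<close>; if the second does, then
    \<open>L j \<le> K3 * j\<close>.\<close>
  define K1 where "K1 = 1 + ln C / l0"
  define K2 where "K2 = K1 / ln 2 + 1 / l0 + s * K1 / ln 2"
  define K3 where "K3 = 2 / s + 2"
  have K1: "1 \<le> K1" using C l0 by (simp add: K1_def)
  have K2: "0 < K2" using K1 l0 s by (simp add: K2_def add_pos_pos)
  have K3: "0 < K3" using s by (simp add: K3_def add_pos_pos)
  \<comment> \<open>In a skipped stage \<open>2 ^ j / 4 < K2 * l\<close>, hence
    \<open>\<psi>j j powr s = exp (- s * l)\<close> is at most
    \<open>exp (- \<kappa> * 2 ^ j)\<close>.\<close>
  define \<kappa> where "\<kappa> = s / (4 * K2)"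
  have \<kappa>: "0 < \<kappa>" using s K2 by (simp add: \<kappa>_def)
  have "(\<lambda>j::nat. real j / 2 ^ j) \<longlonglongrightarrow> 0" by real_asymp
  then have E1: "\<forall>\<^sub>F j in sequentially. real j / 2 ^ j < real b powr (-s)"
    by (rule order_tendstoD) (use b in simp)
  have "(\<lambda>j::nat. K3 * 4 * (real j / 2 ^ j)) \<longlonglongrightarrow> 0" by real_asymp
  then have E2: "\<forall>\<^sub>F j in sequentially. K3 * 4 * (real j / 2 ^ j) < 1"
    by (rule order_tendstoD) simp
  \<comment> \<open>\<open>8 ^ j\<close> is the \<open>4 ^ j\<close> of \<open>a j\<close> times the
    \<open>2 ^ j\<close> that leaves the error \<open>(1/2) ^ j\<close>.\<close>
  have "(\<lambda>j::nat. 8 ^ j * exp (- \<kappa> * 2 ^ j)) \<longlonglongrightarrow> 0" using \<kappa> by real_asymp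
  then have E3: "\<forall>\<^sub>F j in sequentially. 8 ^ j * exp (- \<kappa> * 2 ^ j) < l0"
    using l0 by (rule order_tendstoD)
  from eventually_conj[OF E1 eventually_conj[OF E2 E3]]
  obtain j2 where j2: "\<And>j. j2 \<le> j \<Longrightarrow> real j / 2 ^ j < real b powr (-s) \<and>
      K3 * 4 * (real j / 2 ^ j) < 1 \<and> 8 ^ j * exp (- \<kappa> * 2 ^ j) < l0"
    by (auto simp: eventually_sequentially)
  define j0 where "j0 = max 3 (max j1 j2)"
  have \<psi>j: "0 < \<psi>j j" "\<psi>j j < 1" "l0 \<le> - ln (\<psi>j j)" if "j0 \<le> j" for j
  proof -
    have "j1 \<le> 2 ^ (j + 2)" using less_exp[of "j + 2"] that by (simp add: j0_def)
    then have "(2::real) ^ j1 \<le> 2 ^ 2 ^ (j + 2)" by (intro power_increasing) auto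
    also have "\<dots> \<le> real b ^ 2 ^ (j + 2)" using b by (intro power_mono) auto
    finally have big: "t0 \<le> real b ^ 2 ^ (j + 2)" using j1 by linarith
    show "0 < \<psi>j j" "\<psi>j j < 1" unfolding \<psi>j_def by (rule pos[OF big], rule lt1[OF big])
    have "\<psi>j j \<le> \<psi> t0" unfolding \<psi>j_def using mono[OF order_refl big] .
    then show "l0 \<le> - ln (\<psi>j j)" using \<open>0 < \<psi>j j\<close> by (simp add: l0_def)
  qed
  have X_s: "X j powr (-s) = real j / 4 ^ j" if "j0 \<le> j" for j
  proof -
    have "0 < 4 ^ j / real j" using that by (simp add: j0_def)
    then show ?thesis using s by (simp add: X_def powr_powr powr_minus_divide)
  qed
  have jle: "2 ^ j \<le> 4 ^ j / real j" "4 ^ j / real j \<le> 4 ^ j" if "j0 \<le> j" for j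
  proof -
    have j: "0 < real j" "1 \<le> real j" using that by (simp_all add: j0_def)
    have "real j \<le> 2 ^ j" using of_nat_less_iff[where 'a=real, THEN iffD2, OF less_exp[of j]] by simp
    then have "real j * 2 ^ j \<le> 2 ^ j * 2 ^ j" by (intro mult_right_mono) auto
    also have "(2::real) ^ j * 2 ^ j = 4 ^ j" by (simp flip: power_mult_distrib)
    finally show "2 ^ j \<le> 4 ^ j / real j" using j by (simp add: field_simps)
    show "4 ^ j / real j \<le> 4 ^ j" using j by (simp add: field_simps)
  qed
  have lnX: "real j * ln 2 \<le> s * ln (X j)" "s * ln (X j) \<le> 2 * real j * ln 2" "1 \<le> X j" if "j0 \<le> j" for j
  proof -
    have p: "0 < 4 ^ j / real j" using that by (simp add: j0_def)
    have eq: "s * ln (X j) = ln (4 ^ j / real j)" using s p by (simp add: X_def ln_powr)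
    have "ln (2 ^ j) \<le> ln (4 ^ j / real j)" using jle(1)[OF that] p by (subst ln_le_cancel_iff) auto
    then show "real j * ln 2 \<le> s * ln (X j)" by (simp add: eq ln_realpow)
    have "ln (4 ^ j / real j) \<le> ln (4 ^ j)" using jle(2)[OF that] p by (subst ln_le_cancel_iff) auto
    also have "ln (4 ^ j :: real) = real j * ln (2 ^ 2)" by (simp add: ln_realpow)
    also have "\<dots> = 2 * real j * ln 2" by (simp only: ln_realpow)
    finally show "s * ln (X j) \<le> 2 * real j * ln 2" by (simp add: eq)
    have "1 \<le> 4 ^ j / real j" using jle(1)[OF that] one_le_power[of "2::real" j] by linarith
    then show "1 \<le> X j" unfolding X_def using s by (intro ge_one_powr_ge_zero) auto
  qed
  have R1: "1 \<le> R j" if "j0 \<le> j" for j using lnX(3)[OF that] by (simp add: R_def)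
  have R_s: "R j powr (-s) \<le> real j / 4 ^ j" if "j0 \<le> j" for j
    unfolding X_s[OF that, symmetric] using s lnX(3)[OF that] by (intro powr_mono2') (auto simp: R_def)
  have L_le: "real (L j) \<le> ln (R j) / ln 2 + 1 + real j" if "j0 \<le> j" for j
  proof -
    have "0 \<le> log 2 (R j)" using R1[OF that] by simp
    then have "real (nat \<lceil>log 2 (R j)\<rceil>) \<le> log 2 (R j) + 1" by linarith
    then show ?thesis by (simp add: L_def log_def)
  qed
  have R_le: "R j \<le> 2 ^ L j" if "j0 \<le> j" for j
  proof -
    have "R j = 2 powr log 2 (R j)" using R1[OF that] by simp
    also have "\<dots> \<le> 2 powr real (L j)"
      by (rule powr_mono) (auto simp: L_def, linarith)
    finally show ?thesis by (simp add: powr_realpow)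
  qed
  have jL: "real j \<le> real (L j)" "0 < L j" if "j0 \<le> j" for j using that by (auto simp: L_def j0_def)
  have Mj: "real (2 ^ (j - 2)) = 2 ^ j / 4" if "j0 \<le> j" for j
    using power_diff[of "2::real" 2 j] that by (simp add: j0_def)
  have T_le: "real (T j) \<le> (2 ^ j / 4) / real (L j)" if "j0 \<le> j" for j
    unfolding T_def Mj[OF that, symmetric] by (rule of_nat_div_le_of_nat)
  have four: "(2::real) ^ j * 2 ^ j = 4 ^ j" for j :: nat by (simp flip: power_mult_distrib)
  have conds: "1 \<le> R j \<and> R j \<le> 2 ^ L j \<and> M j + L j + T j * L j \<le> 2 ^ j \<and>
       C \<le> \<psi> (real b ^ 2 ^ (j + 2)) * R j \<and> real (M j) * R j powr (-s) \<le> real b powr (-s) \<and>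
       real (T j) * (real (M j) * R j powr (-s)) \<le> 1" if j: "j0 \<le> j" and g: "good j" for j
  proof (intro conjI)
    show "1 \<le> R j" "R j \<le> 2 ^ L j" by (rule R1[OF j], rule R_le[OF j])
    have "T j * L j \<le> 2 ^ (j - 2)" by (simp add: T_def)
    moreover have "2 ^ j = 4 * (2::nat) ^ (j - 2)"
    proof -
      obtain i where "j = 2 + i" using le_Suc_ex[of 2 j] j by (auto simp: j0_def)
      then show ?thesis by (simp add: power_add)
    qed
    ultimately show "M j + L j + T j * L j \<le> 2 ^ j" using g by (simp add: good_def M_def)
    have "C / \<psi>j j \<le> R j" by (simp add: R_def)
    then show "C \<le> \<psi> (real b ^ 2 ^ (j + 2)) * R j"
      unfolding \<psi>j_def[symmetric] using \<psi>j(1)[OF j] by (simp add: field_simps)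
    have MR: "real (M j) * R j powr (-s) \<le> (2 ^ j / 4) * (real j / 4 ^ j)"
      unfolding M_def Mj[OF j] using R_s[OF j] by (intro mult_left_mono) auto
    also have "\<dots> = (real j / 2 ^ j) / 4" by (simp add: four[symmetric])
    also have "\<dots> \<le> real j / 2 ^ j"
    proof -
      have quarter: "x / 4 \<le> x" if "0 \<le> x" for x :: real using that by simp
      show ?thesis by (rule quarter) (rule divide_nonneg_nonneg, auto)
    qed
    also have "\<dots> \<le> real b powr (-s)" using j2[of j] j by (simp add: j0_def)
    finally show "real (M j) * R j powr (-s) \<le> real b powr (-s)" .
    have "real (T j) * (real (M j) * R j powr (-s)) \<le> ((2 ^ j / 4) / real (L j)) * ((2 ^ j / 4) * (real j / 4 ^ j))"
      by (rule mult_mono[OF T_le[OF j] MR]) auto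
    also have "\<dots> = real j / real (L j) / 16" by (simp add: four[symmetric])
    also have "\<dots> \<le> 1" using jL[OF j] by (simp add: divide_le_eq)
    finally show "real (T j) * (real (M j) * R j powr (-s)) \<le> 1" .
  qed
  define K where "K = 32 * (C powr s * K2) + 32 * K3"
  have D0: "0 \<le> D j" for j by (simp add: D_def)
  have D_ge: "4 ^ j * R j powr (-s) / (32 * real (L j)) \<le> D j" if j: "j0 \<le> j" and g: "good j" for j
  proof -
    have "real (2 ^ (j - 2)) / (2 * real (L j)) \<le> real (T j)"
      unfolding T_def using jL(2)[OF j] g by (intro nat_div_ge_half) (auto simp: good_def)
    then have "(2 ^ j / 4) / (2 * real (L j)) * ((2 ^ j / 4) * R j powr (-s)) \<le> real (T j) * ((2 ^ j / 4) * R j powr (-s))"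
      unfolding Mj[OF j] by (intro mult_right_mono) auto
    moreover have "(2 ^ j / 4) / (2 * real (L j)) * ((2 ^ j / 4) * R j powr (-s)) = 4 ^ j * R j powr (-s) / (32 * real (L j))"
      by (simp add: four[symmetric])
    moreover have "D j = real (T j) * ((2 ^ j / 4) * R j powr (-s))"
      using g by (simp only: D_def M_def Mj[OF j] if_True)
    ultimately show ?thesis by (simp only:)
  qed
  \<comment> \<open>If the first term of \<open>R j\<close> dominates, \<open>K * D j\<close>
    exceeds \<open>a j\<close> in a good stage, and \<open>a j\<close> is below
    \<open>(1/2) ^ j\<close> in a skipped one. If the second dominates, the stage is good and
    \<open>K * D j\<close> is at least 1, whence the minimum.\<close>
  have key: "min 1 (a j) \<le> K * D j + (1/2) ^ j" if j: "j0 \<le> j" for j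
  proof -
    define l where "l = - ln (\<psi>j j)"
    have l: "l0 \<le> l" "0 < l" using \<psi>j(3)[OF j] l0 by (auto simp: l_def)
    have a_eq: "a j = 4 ^ j * \<psi>j j powr s / l" using l by (simp add: a_def l_def)
    show ?thesis
    proof (cases "X j \<le> C / \<psi>j j")
      case True
      then have R: "R j = C / \<psi>j j" by (simp add: R_def)
      have "ln (R j) = ln C + l" using C \<psi>j[OF j] by (simp add: R ln_div l_def)
      also have "\<dots> \<le> K1 * l"
      proof -
        have "ln C / l0 * l0 \<le> ln C / l0 * l" using l C l0 by (intro mult_left_mono) auto
        then show ?thesis using l0 by (simp add: K1_def algebra_simps)
      qed
      finally have lnR: "ln (R j) \<le> K1 * l" .
      have "real j * ln 2 \<le> s * ln (R j)"
      proof -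
        have "ln (X j) \<le> ln (R j)" using lnX(3)[OF j] True by (subst ln_le_cancel_iff) (auto simp: R)
        then have "s * ln (X j) \<le> s * ln (R j)" using s by (intro mult_left_mono) auto
        with lnX(1)[OF j] show ?thesis by linarith
      qed
      also have "\<dots> \<le> s * (K1 * l)" using lnR s by (intro mult_left_mono) auto
      finally have jl: "real j \<le> s * K1 / ln 2 * l" by (simp add: field_simps)
      have "real (L j) \<le> ln (R j) / ln 2 + 1 + real j" by (rule L_le[OF j])
      also have "\<dots> \<le> K1 * l / ln 2 + l / l0 + s * K1 / ln 2 * l"
        using lnR jl l l0 by (intro add_mono divide_right_mono) auto
      also have "\<dots> = K2 * l" by (simp add: K2_def algebra_simps)
      finally have LK: "real (L j) \<le> K2 * l" .
      show ?thesis
      proof (cases "good j")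
        case g: True
        have Rs: "R j powr (-s) = \<psi>j j powr s / C powr s"
          using C \<psi>j[OF j] by (simp add: R powr_divide powr_minus_divide)
        have "a j = (32 * (C powr s * K2)) * (4 ^ j * R j powr (-s) / (32 * (K2 * l)))"
          using K2 l C by (simp add: a_eq Rs)
        also have "\<dots> \<le> (32 * (C powr s * K2)) * (4 ^ j * R j powr (-s) / (32 * real (L j)))"
          using LK K2 jL[OF j] l by (intro mult_left_mono divide_left_mono) auto
        also have "\<dots> \<le> (32 * (C powr s * K2)) * D j"
          using D_ge[OF j g] K2 by (intro mult_left_mono) auto
        also have "\<dots> \<le> K * D j" unfolding K_def using D0[of j] K3 by (intro mult_right_mono) auto
        finally have "a j \<le> K * D j" .
        then show ?thesis by (simp add: min_def add_increasing2)
      next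
        case False
        then have "real (2 ^ (j - 2)) < real (L j)" unfolding good_def by linarith
        then have "2 ^ j / 4 < K2 * l" using LK Mj[OF j] by linarith
        then have "\<kappa> * 2 ^ j \<le> s * l" using K2 s by (simp add: \<kappa>_def field_simps)
        then have "\<psi>j j powr s \<le> exp (- \<kappa> * 2 ^ j)" using \<psi>j[OF j] by (simp add: powr_def l_def)
        then have "a j \<le> 4 ^ j * exp (- \<kappa> * 2 ^ j) / l0"
          unfolding a_eq using l l0 by (intro frac_le mult_left_mono) auto
        also have "\<dots> = (8 ^ j * exp (- \<kappa> * 2 ^ j)) / l0 * (1/2) ^ j"
        proof -
          have "(8::real) ^ j * (1/2) ^ j = 4 ^ j" by (simp flip: power_mult_distrib)
          then show ?thesis by (simp add: mult.commute mult.left_commute)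
        qed
        also have "\<dots> \<le> 1 * (1/2) ^ j"
          using j2[of j] j l0 by (intro mult_right_mono) (auto simp: j0_def divide_le_eq)
        finally have "a j \<le> (1/2) ^ j" by simp
        moreover have "0 \<le> K * D j" using D0[of j] K2 K3 by (simp add: K_def)
        ultimately show ?thesis by linarith
      qed
    next
      case False
      then have R: "R j = X j" by (simp add: R_def)
      have "real (L j) \<le> ln (R j) / ln 2 + 1 + real j" by (rule L_le[OF j])
      also have "ln (R j) / ln 2 \<le> 2 / s * real j"
        using lnX(2)[OF j] s by (simp add: R field_simps)
      also have "2 / s * real j + 1 + real j \<le> K3 * real j"
        using j by (simp add: K3_def j0_def algebra_simps)
      finally have LK: "real (L j) \<le> K3 * real j" by simp
      have "K3 * real j < 2 ^ j / 4" using j2[of j] j by (simp add: j0_def field_simps)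
      then have "real (L j) \<le> real (2 ^ (j - 2))" using LK Mj[OF j] by linarith
      then have g: "good j" unfolding good_def by linarith
      have j': "0 < real j" using j by (simp add: j0_def)
      have "1 = (32 * K3) * (4 ^ j * R j powr (-s) / (32 * (K3 * real j)))"
        using K3 j' by (simp add: R X_s[OF j])
      also have "\<dots> \<le> (32 * K3) * (4 ^ j * R j powr (-s) / (32 * real (L j)))"
        using LK K3 jL[OF j] j' by (intro mult_left_mono divide_left_mono) auto
      also have "\<dots> \<le> (32 * K3) * D j" using D_ge[OF j g] K3 by (intro mult_left_mono) auto
      also have "\<dots> \<le> K * D j" unfolding K_def using D0[of j] K2 by (intro mult_right_mono) auto
      finally have "1 \<le> K * D j" .
      then show ?thesis by (simp add: min_def add_increasing2)
    qed
  qed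
  have "\<not> summable D"
  proof
    assume "summable D"
    then have "summable (\<lambda>j. K * D j + (1/2) ^ j)"
      by (intro summable_add summable_mult summable_geometric) auto
    then have "summable (\<lambda>j. min 1 (a j))"
    proof (rule summable_comparison_test'[where N = j0])
      fix j assume "j0 \<le> j"
      moreover have "0 \<le> a j" by (simp add: a_def)
      ultimately show "norm (min 1 (a j)) \<le> K * D j + (1/2) ^ j" using key[of j] by simp
    qed
    then show False using a_div summable_min_one by blast
  qed
  then show ?thesis using that[of j0 good R L M T] conds unfolding D_def[abs_def] by blast
qed

subsection \<open>The divergence case\<close>

context rational_ifs
begin

lemma hit_append:
  assumes R: "R \<le> 2 ^ L" and x: "length x = M + L + T * L"
  shows "hit R M T L (x @ y) \<longleftrightarrow> hit R M T L x"
proof -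
  have "cut R (drop (M + L + k * L) (x @ y)) = cut R (drop (M + L + k * L) x)" if "k < T" for k
  proof -
    have "k * L + L \<le> T * L" using that mult_le_mono1[of "Suc k" T L] by simp
    then have "M + L + k * L + L \<le> length x" using x by linarith
    then have len: "L \<le> length (drop (M + L + k * L) x)" "M + L + k * L \<le> length x" by simp_all
    have "R \<le> 2 ^ length (drop (M + L + k * L) x)"
      by (rule order_trans[OF R], rule power_increasing[OF len(1)]) simp
    then show ?thesis using len(2) cut_append[of R "drop (M + L + k * L) x" y] by simp
  qed
  moreover have "take (M + L) (x @ y) = take (M + L) x" using x by simp
  ultimately show ?thesis unfolding hit_def by (metis (no_types, lifting))
qed

text \<open>Pads the letters read by \<open>hit\<close> to the full length of a stage; the weights
  of the remaining letters sum to 1.\<close>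

lemma sum_W_hit_extend:
  assumes R: "R \<le> 2 ^ L" and m: "M + L + T * L \<le> m"
  shows "(\<Sum>z\<in>words m. of_bool (hit R M T L z) * W z)
    = (\<Sum>z\<in>words (M + L + T * L). of_bool (hit R M T L z) * W z)"
proof -
  let ?n = "M + L + T * L"
  have "(\<Sum>z\<in>words m. of_bool (hit R M T L z) * W z)
      = (\<Sum>z\<in>words (?n + (m - ?n)). of_bool (hit R M T L z) * W z)" using m by simp
  also have "\<dots> = (\<Sum>x\<in>words ?n. \<Sum>y\<in>words (m - ?n). of_bool (hit R M T L x) * W x * W y)"
    unfolding sum_words_add[of _ ?n]
  proof (intro sum.cong refl)
    fix x y :: "'e list" assume "x \<in> words ?n"
    then have "hit R M T L (x @ y) = hit R M T L x" by (intro hit_append[OF R]) simp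
    then show "of_bool (hit R M T L (x @ y)) * W (x @ y) = of_bool (hit R M T L x) * W x * W y"
      by (simp only: W_append mult.assoc)
  qed
  also have "\<dots> = (\<Sum>x\<in>words ?n. of_bool (hit R M T L x) * W x)"
    by (simp only: sum_distrib_left[symmetric] sum_W mult_1_right)
  finally show ?thesis .
qed

text \<open>The constant \<open>e\<close> is fixed because the thresholds \<open>R j\<close> depend
  on it through \<open>C\<close>; \<open>divergence_case\<close> takes a union over
  \<open>e = 1 / (i + 1)\<close>.\<close>

lemma bad_with_constant_null:
  assumes e: "0 < e" and t0: "2 \<le> t0"
    and pos: "\<And>t. t0 \<le> t \<Longrightarrow> 0 < \<psi> t"
    and mono: "\<And>s t. t0 \<le> s \<Longrightarrow> s \<le> t \<Longrightarrow> \<psi> t \<le> \<psi> s"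
    and lt1: "\<And>t. t0 \<le> t \<Longrightarrow> \<psi> t < 1"
    and div: "\<not> summable (\<lambda>n::nat. ln (real n) * \<psi> (real n) powr s / (real n * \<bar>ln (\<psi> (real n))\<bar>))"
  shows "\<exists>N. hausdorff_outer s N = 0 \<and> (\<forall>\<omega>. cm \<omega> \<notin> \<rat> \<longrightarrow>
      (\<forall>y \<in> \<rat> \<inter> limit_set p q r.
        e * \<psi> (of_int (intrinsic_denom p q r y)) / of_int (intrinsic_denom p q r y) \<le> \<bar>cm \<omega> - y\<bar>)
      \<longrightarrow> cm \<omega> \<in> N)"
proof -
  \<comment> \<open>The summand 1 makes the inequality for \<open>bad_imp_finitely_many_hits\<close>
    strict; the maximum keeps \<open>ln C\<close> nonnegative for
    \<open>divergence_parameters\<close>.\<close>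
  define C where "C = max 1 (2 * (d - c) / e + 1)"
  have "1 \<le> C" by (simp add: C_def)
  have C: "2 * (d - c) < e * C"
  proof -
    have "2 * (d - c) / e < C" by (simp add: C_def)
    then show ?thesis using e by (simp add: divide_less_eq mult.commute)
  qed
  obtain R :: "nat \<Rightarrow> real" and M T L :: "nat \<Rightarrow> nat" and good j0 where
    par': "\<forall>j\<ge>j0. good j \<longrightarrow> 1 \<le> R j \<and> R j \<le> 2 ^ L j \<and> M j + L j + T j * L j \<le> 2 ^ j \<and>
       C \<le> \<psi> (real b ^ 2 ^ (j + 2)) * R j \<and> real (M j) * R j powr (-s) \<le> real b powr (-s) \<and>
       real (T j) * (real (M j) * R j powr (-s)) \<le> 1"
    and D: "\<not> summable (\<lambda>j. if good j then real (T j) * (real (M j) * R j powr (-s)) else 0)"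
    by (rule divergence_parameters[of s b t0 C \<psi>, OF s_pos b_ge2 t0 \<open>1 \<le> C\<close> pos mono lt1 div])
      (assumption | rule that)+
  note par = par'[rule_format]
  define H where "H j z \<longleftrightarrow> good j \<and> hit (R j) (M j) (T j) (L j) z" for j z
  define P where "P j = (\<Sum>z\<in>words (2 ^ j). of_bool (H j z) * W z)" for j
  have P0: "0 \<le> P j" for j unfolding P_def by (intro sum_nonneg) simp
  define \<beta> where "\<beta> = real b powr (-s)"
  have \<beta>: "0 < \<beta>" using b_ge2 by (simp add: \<beta>_def)
  have "\<not> summable P"
  proof
    assume "summable P"
    then have "summable (\<lambda>j. 4 / \<beta> * P j)" by (rule summable_mult)
    then have "summable (\<lambda>j. if good j then real (T j) * (real (M j) * R j powr (-s)) else 0)"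
    proof (rule summable_comparison_test'[where N = j0])
      fix j assume j: "j0 \<le> j"
      show "norm (if good j then real (T j) * (real (M j) * R j powr (-s)) else 0) \<le> 4 / \<beta> * P j"
      proof (cases "good j")
        case True
        note c = par[OF j True]
        have "real (T j) * (real (M j) * R j powr (-s)) * \<beta> / 4
            \<le> (\<Sum>z\<in>words (M j + L j + T j * L j). of_bool (hit (R j) (M j) (T j) (L j) z) * W z)"
          unfolding \<beta>_def using c by (intro sum_W_hit_ge) auto
        also have "\<dots> = (\<Sum>z\<in>words (2 ^ j). of_bool (hit (R j) (M j) (T j) (L j) z) * W z)"
          using c by (intro sum_W_hit_extend[symmetric]) auto
        also have "\<dots> = P j" unfolding P_def H_def using True by simp
        finally show ?thesis using True \<beta> by (simp add: field_simps)
      next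
        case False
        then show ?thesis using P0[of j] \<beta> by simp
      qed
    qed
    with D show False by simp
  qed
  then have null: "hausdorff_outer s {cm \<omega> | \<omega>. \<forall>j\<ge>J. \<not> H j (map (\<lambda>i. \<omega> (2 ^ j + i)) [0..<2 ^ j])} = 0" for J
    unfolding P_def[abs_def] by (rule never_hit_null)
  define N where "N = (\<Union>J. {cm \<omega> | \<omega>. \<forall>j\<ge>J. \<not> H j (map (\<lambda>i. \<omega> (2 ^ j + i)) [0..<2 ^ j])})"
  show ?thesis
  proof (intro exI[of _ N] conjI allI impI)
    show "hausdorff_outer s N = 0" unfolding N_def by (rule hausdorff_outer_null_UN[OF null])
    fix \<omega> assume irr: "cm \<omega> \<notin> \<rat>" and bad: "\<forall>y \<in> \<rat> \<inter> limit_set p q r.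
        e * \<psi> (of_int (intrinsic_denom p q r y)) / of_int (intrinsic_denom p q r y) \<le> \<bar>cm \<omega> - y\<bar>"
    have "\<exists>J\<ge>j0. \<forall>j\<ge>J. \<not> (good j \<and> hit (R j) (M j) (T j) (L j) (map (\<lambda>i. \<omega> (2 ^ j + i)) [0..<2 ^ j]))"
    proof (rule bad_imp_finitely_many_hits[where \<psi> = \<psi>, OF irr e _ pos mono])
      show "e * \<psi> (of_int (intrinsic_denom p q r y)) / of_int (intrinsic_denom p q r y) \<le> \<bar>cm \<omega> - y\<bar>"
        if "y \<in> \<rat> \<inter> limit_set p q r" for y using bad that by blast
      fix j assume j: "j0 \<le> j" "good j"
      note c = par[OF j]
      have "e * C \<le> e * (\<psi> (real b ^ 2 ^ (j + 2)) * R j)" using c e by (intro mult_left_mono) auto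
      then have "2 * (d - c) < e * \<psi> (real b ^ 2 ^ (j + 2)) * R j" using C by (simp only: mult.assoc)
      with c show "1 \<le> R j \<and> R j \<le> 2 ^ L j \<and> M j + L j + T j * L j \<le> 2 ^ j \<and>
        2 * (d - c) < e * \<psi> (real b ^ 2 ^ (j + 2)) * R j" by blast
    qed
    then obtain J where "\<forall>j\<ge>J. \<not> H j (map (\<lambda>i. \<omega> (2 ^ j + i)) [0..<2 ^ j])"
      unfolding H_def by blast
    then show "cm \<omega> \<in> N" unfolding N_def by blast
  qed
qed

lemma divergence_case:
  assumes adm: "admissible_psi \<psi>" and ev1: "\<forall>\<^sub>F t in at_top. \<psi> t < 1"
    and div: "\<not> summable (\<lambda>n::nat. ln (real n) * \<psi> (real n) powr s / (real n * \<bar>ln (\<psi> (real n))\<bar>))"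
  shows "hausdorff_ae s (limit_set p q r) (sym_well_approx p q r \<psi>)"
proof -
  obtain t1 where t1: "2 \<le> t1" "\<And>t. t1 \<le> t \<Longrightarrow> 0 < \<psi> t" "\<And>s t. t1 \<le> s \<Longrightarrow> s \<le> t \<Longrightarrow> \<psi> t \<le> \<psi> s"
    using admissible_psi_pos_mono[OF adm] by blast
  obtain t2 where t2: "\<And>t. t2 \<le> t \<Longrightarrow> \<psi> t < 1" using ev1 by (auto simp: eventually_at_top_linorder)
  define t0 where "t0 = max t1 t2"
  have t0: "2 \<le> t0" using t1(1) by (simp add: t0_def)
  have pos: "0 < \<psi> t" if "t0 \<le> t" for t using that t1(2)[of t] by (simp add: t0_def)
  have lt1: "\<psi> t < 1" if "t0 \<le> t" for t using that t2[of t] by (simp add: t0_def)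
  have mono: "\<psi> t \<le> \<psi> t'" if "t0 \<le> t'" "t' \<le> t" for t t' using that t1(3)[of t' t] by (simp add: t0_def)
  let ?val = "\<lambda>y. \<psi> (of_int (intrinsic_denom p q r y)) / of_int (intrinsic_denom p q r y)"
  define bad where "bad e \<omega> \<longleftrightarrow> (\<forall>y \<in> \<rat> \<inter> limit_set p q r.
        e * \<psi> (of_int (intrinsic_denom p q r y)) / of_int (intrinsic_denom p q r y) \<le> \<bar>cm \<omega> - y\<bar>)" for e \<omega>
  have "\<exists>N. hausdorff_outer s N = 0 \<and> (\<forall>\<omega>. cm \<omega> \<notin> \<rat> \<longrightarrow> bad (1 / real (Suc i)) \<omega> \<longrightarrow> cm \<omega> \<in> N)" for i
    unfolding bad_def by (rule bad_with_constant_null[where \<psi> = \<psi>, OF _ t0 pos mono lt1 div]) simp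
  then obtain N where N: "\<And>i. hausdorff_outer s (N i) = 0"
    "\<And>i \<omega>. cm \<omega> \<notin> \<rat> \<Longrightarrow> bad (1 / real (Suc i)) \<omega> \<Longrightarrow> cm \<omega> \<in> N i" by metis
  have "hausdorff_outer s ((\<Union>i. N i) \<union> \<rat>) = 0"
    by (intro hausdorff_outer_null_Un hausdorff_outer_null_UN N(1) hausdorff_outer_null_countable
        countable_rat s_pos)
  moreover have "sym_well_approx p q r \<psi> x" if x: "x \<in> limit_set p q r - ((\<Union>i. N i) \<union> \<rat>)" for x
    unfolding sym_well_approx_def
  proof
    assume "badly_sym_approx p q r \<psi> x"
    then obtain e where e: "0 < e" and bade: "\<And>y. y \<in> \<rat> \<inter> limit_set p q r \<Longrightarrow> e * ?val y \<le> \<bar>x - y\<bar>"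
      by (auto simp: badly_sym_approx_def)
    obtain \<omega> where \<omega>: "x = cm \<omega>" using x by (auto simp: limit_set_iff)
    obtain i where i: "1 / real (Suc i) < e" using e reals_Archimedean[of e] by (auto simp: inverse_eq_divide)
    have "bad (1 / real (Suc i)) \<omega>"
      unfolding bad_def
    proof
      fix y assume y: "y \<in> \<rat> \<inter> limit_set p q r"
      \<comment> \<open>For small denominators the value of \<open>\<psi>\<close> may be negative;
        the inequality is then trivial, so the smaller constant is still admissible.\<close>
      have "1 / real (Suc i) * ?val y \<le> \<bar>x - y\<bar>"
      proof (cases "0 \<le> ?val y")
        case True
        have "1 / real (Suc i) * ?val y \<le> e * ?val y" using True i by (intro mult_right_mono) auto
        with bade[OF y] show ?thesis by linarith
      next
        case False
        then have "1 / real (Suc i) * ?val y \<le> 0" by (intro mult_nonneg_nonpos) auto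
        then show ?thesis by linarith
      qed
      then show "1 / real (Suc i) * \<psi> (of_int (intrinsic_denom p q r y)) / of_int (intrinsic_denom p q r y) \<le> \<bar>cm \<omega> - y\<bar>"
        by (simp only: \<omega> times_divide_eq_right)
    qed
    then have "x \<in> N i" using N(2) x \<omega> by blast
    then show False using x by blast
  qed
  ultimately show ?thesis unfolding hausdorff_ae_def by blast
qed

end

subsection \<open>The main theorem\<close>

text \<open>Intermediate value theorem: at exponent 0 the sum is the number of letters; at
  \<open>T\<close>, where \<open>2 powr (-T)\<close> is the reciprocal of that number, it is at most
  1.\<close>

lemma moran_equation_solvable:
  fixes q :: "'e::finite \<Rightarrow> nat"
  assumes card: "2 \<le> CARD('e)" and q: "\<And>a. 2 \<le> q a"
  obtains s where "0 < s" "(\<Sum>a\<in>UNIV. real (q a) powr (-s)) = 1"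
proof -
  define f where "f t = (\<Sum>a\<in>UNIV. real (q a) powr (-t))" for t
  define T where "T = log 2 (real CARD('e))"
  have q0: "q a \<noteq> 0" for a using q[of a] by simp
  have T0: "0 \<le> T" using card by (simp add: T_def)
  have "f 0 = (\<Sum>a\<in>(UNIV :: 'e set). 1)" unfolding f_def by (intro sum.cong) (use q0 in auto)
  then have f0: "f 0 = real CARD('e)" by simp
  have "f T \<le> (\<Sum>a\<in>(UNIV :: 'e set). 2 powr (-T))"
    unfolding f_def using q T0 by (intro sum_mono powr_mono2') auto
  also have "\<dots> = 1" using card by (simp add: T_def powr_minus_divide)
  finally have fT: "f T \<le> 1" .
  have "continuous_on {0..T} f"
    unfolding f_def using q0 by (intro continuous_intros) auto
  then obtain s where s: "0 \<le> s" "f s = 1"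
    using IVT2'[of f T 1 0] f0 fT card T0 by auto
  have "s \<noteq> 0" using s(2) f0 card by auto
  with s show ?thesis by (intro that[of s]) (auto simp: f_def)
qed

text \<open>Disjoint compact images have positive distance, and there are finitely many pairs of
  letters. A one-point interval is impossible: every branch would fix its point, so two images would
  meet.\<close>

lemma strong_separation_gap:
  fixes p r :: "'e::finite \<Rightarrow> int" and q :: "'e \<Rightarrow> nat"
  assumes card: "2 \<le> CARD('e)" and "strong_separation p q r"
  obtains c d g where "c < d" "0 < g" "\<forall>a. \<forall>x\<in>{c..d}. ifs_map p q r a x \<in> {c..d}"
    "\<forall>a a'. a \<noteq> a' \<longrightarrow> (\<forall>x\<in>{c..d}. \<forall>y\<in>{c..d}. g \<le> \<bar>ifs_map p q r a x - ifs_map p q r a' y\<bar>)"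
proof -
  from assms(2)[unfolded strong_separation_def]
  obtain c d where cd: "c \<le> d" and sub: "\<forall>a. ifs_map p q r a ` {c..d} \<subseteq> {c..d}"
    and disj': "\<forall>a b. a \<noteq> b \<longrightarrow> ifs_map p q r a ` {c..d} \<inter> ifs_map p q r b ` {c..d} = {}"
    by (elim exE conjE) (rule that)
  note disj = disj'[rule_format]
  have in_cd: "ifs_map p q r a x \<in> {c..d}" if "x \<in> {c..d}" for a x using sub that by blast
  have "c \<noteq> d"
  proof
    assume eq: "c = d"
    have "\<not> card (UNIV :: 'e set) \<le> Suc 0" using card by simp
    then obtain a b :: 'e where ab: "a \<noteq> b" by (auto simp: card_le_Suc0_iff_eq)
    have "ifs_map p q r a c = c" "ifs_map p q r b c = c" using in_cd[of c a] in_cd[of c b] eq by auto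
    moreover have "c \<in> ifs_map p q r a ` {c..d}" if "ifs_map p q r a c = c" for a
      by (rule image_eqI[of _ _ c]) (use that cd in auto)
    ultimately have "c \<in> ifs_map p q r a ` {c..d} \<inter> ifs_map p q r b ` {c..d}" by blast
    with disj[OF ab] show False by blast
  qed
  have comp: "compact (ifs_map p q r a ` {c..d})" for a
    unfolding ifs_map_def by (intro compact_continuous_image continuous_intros) auto
  have "\<exists>g>0. \<forall>x\<in>{c..d}. \<forall>y\<in>{c..d}. g \<le> \<bar>ifs_map p q r a x - ifs_map p q r b y\<bar>" if "a \<noteq> b" for a b
    using separate_compact_closed[OF comp[of a] compact_imp_closed[OF comp[of b]] disj[OF that]]
    by (auto simp: dist_real_def)
  then obtain h where h: "\<And>a b. a \<noteq> b \<Longrightarrow> 0 < h a b"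
    "\<And>a b x y. a \<noteq> b \<Longrightarrow> x \<in> {c..d} \<Longrightarrow> y \<in> {c..d} \<Longrightarrow> h a b \<le> \<bar>ifs_map p q r a x - ifs_map p q r b y\<bar>"
    by metis
  define F where "F = {(a :: 'e, b). a \<noteq> b}"
  define hh where "hh z = h (fst z) (snd z)" for z
  have fin: "finite F" by simp
  have pos: "0 < hh z" if "z \<in> F" for z
    using that h(1) by (auto simp: F_def hh_def)
  obtain g where g: "0 < g" "g \<le> 1" "\<And>z. z \<in> F \<Longrightarrow> g \<le> hh z"
    using finite_positive_lower_bound[of F hh] fin pos by blast
  show ?thesis
  proof (rule that[of c d g])
    show "c < d" using cd \<open>c \<noteq> d\<close> by simp
    have "g \<le> \<bar>ifs_map p q r a x - ifs_map p q r a' y\<bar>" if "a \<noteq> a'" "x \<in> {c..d}" "y \<in> {c..d}" for a a' x y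
      using g(3)[of "(a, a')"] h(2)[OF that] that(1) by (simp add: F_def hh_def)
    then show "\<forall>a a'. a \<noteq> a' \<longrightarrow>
        (\<forall>x\<in>{c..d}. \<forall>y\<in>{c..d}. g \<le> \<bar>ifs_map p q r a x - ifs_map p q r a' y\<bar>)" by blast
    show "\<forall>a. \<forall>x\<in>{c..d}. ifs_map p q r a x \<in> {c..d}" using in_cd by blast
  qed (rule g(1))
qed

section \<open>The logarithmic examples\<close>

lemma admissible_ln_powr:
  assumes \<alpha>: "0 < \<alpha>" shows "admissible_psi (\<lambda>t. ln t powr (-\<alpha>))"
  unfolding admissible_psi_def
proof (intro conjI allI impI)
  have ev: "\<forall>\<^sub>F t in at_top. K \<le> ln (t::real)" for K
    using ln_at_top by (simp add: filterlim_at_top)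
  show "\<forall>\<^sub>F t in at_top. 0 < ln (t::real) powr (-\<alpha>)"
    using ev[of 1] by eventually_elim auto
  show "\<exists>T. \<forall>s t. T \<le> s \<longrightarrow> s \<le> t \<longrightarrow> ln t powr (-\<alpha>) \<le> ln s powr (-\<alpha>)"
    by (rule exI[of _ "2::real"]) (use \<alpha> in \<open>auto intro!: powr_mono2'\<close>)
  have "\<forall>\<^sub>F t in at_top. ln (t::real) powr (-\<alpha>) \<le> 1"
    using ev[of 1]
  proof eventually_elim
    case (elim t)
    then show ?case using \<alpha> powr_mono2'[of "-\<alpha>" 1 "ln t"] by simp
  qed
  then show "\<exists>B. \<forall>\<^sub>F t in at_top. ln (t::real) powr (-\<alpha>) \<le> B" by blast
  fix K :: real assume K: "0 < K"
  have "\<forall>\<^sub>F t in at_top. 2 powr (-\<alpha>) * ln t powr (-\<alpha>) \<le> ln (K * t) powr (-\<alpha>) \<and>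
      ln (K * t) powr (-\<alpha>) \<le> (1/2) powr (-\<alpha>) * ln t powr (-\<alpha>)"
    using ev[of "2 * \<bar>ln K\<bar> + 1"] eventually_gt_at_top[of 0]
  proof eventually_elim
    case (elim t)
    define l where "l = ln t"
    have "ln (K * t) = ln K + l" using K elim by (simp add: ln_mult l_def)
    \<comment> \<open>The threshold \<open>2 * \<bar>ln K\<bar> + 1\<close> for \<open>ln t\<close>
      makes \<open>\<bar>ln K\<bar>\<close> at most half of \<open>ln t\<close>.\<close>
    then have b: "0 < 1/2 * l" "1/2 * l \<le> ln (K * t)" "ln (K * t) \<le> 2 * l" "0 < l" using elim(1) by (auto simp: l_def)
    have "(2 * l) powr (-\<alpha>) \<le> ln (K * t) powr (-\<alpha>)" using \<alpha> b by (intro powr_mono2') auto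
    moreover have "ln (K * t) powr (-\<alpha>) \<le> (1/2 * l) powr (-\<alpha>)" using \<alpha> b by (intro powr_mono2') auto
    moreover have "(2 * l) powr (-\<alpha>) = 2 powr (-\<alpha>) * l powr (-\<alpha>)"
        "(1/2 * l) powr (-\<alpha>) = (1/2) powr (-\<alpha>) * l powr (-\<alpha>)"
      using b(4) by (auto simp only: powr_mult)
    ultimately show ?case by (simp only: l_def)
  qed
  then show "\<exists>c C. 0 < c \<and> 0 < C \<and> (\<forall>\<^sub>F t in at_top. c * ln t powr (-\<alpha>) \<le> ln (K * t) powr (-\<alpha>) \<and>
      ln (K * t) powr (-\<alpha>) \<le> C * ln t powr (-\<alpha>))"
    by (intro exI[of _ "2 powr (-\<alpha>)"] exI[of _ "(1/2) powr (-\<alpha>)"]) auto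
qed

lemma ln_gt_1: "4 \<le> t \<Longrightarrow> 1 < ln (t::real)"
proof -
  assume "4 \<le> t"
  then have "exp 1 < t" using exp_le by linarith
  then show ?thesis using ln_less_cancel_iff[of "exp 1" t] \<open>4 \<le> t\<close> by simp
qed

lemma summable_ln_powr:
  assumes \<eta>: "0 < \<eta>" shows "summable (\<lambda>n::nat. ln (real n) powr (-(1 + \<eta>)) / real n)"
proof (rule summable_from_blocks[where B = "\<lambda>k. 2 ^ (k + 1)"])
  show "strict_mono (\<lambda>k. 2 ^ (k + 1) :: nat)" by (intro strict_monoI power_strict_increasing) auto
  show "0 \<le> ln (real n) powr (-(1 + \<eta>)) / real n" for n by simp
  define g where "g k = real k powr (-(1 + \<eta>))" for k
  have "summable g" unfolding g_def using \<eta> by (subst summable_real_powr_iff) simp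
  then have "summable (\<lambda>k. g (k + 1))" by (simp only: summable_iff_shift)
  then have "summable (\<lambda>k. ln 2 powr (-(1 + \<eta>)) * g (k + 1))" by (rule summable_mult)
  then show "summable (\<lambda>k. \<Sum>n\<in>{2 ^ (k + 1)..<2 ^ (Suc k + 1)}. ln (real n) powr (-(1 + \<eta>)) / real n)"
  proof (rule summable_comparison_test'[where N = 0])
    fix k
    have "(\<Sum>n\<in>{2 ^ (k + 1)..<2 ^ (Suc k + 1)}. ln (real n) powr (-(1 + \<eta>)) / real n)
        \<le> (\<Sum>n\<in>{2 ^ (k + 1)..<2 ^ (Suc k + 1) :: nat}. (real (k + 1) * ln 2) powr (-(1 + \<eta>)) / 2 ^ (k + 1))"
    proof (rule sum_mono)
      fix n :: nat assume "n \<in> {2 ^ (k + 1)..<2 ^ (Suc k + 1)}"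
      then have "real (2 ^ (k + 1)) \<le> real n" by (intro of_nat_mono) auto
      then have n: "2 ^ (k + 1) \<le> real n" by (simp only: of_nat_power of_nat_numeral)
      have "real (k + 1) * ln 2 = ln (2 ^ (k + 1))" by (simp only: ln_realpow zero_less_numeral)
      also have "\<dots> \<le> ln (real n)" using n by (intro ln_mono) auto
      finally have "ln (real n) powr (-(1 + \<eta>)) \<le> (real (k + 1) * ln 2) powr (-(1 + \<eta>))"
        using \<eta> by (intro powr_mono2') auto
      then show "ln (real n) powr (-(1 + \<eta>)) / real n \<le> (real (k + 1) * ln 2) powr (-(1 + \<eta>)) / 2 ^ (k + 1)"
        using n by (intro frac_le) auto
    qed
    also have "\<dots> = (real (k + 1) * ln 2) powr (-(1 + \<eta>))" by simp
    also have "\<dots> = ln 2 powr (-(1 + \<eta>)) * g (k + 1)" by (simp only: g_def powr_mult mult.commute)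
    finally show "norm (\<Sum>n\<in>{2 ^ (k + 1)..<2 ^ (Suc k + 1)}. ln (real n) powr (-(1 + \<eta>)) / real n)
        \<le> ln 2 powr (-(1 + \<eta>)) * g (k + 1)" by (simp add: sum_nonneg)
  qed
qed

text \<open>Reuses \<open>summable_condensed\<close> with
  \<open>\<psi> t = 1 / (ln t)\<^sup>2\<close> and exponent 1; the condensed series dominates the
  harmonic series.\<close>

lemma not_summable_inverse_n_ln: "\<not> summable (\<lambda>n::nat. 1 / (real n * ln (real n)))"
proof
  assume sum: "summable (\<lambda>n::nat. 1 / (real n * ln (real n)))"
  define \<psi> where "\<psi> t = 1 / (ln t * ln t)" for t :: real
  have eq: "\<forall>\<^sub>F n in sequentially. 1 / (real n * ln (real n)) = ln (real n) * \<psi> (real n) powr 1 / real n"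
    using eventually_ge_at_top[of 4]
  proof eventually_elim
    case (elim n)
    then show ?case using ln_gt_1[of "real n"] by (simp add: \<psi>_def)
  qed
  have "summable (\<lambda>k. real k * \<psi> (2 ^ (k - 1)) powr 1)"
  proof (rule summable_condensed[where T = 4])
    show "0 < \<psi> t" if "4 \<le> t" for t using ln_gt_1[OF that] by (simp add: \<psi>_def)
    show "\<psi> t \<le> \<psi> t'" if "4 \<le> t'" "t' \<le> t" for t' t
      unfolding \<psi>_def using ln_gt_1[of t'] ln_gt_1[of t] that by (intro divide_left_mono mult_mono) auto
    show "summable (\<lambda>n. ln (real n) * \<psi> (real n) powr 1 / real n)"
      using sum summable_cong[OF eq] by simp
  qed auto
  then have "summable (\<lambda>k. inverse (real k))"
  proof (rule summable_comparison_test'[where N = 3])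
    fix k :: nat assume k: "3 \<le> k"
    define l where "l = ln ((2::real) ^ (k - 1))"
    have l: "l = real (k - 1) * ln 2" by (simp only: l_def ln_realpow zero_less_numeral)
    have l0: "0 < l" using k by (simp add: l)
    have "l \<le> real k * 1" unfolding l using ln_2_less_1 by (intro mult_mono) auto
    then have "l * l \<le> real k * real k" using l0 by (intro mult_mono) auto
    then have "real k * (1 / (real k * real k)) \<le> real k * (1 / (l * l))"
      using l0 k by (intro mult_left_mono divide_left_mono) auto
    moreover have "\<psi> (2 ^ (k - 1)) = 1 / (l * l)" by (simp only: \<psi>_def l_def)
    ultimately show "norm (inverse (real k)) \<le> real k * \<psi> (2 ^ (k - 1)) powr 1"
      using k l0 by (simp add: inverse_eq_divide)
  qed
  then show False using not_summable_harmonic[where 'a = real] by simp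
qed

text \<open>The same device once more: the condensed series now dominates that of
  \<open>1 / (k * ln k)\<close>.\<close>

lemma not_summable_inverse_n_ln_ln: "\<not> summable (\<lambda>n::nat. 1 / (real n * ln (real n) * ln (ln (real n))))"
proof
  assume sum: "summable (\<lambda>n::nat. 1 / (real n * ln (real n) * ln (ln (real n))))"
  define \<psi> where "\<psi> t = 1 / (ln t * ln t * ln (ln t))" for t :: real
  have eq: "\<forall>\<^sub>F n in sequentially. 1 / (real n * ln (real n) * ln (ln (real n)))
      = ln (real n) * \<psi> (real n) powr 1 / real n"
    using eventually_ge_at_top[of 4]
  proof eventually_elim
    case (elim n)
    then show ?case using ln_gt_1[of "real n"] by (simp add: \<psi>_def)
  qed
  have "summable (\<lambda>k. real k * \<psi> (2 ^ (k - 1)) powr 1)"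
  proof (rule summable_condensed[where T = 4])
    show "0 < \<psi> t" if "4 \<le> t" for t using ln_gt_1[OF that] by (simp add: \<psi>_def)
    show "\<psi> t \<le> \<psi> t'" if "4 \<le> t'" "t' \<le> t" for t' t
    proof -
      have "1 < ln t'" "ln t' \<le> ln t" using ln_gt_1[of t'] that by auto
      then show ?thesis unfolding \<psi>_def by (intro divide_left_mono mult_mono) auto
    qed
    show "summable (\<lambda>n. ln (real n) * \<psi> (real n) powr 1 / real n)"
      using sum summable_cong[OF eq] by simp
  qed auto
  then have "summable (\<lambda>k. 1 / (real k * ln (real k)))"
  proof (rule summable_comparison_test'[where N = 4])
    fix k :: nat assume k: "4 \<le> k"
    define l where "l = ln ((2::real) ^ (k - 1))"
    have l: "l = real (k - 1) * ln 2" by (simp only: l_def ln_realpow zero_less_numeral)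
    have "(2::real) ^ 2 \<le> 2 ^ (k - 1)" using k by (intro power_increasing) auto
    then have l1: "1 < l" unfolding l_def by (intro ln_gt_1) simp
    have lk: "l \<le> real k"
    proof -
      have "l \<le> real k * 1" unfolding l using ln_2_less_1 by (intro mult_mono) auto
      then show ?thesis by simp
    qed
    then have "l * l * ln l \<le> real k * real k * ln (real k)" using l1 by (intro mult_mono) auto
    then have "real k * (1 / (real k * real k * ln (real k))) \<le> real k * (1 / (l * l * ln l))"
      using l1 lk by (intro mult_left_mono divide_left_mono) auto
    moreover have "\<psi> (2 ^ (k - 1)) = 1 / (l * l * ln l)" by (simp only: \<psi>_def l_def)
    ultimately show "norm (1 / (real k * ln (real k))) \<le> real k * \<psi> (2 ^ (k - 1)) powr 1"
      using k l1 by simp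
  qed
  then show False using not_summable_inverse_n_ln by simp
qed

theorem theorem4p5:
  fixes p r :: "'e::finite \<Rightarrow> int" and q :: "'e \<Rightarrow> nat"
  assumes card_E: "CARD('e) \<ge> 2"
    and p_unit: "\<forall>a. p a = 1 \<or> p a = -1"
    and q_ge2: "\<forall>a. q a \<ge> 2"
    and ssc: "strong_separation p q r"
  defines "J \<equiv> limit_set p q r"
    and "\<delta> \<equiv> hausdorff_dim (limit_set p q r)"
  shows
    "(\<forall>\<psi>. admissible_psi \<psi> \<longrightarrow>
        summable (\<lambda>n::nat. ln (real n) * \<psi> (real n) powr \<delta> / real n) \<longrightarrow>
        hausdorff_ae \<delta> J (badly_sym_approx p q r \<psi>))
   \<and> (\<forall>\<psi>. admissible_psi \<psi> \<longrightarrow> (\<forall>\<^sub>F t in at_top. \<psi> t < 1) \<longrightarrow>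
        \<not> summable (\<lambda>n::nat. ln (real n) * \<psi> (real n) powr \<delta> / (real n * \<bar>ln (\<psi> (real n))\<bar>)) \<longrightarrow>
        hausdorff_ae \<delta> J (sym_well_approx p q r \<psi>))
   \<and> (\<forall>\<epsilon>>0. let \<psi> = (\<lambda>t. ln t powr (- (2 / \<delta> + \<epsilon>))) in
        admissible_psi \<psi> \<and>
        summable (\<lambda>n::nat. ln (real n) * \<psi> (real n) powr \<delta> / real n) \<and>
        hausdorff_ae \<delta> J (badly_sym_approx p q r \<psi>))
   \<and> (let \<psi> = (\<lambda>t. ln t powr (- (2 / \<delta>))) in
        admissible_psi \<psi> \<and> (\<forall>\<^sub>F t in at_top. \<psi> t < 1) \<and>
        \<not> summable (\<lambda>n::nat. ln (real n) * \<psi> (real n) powr \<delta> / (real n * \<bar>ln (\<psi> (real n))\<bar>)) \<and>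
        hausdorff_ae \<delta> J (sym_well_approx p q r \<psi>))"
proof -
  have q2: "2 \<le> q a" for a using q_ge2 by blast
  obtain s where s: "0 < s" "(\<Sum>a\<in>UNIV. real (q a) powr (-s)) = 1"
    by (rule moran_equation_solvable[OF card_E q2])
  obtain c d g where cdg: "c < d" "0 < g" "\<forall>a. \<forall>x\<in>{c..d}. ifs_map p q r a x \<in> {c..d}"
    "\<forall>a a'. a \<noteq> a' \<longrightarrow> (\<forall>x\<in>{c..d}. \<forall>y\<in>{c..d}. g \<le> \<bar>ifs_map p q r a x - ifs_map p q r a' y\<bar>)"
    by (rule strong_separation_gap[OF card_E ssc])
  interpret rational_ifs p r q c d g s "Max (range q)"
  proof
    show "p a = 1 \<or> p a = -1" for a using p_unit by blast
    show "q a \<le> Max (range q)" for a by (rule Max_ge) auto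
    show "ifs_map p q r a x \<in> {c..d}" if "x \<in> {c..d}" for a x using cdg(3) that by blast
    show "g \<le> \<bar>ifs_map p q r a x - ifs_map p q r a' y\<bar>" if "a \<noteq> a'" "x \<in> {c..d}" "y \<in> {c..d}" for a a' x y
      using cdg(4) that by blast
  qed (fact q2 cdg s)+
  have \<delta>: "\<delta> = s" unfolding \<delta>_def by (rule hausdorff_dim_limit_set)
  have conv: "hausdorff_ae \<delta> J (badly_sym_approx p q r \<psi>)"
    if "admissible_psi \<psi>" "summable (\<lambda>n::nat. ln (real n) * \<psi> (real n) powr \<delta> / real n)" for \<psi>
    using convergence_case[OF that(1)] that(2) unfolding \<delta> J_def by blast
  have dive: "hausdorff_ae \<delta> J (sym_well_approx p q r \<psi>)"
    if "admissible_psi \<psi>" "\<forall>\<^sub>F t in at_top. \<psi> t < 1"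
      "\<not> summable (\<lambda>n::nat. ln (real n) * \<psi> (real n) powr \<delta> / (real n * \<bar>ln (\<psi> (real n))\<bar>))" for \<psi>
    using divergence_case[OF that(1,2)] that(3) unfolding \<delta> J_def by blast
  have \<delta>0: "0 < \<delta>" using s(1) \<delta> by simp
  have ex1: "admissible_psi (\<lambda>t. ln t powr (- (2 / \<delta> + \<epsilon>)))"
    "summable (\<lambda>n::nat. ln (real n) * (ln (real n) powr (- (2 / \<delta> + \<epsilon>))) powr \<delta> / real n)"
    if \<epsilon>: "0 < \<epsilon>" for \<epsilon> :: real
  proof -
    show "admissible_psi (\<lambda>t. ln t powr (- (2 / \<delta> + \<epsilon>)))"
      using \<epsilon> \<delta>0 by (intro admissible_ln_powr) (simp add: add_pos_pos)
    \<comment> \<open>Multiplying the exponent by \<open>\<delta>\<close> gives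
      \<open>-(2 + \<delta> * \<epsilon>)\<close>, and the factor \<open>ln n\<close> removes one
      power.\<close>
    have "\<forall>\<^sub>F n in sequentially. ln (real n) powr (-(1 + \<delta> * \<epsilon>)) / real n
        = ln (real n) * (ln (real n) powr (- (2 / \<delta> + \<epsilon>))) powr \<delta> / real n"
      using eventually_ge_at_top[of 4]
    proof eventually_elim
      case (elim n)
      define l where "l = ln (real n)"
      have l: "0 < l" using elim ln_gt_1[of "real n"] by (simp add: l_def)
      have "(l powr (- (2 / \<delta> + \<epsilon>))) powr \<delta> = l powr (- (2 + \<delta> * \<epsilon>))"
      proof -
        have "- (2 / \<delta> + \<epsilon>) * \<delta> = - (2 + \<delta> * \<epsilon>)" using \<delta>0 by (simp add: algebra_simps)
        then show ?thesis by (simp only: powr_powr)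
      qed
      moreover have "l * l powr (- (2 + \<delta> * \<epsilon>)) = l powr 1 * l powr (- (2 + \<delta> * \<epsilon>))" using l by simp
      moreover have "l powr 1 * l powr (- (2 + \<delta> * \<epsilon>)) = l powr (-(1 + \<delta> * \<epsilon>))"
        unfolding powr_add[symmetric] by simp
      ultimately show ?case unfolding l_def[symmetric] by (simp only:)
    qed
    from summable_cong[OF this] summable_ln_powr[of "\<delta> * \<epsilon>"]
    show "summable (\<lambda>n::nat. ln (real n) * (ln (real n) powr (- (2 / \<delta> + \<epsilon>))) powr \<delta> / real n)"
      using \<epsilon> \<delta>0 by simp
  qed
  have ex2: "admissible_psi (\<lambda>t. ln t powr (- (2 / \<delta>)))" using \<delta>0 by (intro admissible_ln_powr) simp
  have ex3: "\<forall>\<^sub>F t in at_top. ln t powr (- (2 / \<delta>)) < (1::real)"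
    using eventually_ge_at_top[of 4]
  proof eventually_elim
    case (elim t)
    then show ?case using ln_gt_1[OF elim] \<delta>0 powr_less_mono[of "- (2 / \<delta>)" 0 "ln t"] by simp
  qed
  have ex4: "\<not> summable (\<lambda>n::nat. ln (real n) * (ln (real n) powr (- (2 / \<delta>))) powr \<delta> /
      (real n * \<bar>ln (ln (real n) powr (- (2 / \<delta>)))\<bar>))"
  proof
    assume sum: "summable (\<lambda>n::nat. ln (real n) * (ln (real n) powr (- (2 / \<delta>))) powr \<delta> /
      (real n * \<bar>ln (ln (real n) powr (- (2 / \<delta>)))\<bar>))"
    \<comment> \<open>Here \<open>\<bar>ln \<psi>\<bar> = 2 / \<delta> * ln (ln n)\<close> and
      \<open>\<psi> powr \<delta> = 1 / (ln n)\<^sup>2\<close>, which leaves the iterated logarithm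
      series.\<close>
    have "\<forall>\<^sub>F n in sequentially. ln (real n) * (ln (real n) powr (- (2 / \<delta>))) powr \<delta> /
      (real n * \<bar>ln (ln (real n) powr (- (2 / \<delta>)))\<bar>) = \<delta> / 2 * (1 / (real n * ln (real n) * ln (ln (real n))))"
      using eventually_ge_at_top[of 4]
    proof eventually_elim
      case (elim n)
      define l where "l = ln (real n)"
      have l: "1 < l" using elim ln_gt_1[of "real n"] by (simp add: l_def)
      have "(l powr (- (2 / \<delta>))) powr \<delta> = l powr (-2)" using \<delta>0 by (simp add: powr_powr)
      also have "\<dots> = 1 / (l * l)" using l by (simp add: powr_minus_divide power2_eq_square)
      finally have 1: "l * (l powr (- (2 / \<delta>))) powr \<delta> = 1 / l" using l by simp
      have 2: "\<bar>ln (l powr (- (2 / \<delta>)))\<bar> = 2 / \<delta> * ln l" using l \<delta>0 by (simp add: ln_powr abs_mult)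
      show ?case unfolding l_def[symmetric] 1 2 using \<delta>0 by simp
    qed
    from summable_cong[OF this] sum
    have "summable (\<lambda>n::nat. \<delta> / 2 * (1 / (real n * ln (real n) * ln (ln (real n)))))" by simp
    then have "summable (\<lambda>n::nat. 1 / (real n * ln (real n) * ln (ln (real n))))"
      using \<delta>0 by (subst (asm) summable_cmult_iff) auto
    with not_summable_inverse_n_ln_ln show False by simp
  qed
  show ?thesis
    unfolding Let_def
    by (intro conjI allI impI conv dive ex1 ex2 ex3 ex4)
qed

end
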